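(* Let $n\ge5$, $N\ge2$ and let $\mathbf{A}\in\mathbb{S}(N\times n)$ be rank-one positive with ellipticity constant $\nu(\mathbf{A})$. Then $$\big\|D^2u\big\|_{L^2(\mathbb{R}^n)}\le\frac{1}{\nu(\mathbf{A})}\big\|\mathbf{A}:D^2u\big\|_{L^2(\mathbb{R}^n)}$$ for all $u\in W^{2,2}_\ast(\mathbb{R}^n)^N$.
   Context: Repeated indices are summed ($i,j$ over $1,\dots,n$; $\alpha,\beta$ over $1,\dots,N$). $\mathbb{S}(N\times n)$ is the set of real tensors $\mathbf{A}=(\mathbf{A}_{\alpha\beta ij})$ with $\mathbf{A}_{\alpha\beta ij}=\mathbf{A}_{\beta\alpha ji}$. $\mathbf{A}:D^2u$ is the $\mathbb{R}^N$-valued map with components $(\mathbf{A}:D^2u)_\alpha=\mathbf{A}_{\alpha\beta ij}D^2_{ij}u_\beta$. The ellipticity constant is $$\nu(\mathbf{A}):=\min\{\mathbf{A}_{\alpha\beta ij}\eta_\alpha a_i\eta_\beta a_j:\ \eta\in\mathbb{R}^N,\ a\in\mathbb{R}^n,\ |\eta|=|a|=1\},$$ and $\mathbf{A}$ is called rank-one positive if $\nu(\mathbf{A})>0$. Pointwise norms are Euclidean, e.g. $|D^2u|^2=D^2_{ij}u_\alpha D^2_{ij}u_\alpha$. With $2^*=\frac{2n}{n-2}$ and $2^{**}=\frac{2n}{n-4}$, $$W^{2,2}_\ast(\mathbb{R}^n)^N:=\big\{u\in L^{2^{**}}(\mathbb{R}^n)^N\ \big|\ Du\in L^{2^*}(\mathbb{R}^n)^{Nn},\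 D^2u\in L^2(\mathbb{R}^n)^{Nn^2}\big\}$$ (weak derivatives). *)

theory Defs
  imports "HOL-Analysis.Analysis"
begin

section \<open>Tensors\<close>

definition tensors_S :: "(real^'n^'n^'N^'N) set" where
  "tensors_S = {A. \<forall>\<alpha> \<beta> i j. A $ \<alpha> $ \<beta> $ i $ j = A $ \<beta> $ \<alpha> $ j $ i}"

definition rank_one_form :: "real^'n^'n^'N^'N \<Rightarrow> real^'N \<Rightarrow> real^'n \<Rightarrow> real" where
  "rank_one_form A \<eta> a =
    (\<Sum>\<alpha>\<in>UNIV. \<Sum>\<beta>\<in>UNIV. \<Sum>i\<in>UNIV. \<Sum>j\<in>UNIV.
       A $ \<alpha> $ \<beta> $ i $ j * \<eta> $ \<alpha> * a $ i * \<eta> $ \<beta> * a $ j)"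

definition ellipticity_constant :: "real^'n^'n^'N^'N \<Rightarrow> real" where
  "ellipticity_constant A =
    (LEAST m. m \<in> {rank_one_form A \<eta> a | \<eta> a. norm \<eta> = 1 \<and> norm a = 1})"

text \<open>The minimum exists, so the \<open>LEAST\<close> above denotes it.\<close>

lemma ellipticity_constant_attained:
  fixes A :: "real^'n^'n^'N^'N"
  obtains \<eta> a where "norm \<eta> = 1" "norm a = 1" "ellipticity_constant A = rank_one_form A \<eta> a"
    "\<And>\<eta>' a'. norm \<eta>' = 1 \<Longrightarrow> norm a' = 1 \<Longrightarrow> ellipticity_constant A \<le> rank_one_form A \<eta>' a'"
proof -
  let ?K = "sphere (0::real^'N) 1 \<times> sphere (0::real^'n) 1"
  have "compact ?K"
    by (intro compact_Times compact_sphere)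
  moreover have "?K \<noteq> {}"
    using sphere_eq_empty[of "0::real^'N" 1] sphere_eq_empty[of "0::real^'n" 1] by auto
  moreover have "continuous_on ?K (\<lambda>p. rank_one_form A (fst p) (snd p))"
    unfolding rank_one_form_def by (intro continuous_intros)
  ultimately obtain p where p: "p \<in> ?K"
    "\<forall>q\<in>?K. rank_one_form A (fst p) (snd p) \<le> rank_one_form A (fst q) (snd q)"
    using continuous_attains_inf by meson
  obtain \<eta> a where pq: "p = (\<eta>, a)" by fastforce
  have n: "norm \<eta> = 1" "norm a = 1"
    using p(1) pq by auto
  have le: "rank_one_form A \<eta> a \<le> rank_one_form A \<eta>' a'" if "norm \<eta>' = 1" "norm a' = 1" for \<eta>' a'
    using p(2) pq that by force
  have "ellipticity_constant A = rank_one_form A \<eta> a"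
    unfolding ellipticity_constant_def using n le by (intro Least_equality) auto
  then show thesis
    using that n le by metis
qed

definition rank_one_positive :: "real^'n^'n^'N^'N \<Rightarrow> bool" where
  "rank_one_positive A \<longleftrightarrow> ellipticity_constant A > 0"

text \<open>A second derivative \<open>D\<^sup>2\<^sub>i\<^sub>j u\<^sub>\<alpha>\<close> is stored at position \<open>\<alpha>, i, j\<close>; the library norm on
  \<open>real^'n^'n^'N\<close> is the Euclidean norm of all entries.\<close>

definition tensor_contract :: "real^'n^'n^'N^'N \<Rightarrow> real^'n^'n^'N \<Rightarrow> real^'N" where
  "tensor_contract A X =
    (\<chi> \<alpha>. \<Sum>\<beta>\<in>UNIV. \<Sum>i\<in>UNIV. \<Sum>j\<in>UNIV. A $ \<alpha> $ \<beta> $ i $ j * X $ \<beta> $ i $ j)"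


section \<open>Lebesgue spaces\<close>

definition in_Lp :: "real \<Rightarrow> ('a::euclidean_space \<Rightarrow> 'b::euclidean_space) \<Rightarrow> bool" where
  "in_Lp p f \<longleftrightarrow> f \<in> borel_measurable lebesgue \<and> integrable lebesgue (\<lambda>x. norm (f x) powr p)"

definition Lp_norm :: "real \<Rightarrow> ('a::euclidean_space \<Rightarrow> 'b::euclidean_space) \<Rightarrow> real" where
  "Lp_norm p f = (LINT x|lebesgue. norm (f x) powr p) powr (1 / p)"

definition locally_integrable :: "('a::euclidean_space \<Rightarrow> real) \<Rightarrow> bool" where
  "locally_integrable f \<longleftrightarrow> (\<forall>K. compact K \<longrightarrow> set_integrable lebesgue K f)"


section \<open>Test functions and weak derivatives\<close>

definition partial_derivative :: "'n \<Rightarrow> (real^'n \<Rightarrow> real) \<Rightarrow> real^'n \<Rightarrow> real" where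
  "partial_derivative i f x = frechet_derivative f (at x) (axis i 1)"

fun C_k :: "nat \<Rightarrow> (real^'n \<Rightarrow> real) \<Rightarrow> bool" where
  "C_k 0 f \<longleftrightarrow> continuous_on UNIV f"
| "C_k (Suc k) f \<longleftrightarrow> f differentiable_on UNIV \<and> (\<forall>i. C_k k (partial_derivative i f))"

definition test_function :: "(real^'n \<Rightarrow> real) \<Rightarrow> bool" where
  "test_function \<phi> \<longleftrightarrow> (\<forall>k. C_k k \<phi>) \<and> compact (closure {x. \<phi> x \<noteq> 0})"

definition has_weak_partial :: "(real^'n \<Rightarrow> real) \<Rightarrow> 'n \<Rightarrow> (real^'n \<Rightarrow> real) \<Rightarrow> bool" where
  "has_weak_partial f i g \<longleftrightarrow>
    locally_integrable f \<and> locally_integrable g \<and>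
    (\<forall>\<phi>. test_function \<phi> \<longrightarrow>
      (LINT x|lebesgue. f x * partial_derivative i \<phi> x) = - (LINT x|lebesgue. g x * \<phi> x))"

definition weakly_differentiable :: "(real^'n \<Rightarrow> real) \<Rightarrow> bool" where
  "weakly_differentiable f \<longleftrightarrow> (\<forall>i. \<exists>g. has_weak_partial f i g)"

text \<open>Weak derivatives are unique only up to null sets; \<open>weak_partial\<close> picks a representative
  and is meaningful only for weakly differentiable functions.\<close>

definition weak_partial :: "'n \<Rightarrow> (real^'n \<Rightarrow> real) \<Rightarrow> real^'n \<Rightarrow> real" where
  "weak_partial i f = (SOME g. has_weak_partial f i g)"

definition weak_D :: "(real^'n \<Rightarrow> real^'N) \<Rightarrow> real^'n \<Rightarrow> real^'n^'N" where
  "weak_D u x = (\<chi> \<alpha> i. weak_partial i (\<lambda>y. u y $ \<alpha>) x)"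

definition weak_D2 :: "(real^'n \<Rightarrow> real^'N) \<Rightarrow> real^'n \<Rightarrow> real^'n^'n^'N" where
  "weak_D2 u x = (\<chi> \<alpha> i j. weak_partial i (weak_partial j (\<lambda>y. u y $ \<alpha>)) x)"


section \<open>The space \<open>W\<^sup>2\<^sup>,\<^sup>2\<^sub>*\<close>\<close>

definition W22_star :: "(real^'n \<Rightarrow> real^'N) set" where
  "W22_star = {u.
     in_Lp (2 * real CARD('n) / (real CARD('n) - 4)) u \<and>
     (\<forall>\<alpha>. weakly_differentiable (\<lambda>y. u y $ \<alpha>)) \<and>
     in_Lp (2 * real CARD('n) / (real CARD('n) - 2)) (weak_D u) \<and>
     (\<forall>\<alpha> j. weakly_differentiable (weak_partial j (\<lambda>y. u y $ \<alpha>))) \<and>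
     in_Lp 2 (weak_D2 u)}"

end

theory Submission
  imports Defs
begin

text \<open>The inequality is first proved for second differences. On a lattice the
  central second differences of a finitely supported map are diagonalised by the finite Fourier
  transform, with real symbols \<open>- 4 s\<^sub>i s\<^sub>j\<close>, so rank-one positivity of \<open>A\<close> gives the inequality
  frequency by frequency: \<open>\<nu> \<bar>s\<bar>\<^sup>2 \<bar>z\<bar>\<^sup>2 \<le> z \<bullet> (A : s \<otimes> s \<otimes> z) \<le> \<bar>z\<bar> \<bar>A : s \<otimes> s \<otimes> z\<bar>\<close>. Integrating over
  all translates of the lattice and letting the mesh tend to zero yields it for mollified functions,
  and hence, the inequality being stable under \<open>L\<^sup>2\<close> limits of the Hessian, for compactly supported
  ones. Finally \<open>D\<^sup>2(\<eta>(x / R) u)\<close> tends to \<open>D\<^sup>2u\<close> in \<open>L\<^sup>2\<close>, precisely because \<open>u\<close> and \<open>Du\<close> lie in the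
  scaling-critical spaces with exponents \<open>2n/(n-4)\<close> and \<open>2n/(n-2)\<close>.\<close>

section \<open>Test functions\<close>

text \<open>Two features shape the proof. The constant has to come out as exactly 1 / \<nu>: the
  passage to limits therefore works with the squared inequality and with weights 1 + t and 1 + 1/t,
  where t tends to 0 only after the approximation parameter has gone. And Plancherel's identity
  enters only through finite character sums: the restriction of a map to a lattice must vanish near
  the boundary of a large box, so that second differences do not wrap around and the cyclic group
  looks like the lattice. Averaging over translates costs no constant because half-open cells tile
  space. The difference quotients are taken of v convolved with a smooth kernel k, not of v itself:
  all differences fall on k and converge by the mean value theorem, while v is merely integrable
  with bounded support; the weak derivatives of v reappear when the derivatives of k are transferred
  back. All of this runs on Borel functions and \<open>lborel\<close>; only the last step returns to
  Lebesgue representatives.\<close>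

lemma C_k_Suc_imp: "C_k (Suc k) f \<Longrightarrow> C_k k f"
proof (induction k arbitrary: f)
  case 0
  then show ?case by (auto intro: differentiable_imp_continuous_on)
qed auto

lemma partial_derivative_eqI:
  assumes "(f has_derivative f') (at x)"
  shows "partial_derivative i f x = f' (axis i 1)"
  unfolding partial_derivative_def using frechet_derivative_at[OF assms] by simp

lemma differentiable_on_UNIV_has_derivative:
  assumes "f differentiable_on UNIV"
  shows "(f has_derivative frechet_derivative f (at x)) (at x)"
  using assms by (simp add: differentiable_on_def frechet_derivative_works[symmetric])

lemma C_k_0 [simp]: "C_k k (\<lambda>x::real^'n. 0)"
proof (induction k)
  case (Suc k)
  have "partial_derivative i (\<lambda>x::real^'n. 0) = (\<lambda>x. 0)" for i
    by (rule ext, subst partial_derivative_eqI[where f'="\<lambda>x. 0"]) auto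
  then show ?case using Suc by simp
qed auto

lemma C_k_add:
  assumes "C_k k f" "C_k k g"
  shows "C_k k (\<lambda>x. f x + g x)"
  using assms
proof (induction k arbitrary: f g)
  case 0
  then show ?case by (auto intro: continuous_intros)
next
  case (Suc k)
  have "partial_derivative i (\<lambda>x. f x + g x) = (\<lambda>x. partial_derivative i f x + partial_derivative i g x)" for i
  proof
    fix x
    show "partial_derivative i (\<lambda>x. f x + g x) x = partial_derivative i f x + partial_derivative i g x"
      using Suc.prems by (subst partial_derivative_eqI[OF has_derivative_add[OF
        differentiable_on_UNIV_has_derivative differentiable_on_UNIV_has_derivative]])
        (auto simp: partial_derivative_def)
  qed
  then show ?case using Suc by (auto intro: derivative_intros)
qed

lemma partial_derivative_mult:
  assumes "f differentiable_on UNIV" "g differentiable_on UNIV"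
  shows "partial_derivative i (\<lambda>x. f x * g x) x =
    partial_derivative i f x * g x + f x * partial_derivative i g x"
  by (subst partial_derivative_eqI[OF has_derivative_mult[OF
        differentiable_on_UNIV_has_derivative[OF assms(1)] differentiable_on_UNIV_has_derivative[OF assms(2)]]])
     (auto simp: partial_derivative_def)

lemma C_k_mult:
  assumes "C_k k f" "C_k k g"
  shows "C_k k (\<lambda>x. f x * g x)"
  using assms
proof (induction k arbitrary: f g)
  case 0
  then show ?case by (auto intro: continuous_intros)
next
  case (Suc k)
  have "partial_derivative i (\<lambda>x. f x * g x) =
    (\<lambda>x. partial_derivative i f x * g x + f x * partial_derivative i g x)" for i
    using Suc.prems partial_derivative_mult by (intro ext) auto
  moreover have "C_k k f" "C_k k g"
    using Suc.prems C_k_Suc_imp by blast+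
  ultimately show ?case using Suc by (auto intro!: derivative_intros C_k_add)
qed

lemma C_k_const [simp]: "C_k k (\<lambda>x::real^'n. c)"
proof (cases k)
  case (Suc l)
  have "partial_derivative i (\<lambda>x::real^'n. c) = (\<lambda>x. 0)" for i
    by (rule ext, subst partial_derivative_eqI[where f'="\<lambda>x. 0"]) auto
  then show ?thesis using Suc by simp
qed auto

lemma C_k_component [simp]: "C_k k (\<lambda>x. x $ i)"
proof (cases k)
  case 0
  then show ?thesis by (auto intro: continuous_intros)
next
  case (Suc l)
  have "partial_derivative j (\<lambda>x. x $ i) = (\<lambda>x. axis j 1 $ i)" for j
    by (rule ext, subst partial_derivative_eqI[where f'="\<lambda>x. x $ i"]) (auto intro!: derivative_eq_intros bounded_linear.has_derivative[OF bounded_linear_vec_nth])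
  moreover have "(\<lambda>x::real^'a. x $ i) differentiable_on UNIV"
    unfolding differentiable_on_def
    by (metis bounded_linear_imp_differentiable bounded_linear_vec_nth)
  ultimately show ?thesis using Suc by simp
qed

text \<open>One affine substitution covers both later uses: the reflection \<open>x - y\<close>
  inside convolutions (\<open>b = -1\<close>) and the dilations of the cut-off profile
  (\<open>a = 0\<close>).\<close>

lemma partial_derivative_affine:
  assumes "f differentiable_on UNIV"
  shows "partial_derivative i (\<lambda>x. f (a + b *\<^sub>R x)) x = b * partial_derivative i f (a + b *\<^sub>R x)"
proof -
  have "((\<lambda>x. f (a + b *\<^sub>R x)) has_derivative
      (\<lambda>h. frechet_derivative f (at (a + b *\<^sub>R x)) (b *\<^sub>R h))) (at x)"
    by (rule has_derivative_compose[OF _ differentiable_on_UNIV_has_derivative[OF assms]])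
       (auto intro!: derivative_eq_intros)
  then show ?thesis
    using linear_frechet_derivative[of f "at (a + b *\<^sub>R x)"] assms
    by (subst partial_derivative_eqI)
       (auto simp: partial_derivative_def differentiable_on_def linear_scale)
qed

lemma differentiable_affine:
  fixes f :: "real^'n \<Rightarrow> real"
  assumes "f differentiable_on UNIV"
  shows "(\<lambda>x. f (a + b *\<^sub>R x)) differentiable_on UNIV"
proof -
  have "((\<lambda>x. f (a + b *\<^sub>R x)) has_derivative
      (\<lambda>h. frechet_derivative f (at (a + b *\<^sub>R x)) (b *\<^sub>R h))) (at x)" for x
    by (rule has_derivative_compose[OF _ differentiable_on_UNIV_has_derivative[OF assms]])
       (auto intro!: derivative_eq_intros)
  then show ?thesis
    unfolding differentiable_on_def differentiable_def by auto
qed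

lemma C_k_affine:
  assumes "C_k k f"
  shows "C_k k (\<lambda>x. f (a + b *\<^sub>R x))"
  using assms
proof (induction k arbitrary: f)
  case 0
  then have "continuous_on UNIV f" by simp
  then have "continuous_on UNIV (\<lambda>x. f (a + b *\<^sub>R x))"
    by (rule continuous_on_compose2) (auto intro!: continuous_intros)
  then show ?case by simp
next
  case (Suc k)
  have "partial_derivative i (\<lambda>x. f (a + b *\<^sub>R x)) = (\<lambda>x. b * partial_derivative i f (a + b *\<^sub>R x))" for i
    using Suc.prems by (auto simp: partial_derivative_affine)
  moreover have "C_k k (\<lambda>x. b * partial_derivative i f (a + b *\<^sub>R x))" for i
    using Suc by (intro C_k_mult C_k_const) auto
  ultimately show ?case using Suc.prems differentiable_affine by auto
qed

lemma test_function_C_k: "test_function \<phi> \<Longrightarrow> C_k k \<phi>"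
  by (simp add: test_function_def)

lemma test_function_differentiable: "test_function \<phi> \<Longrightarrow> \<phi> differentiable_on UNIV"
  using test_function_C_k[of \<phi> "Suc 0"] by simp

lemma test_function_continuous: "test_function \<phi> \<Longrightarrow> continuous_on UNIV \<phi>"
  using test_function_C_k[of \<phi> 0] by simp

lemma test_function_borel [measurable]: "test_function \<phi> \<Longrightarrow> \<phi> \<in> borel_measurable borel"
  by (intro borel_measurable_continuous_onI test_function_continuous)

lemma test_functionI:
  assumes "\<And>k. C_k k \<phi>" "\<And>x. \<phi> x \<noteq> 0 \<Longrightarrow> x \<in> K" "compact K"
  shows "test_function \<phi>"
proof -
  have "closure {x. \<phi> x \<noteq> 0} \<subseteq> K"
    using assms by (intro closure_minimal) (auto simp: compact_imp_closed)
  then have "compact (closure {x. \<phi> x \<noteq> 0})"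
    using assms(3) by (meson bounded_subset closed_closure compact_eq_bounded_closed)
  then show ?thesis using assms by (simp add: test_function_def)
qed

lemma test_function_support:
  assumes "test_function \<phi>"
  obtains r where "r > 0" "\<And>x. norm x > r \<Longrightarrow> \<phi> x = 0"
proof -
  have "bounded (closure {x. \<phi> x \<noteq> 0})"
    using assms by (simp add: test_function_def compact_imp_bounded)
  then obtain r where r: "r > 0" "\<forall>x\<in>closure {x. \<phi> x \<noteq> 0}. norm x \<le> r"
    unfolding bounded_pos by auto
  show thesis
  proof (rule that[OF r(1)])
    fix x :: "real^'a" assume "norm x > r"
    then have "x \<notin> closure {x. \<phi> x \<noteq> 0}" using r(2) by force
    then show "\<phi> x = 0" using closure_subset[of "{x. \<phi> x \<noteq> 0}"] by auto
  qed
qed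

lemma test_function_bounded:
  assumes "test_function \<phi>"
  obtains C where "C > 0" "\<And>x. \<bar>\<phi> x\<bar> \<le> C"
proof -
  let ?K = "closure {x. \<phi> x \<noteq> 0}"
  have "compact (\<phi> ` ?K)"
    using assms by (intro compact_continuous_image continuous_on_subset[OF test_function_continuous])
      (auto simp: test_function_def)
  then obtain C where C: "C > 0" "\<forall>y\<in>\<phi> ` ?K. norm y \<le> C"
    unfolding bounded_pos[symmetric] by (meson compact_imp_bounded bounded_pos)
  have "\<bar>\<phi> x\<bar> \<le> C" for x
  proof (cases "\<phi> x = 0")
    case False
    then have "x \<in> ?K" using closure_subset[of "{x. \<phi> x \<noteq> 0}"] by auto
    then show ?thesis using C by auto
  qed (use C in auto)
  then show thesis using that C by blast
qed

text \<open>Off the closed support the function vanishes on a neighbourhood, so its derivative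
  vanishes there too and the same compact set serves.\<close>

lemma test_function_partial:
  assumes "test_function \<phi>"
  shows "test_function (partial_derivative i \<phi>)"
proof (rule test_functionI)
  fix k
  show "C_k k (partial_derivative i \<phi>)"
    using test_function_C_k[OF assms, of "Suc k"] by simp
next
  fix x assume nz: "partial_derivative i \<phi> x \<noteq> 0"
  show "x \<in> closure {x. \<phi> x \<noteq> 0}"
  proof (rule ccontr)
    assume x: "x \<notin> closure {x. \<phi> x \<noteq> 0}"
    have "(\<phi> has_derivative (\<lambda>_. 0)) (at x)"
    proof (rule has_derivative_transform_within_open[of "\<lambda>_. 0" _ x UNIV])
      show "open (- closure {x. \<phi> x \<noteq> 0})"
        by (rule open_Compl[OF closed_closure])
      show "x \<in> - closure {x. \<phi> x \<noteq> 0}" using x by simp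
      show "\<And>y. y \<in> - closure {x. \<phi> x \<noteq> 0} \<Longrightarrow> 0 = \<phi> y"
        using closure_subset[of "{x. \<phi> x \<noteq> 0}"] by auto
    qed auto
    then show False using nz by (simp add: partial_derivative_eqI)
  qed
qed (use assms in \<open>simp add: test_function_def\<close>)

lemma test_function_affine:
  assumes "test_function \<phi>" "b \<noteq> 0"
  shows "test_function (\<lambda>x. \<phi> (a + b *\<^sub>R x))"
proof -
  obtain r where r: "r > 0" "\<And>x. norm x > r \<Longrightarrow> \<phi> x = 0"
    using test_function_support[OF assms(1)] by blast
  show ?thesis
  proof (rule test_functionI)
    show "C_k k (\<lambda>x. \<phi> (a + b *\<^sub>R x))" for k
      by (rule C_k_affine[OF test_function_C_k[OF assms(1)]])
    show "x \<in> cball 0 ((r + norm a) / \<bar>b\<bar>)" if "\<phi> (a + b *\<^sub>R x) \<noteq> 0" for x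
    proof -
      have "norm (a + b *\<^sub>R x) \<le> r" using r that by force
      then have "norm (b *\<^sub>R x) \<le> r + norm a"
        using norm_triangle_ineq4[of "a + b *\<^sub>R x" a] by auto
      then show ?thesis
        using assms(2) by (simp add: field_simps)
    qed
    show "compact (cball (0::real^'a) ((r + norm a) / \<bar>b\<bar>))"
      by (rule compact_cball)
  qed
qed

lemma test_function_mult:
  assumes \<phi>: "test_function \<phi>" and \<psi>: "\<And>k. C_k k \<psi>"
  shows "test_function (\<lambda>x. \<psi> x * \<phi> x)"
proof (rule test_functionI)
  show "C_k k (\<lambda>x. \<psi> x * \<phi> x)" for k
    by (rule C_k_mult[OF \<psi> test_function_C_k[OF \<phi>]])
  show "\<psi> x * \<phi> x \<noteq> 0 \<Longrightarrow> x \<in> closure {x. \<phi> x \<noteq> 0}" for x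
    using closure_subset[of "{x. \<phi> x \<noteq> 0}"] by (auto simp: subset_iff)
  show "compact (closure {x. \<phi> x \<noteq> 0})"
    using \<phi> by (simp add: test_function_def)
qed

lemma test_function_cmult: "test_function \<phi> \<Longrightarrow> test_function (\<lambda>x. c * \<phi> x)"
  by (rule test_function_mult[where \<psi>="\<lambda>_. c"]) auto

section \<open>Construction of a smooth bump function\<close>

definition flat_exp :: "real poly \<Rightarrow> real \<Rightarrow> real" where
  "flat_exp p s = (if s > 0 then poly p (1 / s) * exp (- (1 / s)) else 0)"

lemma flat_exp_tendsto_0: "(flat_exp p \<longlongrightarrow> 0) (at 0)"
proof -
  have *: "((\<lambda>t::real. c * (t ^ k / exp t)) \<longlongrightarrow> 0) at_top" for c k
    by (rule tendsto_mult_right_zero, rule tendsto_power_div_exp_0)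
  have "((\<lambda>t::real. \<Sum>i\<le>degree p. coeff p i * (t ^ i / exp t)) \<longlongrightarrow> 0) at_top"
    by (intro tendsto_null_sum *)
  moreover have "(\<Sum>i\<le>degree p. coeff p i * (t ^ i / exp t)) = poly p t * exp (- t)" for t
    by (simp only: poly_altdef sum_distrib_right exp_minus field_class.field_divide_inverse mult.assoc)
  ultimately have "((\<lambda>t. poly p t * exp (- t)) \<longlongrightarrow> 0) at_top"
    by simp
  then have "((\<lambda>s. poly p (1 / s) * exp (- (1 / s))) \<longlongrightarrow> 0) (at_right 0)"
    using filterlim_compose[OF _ filterlim_inverse_at_top_right] by (fastforce simp: inverse_eq_divide)
  then have "(flat_exp p \<longlongrightarrow> 0) (at_right 0)"
    by (rule Lim_transform_eventually) (auto simp: eventually_at_right_less flat_exp_def intro!: eventually_at_rightI[of 0 1])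
  moreover have "(flat_exp p \<longlongrightarrow> 0) (at_left 0)"
    by (rule Lim_transform_eventually[OF tendsto_const]) (auto simp: flat_exp_def intro!: eventually_at_leftI[of "-1" 0])
  ultimately show ?thesis by (simp add: filterlim_split_at)
qed

text \<open>The family is closed under differentiation. This is why \<open>flat_exp\<close> carries
  a polynomial: one induction over the order then gives smoothness.\<close>

lemma flat_exp_has_derivative:
  "\<exists>q. \<forall>s. (flat_exp p has_real_derivative flat_exp q s) (at s)"
proof -
  \<comment> \<open>Chain rule for s > 0: differentiating p(1/s) exp(-1/s) produces (1/s)^2 times (p
    - p')(1/s) times the same exponential.\<close>
  define q where "q = [:0, 0, 1:] * (p - pderiv p)"
  have "(flat_exp p has_real_derivative flat_exp q s) (at s)" for s
  proof -
    consider "s > 0" | "s < 0" | "s = 0" by linarith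
    then show ?thesis
    proof cases
      case 1
      have "((\<lambda>s. poly p (1 / s) * exp (- (1 / s))) has_real_derivative flat_exp q s) (at s)"
        using 1 by (auto intro!: derivative_eq_intros DERIV_chain2[OF poly_DERIV]
          simp: flat_exp_def q_def field_simps power2_eq_square)
      then show ?thesis
        by (rule DERIV_cong_ev[THEN iffD1, rotated -1])
           (use 1 in \<open>auto simp: flat_exp_def intro!: eventually_nhds_in_open[of "{0<..}", THEN eventually_mono]\<close>)
    next
      case 2
      have "((\<lambda>s. 0) has_real_derivative flat_exp q s) (at s)"
        using 2 by (auto simp: flat_exp_def)
      then show ?thesis
        by (rule DERIV_cong_ev[THEN iffD1, rotated -1])
           (use 2 in \<open>auto simp: flat_exp_def intro!: eventually_nhds_in_open[of "{..<0}", THEN eventually_mono]\<close>)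
    next
      case 3
      \<comment> \<open>At 0 the difference quotient of \<open>flat_exp p\<close> is again a member
        of the family, with p multiplied by the variable.\<close>
      have "(flat_exp ([:0, 1:] * p) \<longlongrightarrow> 0) (at 0)" by (rule flat_exp_tendsto_0)
      then have "((\<lambda>h. (flat_exp p (0 + h) - flat_exp p 0) / h) \<longlongrightarrow> 0) (at 0)"
        by (rule Lim_transform_eventually) (auto simp: flat_exp_def eventually_at_filter)
      then show ?thesis using 3 by (simp add: DERIV_def flat_exp_def)
    qed
  qed
  then show ?thesis by blast
qed

text \<open>The induction keeps p arbitrary because each derivative replaces p by another
  polynomial; the inner function contributes only the smooth factor -2 times a coordinate.\<close>

lemma C_k_flat_exp: "C_k k (\<lambda>x. flat_exp p (1 - x \<bullet> x))"
proof (induction k arbitrary: p)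
  case 0
  have "continuous_on UNIV (flat_exp p)"
    using flat_exp_has_derivative[of p] by (meson DERIV_isCont continuous_at_imp_continuous_on)
  then have "continuous_on UNIV (\<lambda>x. flat_exp p (1 - x \<bullet> x))"
    by (rule continuous_on_compose2) (auto intro!: continuous_intros)
  then show ?case by simp
next
  case (Suc k)
  obtain q where q: "\<And>s. (flat_exp p has_real_derivative flat_exp q s) (at s)"
    using flat_exp_has_derivative by blast
  have D: "((\<lambda>x. flat_exp p (1 - x \<bullet> x)) has_derivative
      (\<lambda>h. (- 2 * (x \<bullet> h)) * flat_exp q (1 - x \<bullet> x))) (at x)" for x :: "real^'a"
    by (rule has_derivative_compose[where g="flat_exp p", OF _ q[THEN has_field_derivative_imp_has_derivative], THEN has_derivative_eq_rhs])
       (auto intro!: derivative_eq_intros simp: inner_commute algebra_simps)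
  have "partial_derivative i (\<lambda>x. flat_exp p (1 - x \<bullet> x)) =
      (\<lambda>x::real^'a. (- 2 * x $ i) * flat_exp q (1 - x \<bullet> x))" for i
    by (rule ext) (simp add: partial_derivative_eqI[OF D] inner_axis)
  moreover have "(\<lambda>x::real^'a. flat_exp p (1 - x \<bullet> x)) differentiable_on UNIV"
    using D unfolding differentiable_on_def differentiable_def by blast
  moreover have "C_k k (\<lambda>x::real^'a. (- 2 * x $ i) * flat_exp q (1 - x \<bullet> x))" for i
    by (intro C_k_mult C_k_const C_k_component Suc)
  ultimately show ?case by simp
qed

text \<open>The classical exp(-1 / (1 - |x|^2)) on the unit ball; using the squared norm avoids the
  singularity of the norm at the origin.\<close>

definition bump :: "real^'n \<Rightarrow> real" where
  "bump x = flat_exp 1 (1 - x \<bullet> x)"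

lemma bump_nonneg: "bump x \<ge> 0"
  and bump_0: "bump 0 > 0"
  by (auto simp: bump_def flat_exp_def)

lemma bump_support: "norm x \<ge> 1 \<Longrightarrow> bump x = 0"
  unfolding bump_def flat_exp_def
  using power_mono[of 1 "norm x" 2] by (simp add: dot_square_norm not_less)

lemma bump_test_function: "test_function bump"
proof (rule test_functionI)
  show "C_k k bump" for k :: nat
    using C_k_flat_exp[of k 1] by (simp add: bump_def[abs_def])
  show "bump x \<noteq> 0 \<Longrightarrow> x \<in> cball 0 1" for x :: "real^'a"
    using bump_support[of x] by force
qed auto

section \<open>The inequality on a lattice\<close>

text \<open>A system of representatives of (Z/M)^n, used both for the lattice sites and for the
  frequencies.\<close>

definition lattice_box :: "nat \<Rightarrow> ('n::finite \<Rightarrow> int) set" where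
  "lattice_box M = {k. \<forall>i. 0 \<le> k i \<and> k i < int M}"

definition lattice_char :: "nat \<Rightarrow> ('n::finite \<Rightarrow> int) \<Rightarrow> ('n \<Rightarrow> int) \<Rightarrow> complex" where
  "lattice_char M \<theta> k = (\<Prod>i\<in>UNIV. cis (2 * pi * of_int (\<theta> i * k i) / of_nat M))"

definition lattice_DFT :: "nat \<Rightarrow> (('n::finite \<Rightarrow> int) \<Rightarrow> real) \<Rightarrow> ('n \<Rightarrow> int) \<Rightarrow> complex" where
  "lattice_DFT M f \<theta> = (\<Sum>k\<in>lattice_box M. of_real (f k) * lattice_char M \<theta> k)"

lemma lattice_box_PiE: "lattice_box M = (\<Pi>\<^sub>E i\<in>UNIV. {0..<int M})"
  by (auto simp: lattice_box_def PiE_def)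

lemma finite_lattice_box [simp]: "finite (lattice_box M)"
  by (simp add: lattice_box_PiE finite_PiE)

lemma lattice_char_add: "lattice_char M \<theta> (\<lambda>i. k i + l i) = lattice_char M \<theta> k * lattice_char M \<theta> l"
  unfolding lattice_char_def prod.distrib[symmetric] cis_mult
  by (simp add: algebra_simps add_divide_distrib)

lemma lattice_char_minus: "lattice_char M \<theta> (\<lambda>i. - k i) = cnj (lattice_char M \<theta> k)"
  by (simp add: lattice_char_def cis_cnj)

lemma lattice_char_diff:
  "lattice_char M \<theta> (\<lambda>i. k i - l i) = lattice_char M \<theta> k * cnj (lattice_char M \<theta> l)"
  using lattice_char_add[of M \<theta> k "\<lambda>i. - l i"] by (simp add: lattice_char_minus)

text \<open>A geometric sum over the powers of an M-th root of unity; divisibility of d by M is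
  exactly what would make that root equal to 1.\<close>

lemma sum_cis_eq_0:
  assumes "\<not> int M dvd d" "M > 0"
  shows "(\<Sum>t\<in>{0..<int M}. cis (2 * pi * of_int (t * d) / of_nat M)) = 0"
proof -
  define z where "z = cis (2 * pi * of_int d / of_nat M)"
  have "z ^ M = cis (real M * (2 * pi * of_int d / of_nat M))"
    by (simp only: z_def Complex.DeMoivre)
  also have "real M * (2 * pi * of_int d / of_nat M) = 2 * pi * of_int d"
    using assms(2) by simp
  finally have zM: "z ^ M = 1"
    using cis_multiple_2pi[of "of_int d"] by simp
  have z1: "z \<noteq> 1"
  proof
    assume "z = 1"
    then have "cos (2 * pi * of_int d / of_nat M) = 1"
      by (simp add: z_def complex_eq_iff)
    then obtain k :: int where "2 * pi * of_int d / of_nat M = of_int k * 2 * pi"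
      using cos_one_2pi_int by auto
    then have "real_of_int d = of_int k * of_nat M"
      using assms(2) by (simp add: field_simps)
    then have "d = k * int M"
      by (metis of_int_eq_iff of_int_mult of_int_of_nat_eq)
    then show False using assms(1) by simp
  qed
  have "(\<Sum>t\<in>{0..<int M}. cis (2 * pi * of_int (t * d) / of_nat M)) = (\<Sum>t<M. z ^ t)"
    by (rule sum.reindex_bij_witness[of _ int nat])
       (auto simp: z_def Complex.DeMoivre intro!: arg_cong[of _ _ cis])
  also have "\<dots> = 0"
    using zM z1 by (simp add: sum_gp_strict)
  finally show ?thesis .
qed

text \<open>The sum factors over the coordinates, and a single coordinate in which k and l differ
  already contributes a vanishing factor.\<close>

lemma lattice_char_orthogonal:
  fixes k l :: "'n::finite \<Rightarrow> int"
  assumes "k \<in> lattice_box M" "l \<in> lattice_box M" "M > 0"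
  shows "(\<Sum>\<theta>\<in>lattice_box M. lattice_char M \<theta> k * cnj (lattice_char M \<theta> l)) =
    (if k = l then of_nat (card (lattice_box M :: ('n \<Rightarrow> int) set)) else 0)"
proof (cases "k = l")
  case True
  have "lattice_char M \<theta> l * cnj (lattice_char M \<theta> l) = 1" for \<theta>
    unfolding lattice_char_minus[symmetric] lattice_char_add[symmetric] by (simp add: lattice_char_def)
  then show ?thesis using True by simp
next
  case False
  then obtain j where j: "k j \<noteq> l j" by blast
  \<comment> \<open>Both entries lie in [0, M), so equal residues would make them equal.\<close>
  have nd: "\<not> int M dvd (k j - l j)"
  proof
    assume "int M dvd (k j - l j)"
    then have "k j mod int M = l j mod int M" by (simp add: mod_eq_dvd_iff)
    then show False using j assms by (simp add: lattice_box_def)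
  qed
  have "(\<Sum>\<theta>\<in>lattice_box M. lattice_char M \<theta> k * cnj (lattice_char M \<theta> l)) =
    (\<Sum>\<theta>\<in>(\<Pi>\<^sub>E i\<in>UNIV. {0..<int M}). \<Prod>i\<in>UNIV. cis (2 * pi * of_int (\<theta> i * (k i - l i)) / of_nat M))"
    unfolding lattice_char_diff[symmetric] lattice_box_PiE by (simp add: lattice_char_def)
  also have "\<dots> = (\<Prod>i\<in>UNIV. \<Sum>t\<in>{0..<int M}. cis (2 * pi * of_int (t * (k i - l i)) / of_nat M))"
    by (rule prod_sum_PiE[symmetric]) auto
  also have "\<dots> = 0"
    using sum_cis_eq_0[OF nd assms(3)] by (auto intro!: prod_zero exI[of _ j])
  finally show ?thesis using False by simp
qed

lemma lattice_Parseval: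
  fixes f :: "('n::finite \<Rightarrow> int) \<Rightarrow> real"
  assumes "M > 0"
  shows "(\<Sum>\<theta>\<in>lattice_box M. (cmod (lattice_DFT M f \<theta>))\<^sup>2) =
    of_nat (card (lattice_box M :: ('n \<Rightarrow> int) set)) * (\<Sum>k\<in>lattice_box M. (f k)\<^sup>2)"
proof -
  let ?B = "lattice_box M :: ('n \<Rightarrow> int) set"
  have "complex_of_real (\<Sum>\<theta>\<in>?B. (cmod (lattice_DFT M f \<theta>))\<^sup>2) =
      (\<Sum>\<theta>\<in>?B. lattice_DFT M f \<theta> * cnj (lattice_DFT M f \<theta>))"
    by (simp add: complex_norm_square[symmetric])
  also have "\<dots> = (\<Sum>\<theta>\<in>?B. \<Sum>k\<in>?B. \<Sum>l\<in>?B. of_real (f k * f l) * (lattice_char M \<theta> k * cnj (lattice_char M \<theta> l)))"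
    by (simp add: lattice_DFT_def sum_product mult_ac)
  also have "\<dots> = (\<Sum>k\<in>?B. \<Sum>l\<in>?B. \<Sum>\<theta>\<in>?B. of_real (f k * f l) * (lattice_char M \<theta> k * cnj (lattice_char M \<theta> l)))"
    by (subst sum.swap, rule sum.cong[OF refl], subst sum.swap, rule refl)
  also have "\<dots> = (\<Sum>k\<in>?B. \<Sum>l\<in>?B. of_real (f k * f l) * (if k = l then of_nat (card ?B) else 0))"
    by (intro sum.cong refl, subst sum_distrib_left[symmetric], subst lattice_char_orthogonal) (use assms in auto)
  also have "\<dots> = (\<Sum>k\<in>?B. of_real (f k * f k) * of_nat (card ?B))"
    by (intro sum.cong refl) (simp add: if_distrib[of "\<lambda>x. _ * x"] sum.delta cong: if_cong)
  also have "\<dots> = complex_of_real (of_nat (card ?B) * (\<Sum>k\<in>?B. (f k)\<^sup>2))"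
    by (simp add: sum_distrib_left power2_eq_square mult_ac)
  finally show ?thesis
    unfolding of_real_eq_iff .
qed

text \<open>The hypothesis keeps the support and its translate inside the box, so that the
  non-periodic shift acts on the transform like a cyclic one.\<close>

lemma lattice_DFT_translate:
  fixes f :: "('n::finite \<Rightarrow> int) \<Rightarrow> real"
  assumes supp: "\<And>k. f k \<noteq> 0 \<Longrightarrow> k \<in> lattice_box M \<and> (\<lambda>i. k i - a i) \<in> lattice_box M"
  shows "lattice_DFT M (\<lambda>k. f (\<lambda>i. k i + a i)) \<theta> = cnj (lattice_char M \<theta> a) * lattice_DFT M f \<theta>"
proof -
  let ?B = "lattice_box M :: ('n \<Rightarrow> int) set"
  let ?S = "{k \<in> ?B. f k \<noteq> 0}"
  have "lattice_DFT M (\<lambda>k. f (\<lambda>i. k i + a i)) \<theta> =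
      (\<Sum>k\<in>{k \<in> ?B. f (\<lambda>i. k i + a i) \<noteq> 0}. of_real (f (\<lambda>i. k i + a i)) * lattice_char M \<theta> k)"
    unfolding lattice_DFT_def by (rule sum.mono_neutral_right) auto
  also have "\<dots> = (\<Sum>k\<in>?S. of_real (f k) * lattice_char M \<theta> (\<lambda>i. k i - a i))"
    by (rule sum.reindex_bij_witness[of _ "\<lambda>k i. k i - a i" "\<lambda>k i. k i + a i"]) (use supp in auto)
  also have "\<dots> = (\<Sum>k\<in>?B. of_real (f k) * lattice_char M \<theta> (\<lambda>i. k i - a i))"
    by (rule sum.mono_neutral_left) auto
  also have "\<dots> = cnj (lattice_char M \<theta> a) * lattice_DFT M f \<theta>"
    by (simp add: lattice_DFT_def lattice_char_diff sum_distrib_left mult_ac)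
  finally show ?thesis .
qed

lemma lattice_DFT_sum: "lattice_DFT M (\<lambda>k. \<Sum>a\<in>S. c a * f a k) \<theta> = (\<Sum>a\<in>S. of_real (c a) * lattice_DFT M (f a) \<theta>)"
  unfolding lattice_DFT_def
  by (simp add: sum_distrib_right sum_distrib_left mult_ac sum.swap[of _ _ S])

lemma lattice_DFT_add: "lattice_DFT M (\<lambda>k. f k + g k) \<theta> = lattice_DFT M f \<theta> + lattice_DFT M g \<theta>"
  by (simp add: lattice_DFT_def sum.distrib algebra_simps)

lemma lattice_DFT_diff: "lattice_DFT M (\<lambda>k. f k - g k) \<theta> = lattice_DFT M f \<theta> - lattice_DFT M g \<theta>"
  by (simp add: lattice_DFT_def sum_subtractf algebra_simps)

definition unit_step :: "'n \<Rightarrow> 'n \<Rightarrow> int" where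
  "unit_step i l = (if l = i then 1 else 0)"

text \<open>Composition of the undivided central differences in directions i and j. For
  \<open>i = j\<close> it reaches two sites out, hence the margin 2 in the support hypotheses below.
  Each shift is kept in one bracket so that the translation rule for \<open>k l + a l\<close>
  matches.\<close>

definition lattice_diff2 :: "'n \<Rightarrow> 'n \<Rightarrow> (('n \<Rightarrow> int) \<Rightarrow> real) \<Rightarrow> ('n \<Rightarrow> int) \<Rightarrow> real" where
  "lattice_diff2 i j f k =
     f (\<lambda>l. k l + (unit_step i l + unit_step j l)) - f (\<lambda>l. k l + (unit_step i l - unit_step j l))
     - f (\<lambda>l. k l + (- unit_step i l + unit_step j l)) + f (\<lambda>l. k l + (- unit_step i l - unit_step j l))"

lemma lattice_char_unit_step:
  "lattice_char M \<theta> (unit_step i) = cis (2 * pi * of_int (\<theta> i) / of_nat M)"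
proof -
  have "lattice_char M \<theta> (unit_step i) =
      (\<Prod>l\<in>UNIV. if l = i then cis (2 * pi * of_int (\<theta> i) / of_nat M) else 1)"
    unfolding lattice_char_def by (rule prod.cong) (auto simp: unit_step_def)
  then show ?thesis by simp
qed

text \<open>Central differences are used because their symbol \<open>\<i> sin\<close> is purely imaginary, so that the
  symbol of \<open>lattice_diff2 i j\<close> is a real multiple of \<open>s\<^sub>i s\<^sub>j\<close> and real rank-one positivity applies.\<close>

lemma lattice_DFT_diff2:
  fixes f :: "('n::finite \<Rightarrow> int) \<Rightarrow> real"
  assumes supp: "\<And>k l. f k \<noteq> 0 \<Longrightarrow> 2 \<le> k l \<and> k l < int M - 2"
  shows "lattice_DFT M (lattice_diff2 i j f) \<theta> =
    of_real (- 4 * (sin (2 * pi * of_int (\<theta> i) / of_nat M) * sin (2 * pi * of_int (\<theta> j) / of_nat M)))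
      * lattice_DFT M f \<theta>"
proof -
  define p q where "p = lattice_char M \<theta> (unit_step i)" and "q = lattice_char M \<theta> (unit_step j)"
  have tr: "lattice_DFT M (\<lambda>k. f (\<lambda>i. k i + a i)) \<theta> = cnj (lattice_char M \<theta> a) * lattice_DFT M f \<theta>"
    if "\<And>l. \<bar>a l\<bar> \<le> 2" for a
  proof (rule lattice_DFT_translate, intro conjI)
    fix k assume "f k \<noteq> 0"
    then have "2 \<le> k l \<and> k l < int M - 2" for l using supp by blast
    with that show "k \<in> lattice_box M" "(\<lambda>i. k i - a i) \<in> lattice_box M"
      unfolding lattice_box_def by (smt (verit) mem_Collect_eq)+
  qed
  have "lattice_DFT M (lattice_diff2 i j f) \<theta> =
    (cnj (p * q) - cnj (p * cnj q) - cnj (cnj p * q) + cnj (cnj p * cnj q)) * lattice_DFT M f \<theta>"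
    unfolding lattice_diff2_def[abs_def] lattice_DFT_add lattice_DFT_diff
    by (subst tr, force simp: unit_step_def)+
       (simp add: p_def q_def lattice_char_add lattice_char_minus lattice_char_diff algebra_simps)
  \<comment> \<open>The four terms are the expanded product of two first-order symbols. Each factor
    such as \<open>p - cnj p\<close> is 2i times a sine, and two factors 2i give the -4.\<close>
  also have "cnj (p * q) - cnj (p * cnj q) - cnj (cnj p * q) + cnj (cnj p * cnj q) = (p - cnj p) * (q - cnj q)"
    by (simp add: algebra_simps)
  also have "\<dots> = of_real (- 4 * (sin (2 * pi * of_int (\<theta> i) / of_nat M) * sin (2 * pi * of_int (\<theta> j) / of_nat M)))"
    by (simp add: p_def q_def lattice_char_unit_step complex_eq_iff)
  finally show ?thesis .
qed

section \<open>Rank-one positivity at a single frequency\<close>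

lemma rank_one_form_scale:
  "rank_one_form A (r *\<^sub>R \<eta>) (t *\<^sub>R a) = r\<^sup>2 * t\<^sup>2 * rank_one_form A \<eta> a"
  by (simp add: rank_one_form_def sum_distrib_left power2_eq_square mult_ac)

text \<open>The form is homogeneous of degree two in each argument, so the bound on the unit spheres
  extends to all vectors.\<close>

lemma rank_one_form_ge:
  "ellipticity_constant A * (norm \<eta>)\<^sup>2 * (norm a)\<^sup>2 \<le> rank_one_form A \<eta> a"
proof (cases "\<eta> = 0 \<or> a = 0")
  case True
  then show ?thesis by (auto simp: rank_one_form_def)
next
  case False
  have "ellipticity_constant A \<le> rank_one_form A (\<eta> /\<^sub>R norm \<eta>) (a /\<^sub>R norm a)"
    by (rule ellipticity_constant_attained[of A]) (use False in auto)
  also have "\<dots> = rank_one_form A \<eta> a / ((norm \<eta>)\<^sup>2 * (norm a)\<^sup>2)"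
    by (simp add: rank_one_form_scale divide_inverse power_inverse)
  finally show ?thesis using False by (simp add: field_simps)
qed

text \<open>Up to sign and phase the Hessian of the plane wave z exp(i s.x). At each frequency the
  transformed lattice Hessian has this shape, which is why positivity in rank-one directions is
  enough.\<close>

definition rank_one_hessian :: "real^'n \<Rightarrow> real^'N \<Rightarrow> real^'n^'n^'N" where
  "rank_one_hessian s z = (\<chi> \<alpha> i j. s $ i * s $ j * z $ \<alpha>)"

lemma norm_tensor_sq: "(norm X)\<^sup>2 = (\<Sum>\<alpha>\<in>UNIV. \<Sum>i\<in>UNIV. \<Sum>j\<in>UNIV. (X $ \<alpha> $ i $ j)\<^sup>2)"
  for X :: "real^'n^'m^'N"
  unfolding power2_norm_eq_inner by (simp add: inner_vec_def power2_eq_square)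

lemma norm_vec_sq: "(norm z)\<^sup>2 = (\<Sum>\<alpha>\<in>UNIV. (z $ \<alpha>)\<^sup>2)" for z :: "real^'N"
  unfolding power2_norm_eq_inner by (simp add: inner_vec_def power2_eq_square)

lemma norm_rank_one_hessian: "norm (rank_one_hessian s z) = (norm s)\<^sup>2 * norm z"
proof -
  have "(norm (rank_one_hessian s z))\<^sup>2 = ((norm s)\<^sup>2 * norm z)\<^sup>2"
  proof -
    have "((norm s)\<^sup>2 * norm z)\<^sup>2 = (norm z)\<^sup>2 * ((norm s)\<^sup>2 * (norm s)\<^sup>2)"
      by (simp add: power2_eq_square)
    also have "\<dots> = (\<Sum>\<alpha>\<in>UNIV. \<Sum>i\<in>UNIV. \<Sum>j\<in>UNIV. (z $ \<alpha>)\<^sup>2 * ((s $ i)\<^sup>2 * (s $ j)\<^sup>2))"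
      unfolding norm_vec_sq[of z] norm_vec_sq[of s] sum_product
      by (simp add: sum_distrib_left sum_distrib_right)
    finally show ?thesis
      by (simp add: norm_tensor_sq rank_one_hessian_def power_mult_distrib mult_ac)
  qed
  then show ?thesis by (simp add: power2_eq_iff_nonneg)
qed

text \<open>Stated for squares because these are what Parseval's identity adds up; the squaring is
  where the sign of the ellipticity constant enters.\<close>

lemma tensor_contract_rank_one_ge:
  assumes "ellipticity_constant A \<ge> 0"
  shows "(ellipticity_constant A)\<^sup>2 * (norm (rank_one_hessian s z))\<^sup>2
    \<le> (norm (tensor_contract A (rank_one_hessian s z)))\<^sup>2"
proof -
  let ?w = "tensor_contract A (rank_one_hessian s z)"
  have "z \<bullet> ?w = rank_one_form A z s"
    by (simp add: inner_vec_def tensor_contract_def rank_one_hessian_def rank_one_form_def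
        sum_distrib_left mult_ac)
  then have *: "ellipticity_constant A * (norm z)\<^sup>2 * (norm s)\<^sup>2 \<le> norm z * norm ?w"
    using rank_one_form_ge[of A z s] norm_cauchy_schwarz[of z ?w] by simp
  \<comment> \<open>The pairing bound contains |z| twice on the left and once on the right; one
    factor cancels unless z = 0.\<close>
  have "ellipticity_constant A * norm (rank_one_hessian s z) \<le> norm ?w"
  proof (cases "z = 0")
    case False
    with * show ?thesis
      by (simp add: norm_rank_one_hessian power2_eq_square[of "norm z"] mult_ac)
  qed (simp add: norm_rank_one_hessian)
  then show ?thesis
    using assms by (metis power_mono power_mult_distrib mult_nonneg_nonneg norm_ge_zero)
qed

definition lattice_hessian :: "(('n \<Rightarrow> int) \<Rightarrow> real^'N) \<Rightarrow> ('n \<Rightarrow> int) \<Rightarrow> real^'n^'n^'N" where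
  "lattice_hessian U k = (\<chi> \<alpha> i j. lattice_diff2 i j (\<lambda>k. U k $ \<alpha>) k)"

text \<open>Since A is real, contraction acts separately on the real and imaginary parts of the
  transform, and each part is a rank-one Hessian to which the estimate at a single frequency
  applies. Parseval's identity costs the same factor \<open>card\<close> on both sides, and it
  cancels because the box is not empty.\<close>

proposition lattice_hessian_inequality:
  fixes A :: "real^'n^'n^'N^'N" and U :: "('n \<Rightarrow> int) \<Rightarrow> real^'N"
  assumes supp: "\<And>k l. U k \<noteq> 0 \<Longrightarrow> 2 \<le> k l \<and> k l < int M - 2"
    and nonneg: "ellipticity_constant A \<ge> 0" and M: "M > 0"
  shows "(ellipticity_constant A)\<^sup>2 * (\<Sum>k\<in>lattice_box M. (norm (lattice_hessian U k))\<^sup>2)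
    \<le> (\<Sum>k\<in>lattice_box M. (norm (tensor_contract A (lattice_hessian U k)))\<^sup>2)"
proof -
  let ?B = "lattice_box M :: ('n \<Rightarrow> int) set"
  let ?D = "\<lambda>\<alpha> i j. lattice_diff2 i j (\<lambda>k. U k $ \<alpha>)"
  define s :: "('n \<Rightarrow> int) \<Rightarrow> real^'n" where "s \<theta> = (\<chi> i. sin (2 * pi * of_int (\<theta> i) / of_nat M))" for \<theta>
  define z where "z \<alpha> = lattice_DFT M (\<lambda>k. U k $ \<alpha>)" for \<alpha>
  \<comment> \<open>Real and imaginary parts of the transform, with the factor -4 of the symbol
    absorbed, so that the two parts of the transformed Hessian are literally values of
    \<open>rank_one_hessian\<close>.\<close>
  define x y :: "('n \<Rightarrow> int) \<Rightarrow> real^'N" where "x \<theta> = (\<chi> \<alpha>. -4 * Re (z \<alpha> \<theta>))" and "y \<theta> = (\<chi> \<alpha>. - 4 * Im (z \<alpha> \<theta>))" for \<theta>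
  have hat: "lattice_DFT M (?D \<alpha> i j) \<theta> = of_real (-4 * (s \<theta> $ i * s \<theta> $ j)) * z \<alpha> \<theta>" for \<alpha> i j \<theta>
    unfolding z_def s_def using supp by (subst lattice_DFT_diff2) force+
  have 1: "(\<Sum>\<alpha>\<in>UNIV. \<Sum>i\<in>UNIV. \<Sum>j\<in>UNIV. (cmod (lattice_DFT M (?D \<alpha> i j) \<theta>))\<^sup>2) =
      (norm (rank_one_hessian (s \<theta>) (x \<theta>)))\<^sup>2 + (norm (rank_one_hessian (s \<theta>) (y \<theta>)))\<^sup>2" for \<theta>
    unfolding hat norm_tensor_sq sum.distrib[symmetric] cmod_power2
    by (intro sum.cong refl) (simp add: rank_one_hessian_def x_def y_def algebra_simps power2_eq_square)
  have 2: "(\<Sum>\<alpha>\<in>UNIV. (cmod (lattice_DFT M (\<lambda>k. tensor_contract A (lattice_hessian U k) $ \<alpha>) \<theta>))\<^sup>2) =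
      (norm (tensor_contract A (rank_one_hessian (s \<theta>) (x \<theta>))))\<^sup>2 + (norm (tensor_contract A (rank_one_hessian (s \<theta>) (y \<theta>))))\<^sup>2" for \<theta>
  proof -
    have "lattice_DFT M (\<lambda>k. tensor_contract A (lattice_hessian U k) $ \<alpha>) \<theta> =
       (\<Sum>\<beta>\<in>UNIV. \<Sum>i\<in>UNIV. \<Sum>j\<in>UNIV. of_real (A $ \<alpha> $ \<beta> $ i $ j) * lattice_DFT M (?D \<beta> i j) \<theta>)" for \<alpha>
    proof -
      \<comment> \<open>The padding by factors 1 gives each nested sum the shape of
        \<open>lattice_DFT_sum\<close>, which is then applied once per summation.\<close>
      have "lattice_DFT M (\<lambda>k. tensor_contract A (lattice_hessian U k) $ \<alpha>) \<theta> =
        lattice_DFT M (\<lambda>k. \<Sum>\<beta>\<in>UNIV. 1 * (\<Sum>i\<in>UNIV. 1 * (\<Sum>j\<in>UNIV. A $ \<alpha> $ \<beta> $ i $ j * ?D \<beta> i j k))) \<theta>"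
        by (simp add: tensor_contract_def lattice_hessian_def)
      then show ?thesis unfolding lattice_DFT_sum by simp
    qed
    then have "Re (lattice_DFT M (\<lambda>k. tensor_contract A (lattice_hessian U k) $ \<alpha>) \<theta>) =
         tensor_contract A (rank_one_hessian (s \<theta>) (x \<theta>)) $ \<alpha>"
       "Im (lattice_DFT M (\<lambda>k. tensor_contract A (lattice_hessian U k) $ \<alpha>) \<theta>) =
         tensor_contract A (rank_one_hessian (s \<theta>) (y \<theta>)) $ \<alpha>" for \<alpha>
      unfolding hat by (simp_all add: tensor_contract_def rank_one_hessian_def x_def y_def mult_ac)
    then show ?thesis
      unfolding norm_vec_sq sum.distrib[symmetric] cmod_power2 by simp
  qed
  have swap1: "of_nat (card ?B) * (\<Sum>k\<in>?B. (norm (lattice_hessian U k))\<^sup>2) =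
      (\<Sum>\<theta>\<in>?B. \<Sum>\<alpha>\<in>UNIV. \<Sum>i\<in>UNIV. \<Sum>j\<in>UNIV. (cmod (lattice_DFT M (?D \<alpha> i j) \<theta>))\<^sup>2)"
    by (simp add: norm_tensor_sq lattice_hessian_def sum.swap[of _ _ ?B] lattice_Parseval[OF M] sum_distrib_left)
  have swap2: "of_nat (card ?B) * (\<Sum>k\<in>?B. (norm (tensor_contract A (lattice_hessian U k)))\<^sup>2) =
      (\<Sum>\<theta>\<in>?B. \<Sum>\<alpha>\<in>UNIV. (cmod (lattice_DFT M (\<lambda>k. tensor_contract A (lattice_hessian U k) $ \<alpha>) \<theta>))\<^sup>2)"
    by (simp add: norm_vec_sq sum.swap[of _ _ ?B] lattice_Parseval[OF M] sum_distrib_left)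
  have "(ellipticity_constant A)\<^sup>2 * (of_nat (card ?B) * (\<Sum>k\<in>?B. (norm (lattice_hessian U k))\<^sup>2))
    \<le> of_nat (card ?B) * (\<Sum>k\<in>?B. (norm (tensor_contract A (lattice_hessian U k)))\<^sup>2)"
    unfolding swap1 swap2 1 2 unfolding sum_distrib_left distrib_left
    by (intro sum_mono add_mono tensor_contract_rank_one_ge nonneg)
  moreover have "card ?B > 0"
  proof -
    have "(\<lambda>_. 0) \<in> ?B" using M by (simp add: lattice_box_def)
    then show ?thesis by (auto simp: card_gt_0_iff)
  qed
  ultimately show ?thesis by simp
qed

section \<open>The inequality for second differences\<close>

lemma integrable_lborel_translate:
  fixes f :: "'a::euclidean_space \<Rightarrow> 'b::{banach, second_countable_topology}"
  assumes "integrable lborel f"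
  shows "integrable lborel (\<lambda>x. f (x + a))"
proof -
  have "f \<in> borel_measurable borel" using assms by auto
  then show ?thesis
    using assms integrable_distr_eq[of "(+) a" lborel borel f] by (simp add: lborel_distr_plus add.commute)
qed

lemma integral_lborel_translate:
  fixes f :: "'a::euclidean_space \<Rightarrow> real"
  assumes "f \<in> borel_measurable borel"
  shows "(LINT x|lborel. f (x + a)) = (LINT x|lborel. f x)"
  using assms integral_distr[of "(+) a" lborel borel f] by (simp add: lborel_distr_plus add.commute)

lemma integrable_bounded_support:
  fixes f :: "'a::euclidean_space \<Rightarrow> real"
  assumes "f \<in> borel_measurable borel" "\<And>x. \<bar>f x\<bar> \<le> C" "\<And>x. norm x > R \<Longrightarrow> f x = 0"
  shows "integrable lborel f"
proof (rule Bochner_Integration.integrable_bound)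
  show "integrable lborel (\<lambda>x. indicator (cball (0::'a) R) x *\<^sub>R C)"
    using emeasure_lborel_cball_finite[of "0::'a" R]
    by (intro integrable_scaleR_left integrable_real_indicator) auto
  show "AE x in lborel. norm (f x) \<le> norm (indicator (cball (0::'a) R) x *\<^sub>R C)"
  proof (rule AE_I2)
    fix x
    show "norm (f x) \<le> norm (indicator (cball 0 R) x *\<^sub>R C)"
      using assms(2)[of x] assms(3)[of x] by (cases "norm x \<le> R") auto
  qed
qed (use assms in auto)

definition lattice_vec :: "real \<Rightarrow> ('n \<Rightarrow> int) \<Rightarrow> real^'n" where
  "lattice_vec h k = (\<chi> i. h * of_int (k i))"

text \<open>The half-open cubes of side h tile space, so integrating over space means integrating
  lattice sums over one cell. The shift by c recentres the box, whose indices start at 0, so that a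
  support around the origin fits into it.\<close>

lemma integral_lattice_cells:
  fixes \<Phi> :: "real^'n \<Rightarrow> real"
  assumes int: "integrable lborel \<Phi>" and h: "h > 0"
    and supp: "\<And>x i. \<Phi> x \<noteq> 0 \<Longrightarrow> - h * of_int c \<le> x $ i \<and> x $ i < h * (of_nat M - of_int c)"
  shows "(LINT x|lborel. \<Phi> x) =
    (LINT x|lborel. indicator {x. \<forall>i. 0 \<le> x $ i \<and> x $ i < h} x *
      (\<Sum>k\<in>lattice_box M. \<Phi> (x + lattice_vec h (\<lambda>i. k i - c))))"
proof -
  let ?Q = "{x::real^'n. \<forall>i. 0 \<le> x $ i \<and> x $ i < h}"
  let ?B = "lattice_box M :: ('n \<Rightarrow> int) set"
  let ?v = "\<lambda>k. lattice_vec h (\<lambda>i. k i - c) :: real^'n"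
  have [measurable]: "\<Phi> \<in> borel_measurable borel" using int by auto
  have [measurable]: "?Q \<in> sets borel" by measurable
  have pt: "\<Phi> y = (\<Sum>k\<in>?B. indicator ?Q (y - ?v k) * \<Phi> y)" for y
  proof (cases "\<Phi> y = 0")
    case False
    \<comment> \<open>The index of the only cell that contains y; the support hypothesis places it
      in the box.\<close>
    define k0 where "k0 = (\<lambda>i. \<lfloor>y $ i / h\<rfloor> + c)"
    have eq: "y - ?v k \<in> ?Q \<longleftrightarrow> k = k0" for k
    proof -
      have "(0 \<le> y $ i - h * of_int (k i - c) \<and> y $ i - h * of_int (k i - c) < h) \<longleftrightarrow> k i = k0 i" for i
      proof -
        have "(0 \<le> y $ i - h * of_int (k i - c) \<and> y $ i - h * of_int (k i - c) < h) \<longleftrightarrow>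
            (of_int (k i - c) \<le> y $ i / h \<and> y $ i / h < of_int (k i - c) + 1)"
          using h by (simp add: field_simps)
        also have "\<dots> \<longleftrightarrow> \<lfloor>y $ i / h\<rfloor> = k i - c"
          using floor_eq_iff[of "y $ i / h" "k i - c"] by blast
        finally show ?thesis by (auto simp: k0_def)
      qed
      then show ?thesis by (auto simp: lattice_vec_def fun_eq_iff)
    qed
    have "k0 \<in> ?B"
    proof -
      have "0 \<le> k0 i \<and> k0 i < int M" for i
      proof -
        have "of_int (- c) \<le> y $ i / h" "y $ i / h < of_int (int M - c)"
          using supp[OF False, of i] h by (auto simp: field_simps)
        then have "- c \<le> \<lfloor>y $ i / h\<rfloor>" "\<lfloor>y $ i / h\<rfloor> < int M - c"
          by (simp_all only: le_floor_iff floor_less_iff)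
        then show ?thesis by (simp add: k0_def)
      qed
      then show ?thesis by (simp add: lattice_box_def)
    qed
    then show ?thesis
      unfolding indicator_def eq by (simp add: if_distrib[of "\<lambda>x. x * _"] cong: if_cong)
  qed simp
  have i1: "integrable lborel (\<lambda>y. indicator ?Q (y - ?v k) * \<Phi> y)" for k
    by (rule Bochner_Integration.integrable_bound[OF int]) (auto simp: indicator_def)
  have i2: "integrable lborel (\<lambda>x. indicator ?Q x * \<Phi> (x + ?v k))" for k
    using integrable_lborel_translate[OF i1[of k], of "?v k"] by simp
  have "(LINT x|lborel. \<Phi> x) = (LINT y|lborel. (\<Sum>k\<in>?B. indicator ?Q (y - ?v k) * \<Phi> y))"
    by (subst pt) rule
  also have "\<dots> = (\<Sum>k\<in>?B. (LINT y|lborel. indicator ?Q (y - ?v k) * \<Phi> y))"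
    by (rule Bochner_Integration.integral_sum) (rule i1)
  also have "\<dots> = (\<Sum>k\<in>?B. (LINT x|lborel. indicator ?Q x * \<Phi> (x + ?v k)))"
    using integral_lborel_translate[of "\<lambda>y. indicator ?Q (y - ?v k) * \<Phi> y" "?v k" for k] by simp
  also have "\<dots> = (LINT x|lborel. (\<Sum>k\<in>?B. indicator ?Q x * \<Phi> (x + ?v k)))"
    by (rule Bochner_Integration.integral_sum[symmetric]) (rule i2)
  finally show ?thesis by (simp add: sum_distrib_left)
qed

lemma borel_measurable_vec_nth [measurable (raw)]:
  fixes f :: "'a \<Rightarrow> 'b::euclidean_space^'m"
  assumes "f \<in> borel_measurable M"
  shows "(\<lambda>x. f x $ i) \<in> borel_measurable M"
  using measurable_compose[OF assms borel_measurable_continuous_onI[of "\<lambda>v. v $ i"]]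
  by (simp add: continuous_on_component)

lemma borel_measurable_vecI:
  fixes f :: "'a \<Rightarrow> 'b::euclidean_space^'m"
  assumes "\<And>i. (\<lambda>x. f x $ i) \<in> borel_measurable M"
  shows "f \<in> borel_measurable M"
  unfolding borel_measurable_euclidean_space[of f] Basis_vec_def
  using assms by (auto simp: inner_axis)

section \<open>Stability of the inequality under scaling and limits\<close>

lemma linear_tensor_contract: "linear (tensor_contract A)"
  by (rule linearI)
     (simp_all add: tensor_contract_def vec_eq_iff algebra_simps sum.distrib sum_distrib_left)

lemma bounded_linear_tensor_contract: "bounded_linear (tensor_contract A)"
  using linear_tensor_contract linear_conv_bounded_linear by blast

lemma tensor_contract_measurable [measurable]: "tensor_contract A \<in> borel_measurable borel"
  by (intro borel_measurable_continuous_onI linear_continuous_on bounded_linear_tensor_contract)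

lemma tensor_contract_bound:
  obtains C where "C > 0" "\<And>X. norm (tensor_contract A X) \<le> C * norm X"
  using bounded_linear.pos_bounded[OF bounded_linear_tensor_contract, of A] by (auto simp: mult.commute)

text \<open>Measurability and integrability are part of the predicate because the integral of a
  non-integrable function is 0 by convention, which would make the bare inequality say nothing about
  F.\<close>

definition hessian_inequality :: "real^'n^'n^'N^'N \<Rightarrow> (real^'n \<Rightarrow> real^'n^'n^'N) \<Rightarrow> bool" where
  "hessian_inequality A F \<longleftrightarrow> F \<in> borel_measurable borel \<and> integrable lborel (\<lambda>x. (norm (F x))\<^sup>2) \<and>
    (ellipticity_constant A)\<^sup>2 * (LINT x|lborel. (norm (F x))\<^sup>2)
      \<le> (LINT x|lborel. (norm (tensor_contract A (F x)))\<^sup>2)"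

lemma hessian_inequality_scale:
  assumes "hessian_inequality A F"
  shows "hessian_inequality A (\<lambda>x. c *\<^sub>R F x)"
proof -
  have "c\<^sup>2 * ((ellipticity_constant A)\<^sup>2 * (LINT x|lborel. (norm (F x))\<^sup>2))
      \<le> c\<^sup>2 * (LINT x|lborel. (norm (tensor_contract A (F x)))\<^sup>2)"
    using assms by (intro mult_left_mono) (auto simp: hessian_inequality_def)
  then show ?thesis
    using assms
    by (auto simp: hessian_inequality_def power_mult_distrib linear_scale[OF linear_tensor_contract] mult_ac)
qed

text \<open>Young's inequality with a weight: the factor of the main term a can be brought
  arbitrarily close to 1 at the expense of b, which is what keeps the constant sharp in the limit.
  The choice t = 1 gives the crude bounds used elsewhere.\<close>

lemma norm_add_sq_le:
  fixes a b :: "'a::real_normed_vector"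
  assumes "t > 0"
  shows "(norm (a + b))\<^sup>2 \<le> (1 + t) * (norm a)\<^sup>2 + (1 + 1 / t) * (norm b)\<^sup>2"
proof -
  have "0 \<le> (sqrt t * norm a - norm b / sqrt t)\<^sup>2" by simp
  also have "\<dots> = t * (norm a)\<^sup>2 + (norm b)\<^sup>2 / t - 2 * norm a * norm b"
    using assms by (simp add: power2_diff power_mult_distrib power_divide)
  finally have "2 * norm a * norm b \<le> t * (norm a)\<^sup>2 + (norm b)\<^sup>2 / t" by simp
  moreover have "(norm (a + b))\<^sup>2 \<le> (norm a + norm b)\<^sup>2"
    by (intro power_mono norm_triangle_ineq) simp
  ultimately show ?thesis by (simp add: power2_sum algebra_simps)
qed

lemma integrable_norm_sq_diff:
  fixes F G :: "real^'n \<Rightarrow> 'b::euclidean_space"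
  assumes [measurable]: "F \<in> borel_measurable borel" "G \<in> borel_measurable borel"
    and "integrable lborel (\<lambda>x. (norm (F x))\<^sup>2)" "integrable lborel (\<lambda>x. (norm (G x))\<^sup>2)"
  shows "integrable lborel (\<lambda>x. (norm (F x - G x))\<^sup>2)"
proof (rule Bochner_Integration.integrable_bound)
  show "integrable lborel (\<lambda>x. 2 * (norm (F x))\<^sup>2 + 2 * (norm (G x))\<^sup>2)"
    using assms by auto
  show "AE x in lborel. norm ((norm (F x - G x))\<^sup>2) \<le> norm (2 * (norm (F x))\<^sup>2 + 2 * (norm (G x))\<^sup>2)"
    using norm_add_sq_le[of 1 "F _" "- G _"] by (intro AE_I2) simp
qed measurable

lemma integrable_tensor_contract_sq:
  assumes [measurable]: "F \<in> borel_measurable borel" and "integrable lborel (\<lambda>x. (norm (F x))\<^sup>2)"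
  shows "integrable lborel (\<lambda>x. (norm (tensor_contract A (F x)))\<^sup>2)"
proof -
  obtain C where C: "C > 0" "\<And>X. norm (tensor_contract A X) \<le> C * norm X"
    using tensor_contract_bound by blast
  show ?thesis
  proof (rule Bochner_Integration.integrable_bound)
    show "integrable lborel (\<lambda>x. C\<^sup>2 * (norm (F x))\<^sup>2)" using assms by auto
    show "AE x in lborel. norm ((norm (tensor_contract A (F x)))\<^sup>2) \<le> norm (C\<^sup>2 * (norm (F x))\<^sup>2)"
      using power_mono[OF C(2), of _ 2] by (intro AE_I2) (simp add: power_mult_distrib)
  qed measurable
qed

text \<open>The weighted bound is applied twice, to pass from G to \<open>F m\<close> and, after
  contraction with A, from \<open>F m\<close> back to G. Each use costs a factor 1 + t, whence
  \<open>(1 + t)\<^sup>2\<close>; for fixed t the remainder is a multiple of \<open>d m\<close> and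
  vanishes.\<close>

lemma hessian_inequality_limit:
  assumes F: "\<And>m. hessian_inequality A (F m)"
    and G [measurable]: "G \<in> borel_measurable borel" and G2: "integrable lborel (\<lambda>x. (norm (G x))\<^sup>2)"
    and lim: "(\<lambda>m. LINT x|lborel. (norm (F m x - G x))\<^sup>2) \<longlonglongrightarrow> 0"
  shows "hessian_inequality A G"
proof -
  let ?\<nu> = "ellipticity_constant A"
  define I J d where "I = (LINT x|lborel. (norm (G x))\<^sup>2)"
    and "J = (LINT x|lborel. (norm (tensor_contract A (G x)))\<^sup>2)"
    and "d m = (LINT x|lborel. (norm (F m x - G x))\<^sup>2)" for m
  obtain C where C: "C > 0" "\<And>X. norm (tensor_contract A X) \<le> C * norm X"
    using tensor_contract_bound by blast
  have F_meas [measurable]: "F m \<in> borel_measurable borel" and F2: "integrable lborel (\<lambda>x. (norm (F m x))\<^sup>2)" for m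
    using F by (auto simp: hessian_inequality_def)
  note d_int = integrable_norm_sq_diff[OF F_meas G F2 G2]
  note AF_int = integrable_tensor_contract_sq[OF F_meas F2]
  note AG_int = integrable_tensor_contract_sq[OF G G2]
  have bound: "?\<nu>\<^sup>2 * I \<le> (1 + t)\<^sup>2 * J" if t: "t > 0" for t
  proof (rule LIMSEQ_le_const)
    show "(\<lambda>m. (1 + t)\<^sup>2 * J + ((1 + t) * (1 + 1 / t) * C\<^sup>2 + ?\<nu>\<^sup>2 * (1 + 1 / t)) * d m) \<longlonglongrightarrow> (1 + t)\<^sup>2 * J"
      using lim unfolding d_def by (auto intro!: tendsto_eq_intros)
    have "?\<nu>\<^sup>2 * I \<le> (1 + t)\<^sup>2 * J + ((1 + t) * (1 + 1 / t) * C\<^sup>2 + ?\<nu>\<^sup>2 * (1 + 1 / t)) * d m" for m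
    proof -
      have "I \<le> (LINT x|lborel. (1 + t) * (norm (F m x))\<^sup>2 + (1 + 1 / t) * (norm (F m x - G x))\<^sup>2)"
        unfolding I_def
      proof (rule integral_mono)
        fix x
        show "(norm (G x))\<^sup>2 \<le> (1 + t) * (norm (F m x))\<^sup>2 + (1 + 1 / t) * (norm (F m x - G x))\<^sup>2"
          using norm_add_sq_le[OF t, of "F m x" "G x - F m x"] by (simp add: norm_minus_commute)
      qed (use G2 F2 d_int in auto)
      also have "\<dots> = (1 + t) * (LINT x|lborel. (norm (F m x))\<^sup>2) + (1 + 1 / t) * d m"
        using F2 d_int by (simp add: d_def)
      finally have 1: "I \<le> \<dots>" .
      have 2: "?\<nu>\<^sup>2 * (LINT x|lborel. (norm (F m x))\<^sup>2) \<le> (LINT x|lborel. (norm (tensor_contract A (F m x)))\<^sup>2)"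
        using F by (auto simp: hessian_inequality_def)
      have "(LINT x|lborel. (norm (tensor_contract A (F m x)))\<^sup>2) \<le>
        (LINT x|lborel. (1 + t) * (norm (tensor_contract A (G x)))\<^sup>2 + (1 + 1 / t) * (C\<^sup>2 * (norm (F m x - G x))\<^sup>2))"
      proof (rule integral_mono)
        fix x
        have "(norm (tensor_contract A (F m x)))\<^sup>2 \<le> (1 + t) * (norm (tensor_contract A (G x)))\<^sup>2 +
            (1 + 1 / t) * (norm (tensor_contract A (F m x - G x)))\<^sup>2"
          using norm_add_sq_le[OF t, of "tensor_contract A (G x)" "tensor_contract A (F m x - G x)"]
          by (simp add: linear_diff[OF linear_tensor_contract])
        also have "(norm (tensor_contract A (F m x - G x)))\<^sup>2 \<le> C\<^sup>2 * (norm (F m x - G x))\<^sup>2"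
          using power_mono[OF C(2), of "F m x - G x" 2] by (simp add: power_mult_distrib)
        finally show "(norm (tensor_contract A (F m x)))\<^sup>2 \<le> (1 + t) * (norm (tensor_contract A (G x)))\<^sup>2 +
            (1 + 1 / t) * (C\<^sup>2 * (norm (F m x - G x))\<^sup>2)"
          using t by (simp add: mult_left_mono)
      qed (use AF_int AG_int d_int in auto)
      also have "\<dots> = (1 + t) * J + (1 + 1 / t) * (C\<^sup>2 * d m)"
        using AG_int d_int by (simp add: d_def J_def)
      finally have 3: "?\<nu>\<^sup>2 * (LINT x|lborel. (norm (F m x))\<^sup>2) \<le> (1 + t) * J + (1 + 1 / t) * (C\<^sup>2 * d m)"
        using 2 by linarith
      have "?\<nu>\<^sup>2 * I \<le> (1 + t) * (?\<nu>\<^sup>2 * (LINT x|lborel. (norm (F m x))\<^sup>2)) + ?\<nu>\<^sup>2 * (1 + 1 / t) * d m"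
        using mult_left_mono[OF 1, of "?\<nu>\<^sup>2"] by (simp add: algebra_simps)
      also have "\<dots> \<le> (1 + t) * ((1 + t) * J + (1 + 1 / t) * (C\<^sup>2 * d m)) + ?\<nu>\<^sup>2 * (1 + 1 / t) * d m"
        using 3 t by (intro add_right_mono mult_left_mono) auto
      finally show ?thesis by (simp add: algebra_simps power2_eq_square)
    qed
    then show "\<exists>N. \<forall>m\<ge>N. ?\<nu>\<^sup>2 * I \<le> (1 + t)\<^sup>2 * J + ((1 + t) * (1 + 1 / t) * C\<^sup>2 + ?\<nu>\<^sup>2 * (1 + 1 / t)) * d m"
      by blast
  qed
  \<comment> \<open>Only now does t tend to 0: the factor 1 + 1/t in the remainder blows up, so the
    limit in m has to come first.\<close>
  have "?\<nu>\<^sup>2 * I \<le> J"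
  proof (rule LIMSEQ_le_const)
    have "(\<lambda>m. (1 + inverse (real (Suc m)))\<^sup>2 * J) \<longlonglongrightarrow> (1 + 0)\<^sup>2 * J"
      by (intro tendsto_intros LIMSEQ_inverse_real_of_nat)
    then show "(\<lambda>m. (1 + inverse (real (Suc m)))\<^sup>2 * J) \<longlonglongrightarrow> J" by simp
    show "\<exists>N. \<forall>m\<ge>N. ?\<nu>\<^sup>2 * I \<le> (1 + inverse (real (Suc m)))\<^sup>2 * J"
      using bound[of "inverse (real (Suc _))"] by simp
  qed
  then show ?thesis using G G2 by (simp add: hessian_inequality_def I_def J_def)
qed

section \<open>Second differences along the translates of a lattice\<close>

definition hessian_difference :: "real \<Rightarrow> (real^'n \<Rightarrow> real^'N) \<Rightarrow> real^'n \<Rightarrow> real^'n^'n^'N" where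
  "hessian_difference h w x = (\<chi> \<alpha> i j.
     w (x + h *\<^sub>R (axis i 1 + axis j 1)) $ \<alpha> - w (x + h *\<^sub>R (axis i 1 - axis j 1)) $ \<alpha>
     - w (x + h *\<^sub>R (- axis i 1 + axis j 1)) $ \<alpha> + w (x + h *\<^sub>R (- axis i 1 - axis j 1)) $ \<alpha>)"

lemma lattice_hessian_restrict:
  "lattice_hessian (\<lambda>k. w (x + lattice_vec h (\<lambda>i. k i - c))) k =
     hessian_difference h w (x + lattice_vec h (\<lambda>i. k i - c))"
proof -
  have *: "lattice_vec h (\<lambda>l. k l + (unit_step i l + unit_step j l) - c) = lattice_vec h (\<lambda>i. k i - c) + h *\<^sub>R (axis i 1 + axis j 1)"
    "lattice_vec h (\<lambda>l. k l + (unit_step i l - unit_step j l) - c) = lattice_vec h (\<lambda>i. k i - c) + h *\<^sub>R (axis i 1 - axis j 1)"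
    "lattice_vec h (\<lambda>l. k l + (- unit_step i l + unit_step j l) - c) = lattice_vec h (\<lambda>i. k i - c) + h *\<^sub>R (- axis i 1 + axis j 1)"
    "lattice_vec h (\<lambda>l. k l + (- unit_step i l - unit_step j l) - c) = lattice_vec h (\<lambda>i. k i - c) + h *\<^sub>R (- axis i 1 - axis j 1)" for i j
    by (auto simp: lattice_vec_def vec_eq_iff unit_step_def axis_def algebra_simps)
  show ?thesis
    unfolding lattice_hessian_def hessian_difference_def lattice_diff2_def * add.assoc by (rule refl)
qed

lemma hessian_difference_borel [measurable]:
  assumes [measurable]: "w \<in> borel_measurable borel"
  shows "hessian_difference h w \<in> borel_measurable borel"
  by (intro borel_measurable_vecI) (simp add: hessian_difference_def)

lemma hessian_difference_bounded:
  fixes w :: "real^'n \<Rightarrow> real^'N"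
  assumes w: "\<And>x. norm (w x) \<le> C"
  shows "\<exists>C'. \<forall>x. norm (hessian_difference h w x) \<le> C'"
proof -
  have c: "\<bar>w x $ \<alpha>\<bar> \<le> C" for x \<alpha>
    using component_le_norm_cart[of "w x" \<alpha>] w[of x] by linarith
  have "(norm (hessian_difference h w x))\<^sup>2 \<le> (\<Sum>\<alpha>\<in>(UNIV::'N set). \<Sum>i\<in>(UNIV::'n set). \<Sum>j\<in>(UNIV::'n set). (4 * C)\<^sup>2)" for x
    unfolding norm_tensor_sq
  proof (intro sum_mono)
    fix \<alpha> i j
    have "\<bar>hessian_difference h w x $ \<alpha> $ i $ j\<bar> \<le> 4 * C"
      unfolding hessian_difference_def
      using c[of "x + h *\<^sub>R (axis i 1 + axis j 1)" \<alpha>] c[of "x + h *\<^sub>R (axis i 1 - axis j 1)" \<alpha>]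
        c[of "x + h *\<^sub>R (- axis i 1 + axis j 1)" \<alpha>] c[of "x + h *\<^sub>R (- axis i 1 - axis j 1)" \<alpha>]
      by simp
    then show "(hessian_difference h w x $ \<alpha> $ i $ j)\<^sup>2 \<le> (4 * C)\<^sup>2"
      by (metis abs_le_square_iff abs_of_nonneg abs_ge_zero order_trans)
  qed
  then have "norm (hessian_difference h w x) \<le> sqrt (\<Sum>\<alpha>\<in>(UNIV::'N set). \<Sum>i\<in>(UNIV::'n set). \<Sum>j\<in>(UNIV::'n set). (4 * C)\<^sup>2)" for x
    by (rule real_le_rsqrt)
  then show ?thesis by blast
qed

lemma hessian_difference_eq_0:
  fixes w :: "real^'n \<Rightarrow> real^'N"
  assumes w: "\<And>x. norm x > r \<Longrightarrow> w x = 0" and x: "norm x > r + 2 * h" and h: "h > 0"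
  shows "hessian_difference h w x = 0"
proof -
  have "w (x + h *\<^sub>R v) = 0" if "norm v \<le> 2" for v
  proof (rule w)
    have "norm (h *\<^sub>R v) \<le> 2 * h" using that h by (simp add: mult.commute)
    then show "norm (x + h *\<^sub>R v) > r"
      using norm_triangle_ineq4[of "x + h *\<^sub>R v" "h *\<^sub>R v"] x by simp
  qed
  moreover have "norm (axis i 1 + axis j 1 :: real^'n) \<le> 2" "norm (axis i 1 - axis j 1 :: real^'n) \<le> 2"
    "norm (- axis i 1 + axis j 1 :: real^'n) \<le> 2" "norm (- axis i 1 - axis j 1 :: real^'n) \<le> 2" for i j
    using norm_triangle_ineq[of "axis i 1::real^'n" "axis j 1"] norm_triangle_ineq4[of "axis i 1::real^'n" "axis j 1"]
     norm_triangle_ineq[of "- axis i 1::real^'n" "axis j 1"] norm_triangle_ineq4[of "- axis i 1::real^'n" "axis j 1"]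
    by simp_all
  ultimately show ?thesis
    by (simp add: hessian_difference_def vec_eq_iff)
qed

text \<open>Bounded support makes every restriction of w to a translate of h Z^n finitely supported,
  and the lattice inequality applies translate by translate; boundedness makes the integrals finite.
  The differences stay undivided since the inequality is homogeneous in the Hessian.\<close>

proposition hessian_inequality_difference:
  fixes A :: "real^'n^'n^'N^'N" and w :: "real^'n \<Rightarrow> real^'N"
  assumes w_meas [measurable]: "w \<in> borel_measurable borel" and w_bdd: "\<And>x. norm (w x) \<le> C"
    and w_supp: "\<And>x. norm x > r \<Longrightarrow> w x = 0" and h: "h > 0" and nonneg: "ellipticity_constant A \<ge> 0"
  shows "hessian_inequality A (hessian_difference h w)"
proof -
  let ?D = "hessian_difference h w" and ?\<nu> = "ellipticity_constant A"
  obtain C' where C': "\<And>x. norm (?D x) \<le> C'"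
    using hessian_difference_bounded[of w C h] w_bdd by blast
  have D0: "?D x = 0" if "norm x > r + 2 * h" for x
    using hessian_difference_eq_0[OF w_supp that h] by simp
  have D_int: "integrable lborel (\<lambda>x. (norm (?D x))\<^sup>2)"
    by (rule integrable_bounded_support[of _ "C'\<^sup>2" "r + 2 * h"]) (auto simp: D0 C' intro!: power_mono)
  note AD_int = integrable_tensor_contract_sq[OF hessian_difference_borel[OF w_meas, of h] D_int, of A]
  \<comment> \<open>The deficit of the inequality. It need not be non-negative at a point; what is
    non-negative is its sum over each translate of the lattice.\<close>
  define \<Phi> where "\<Phi> x = (norm (tensor_contract A (?D x)))\<^sup>2 - ?\<nu>\<^sup>2 * (norm (?D x))\<^sup>2" for x
  have \<Phi>_int: "integrable lborel \<Phi>"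
    unfolding \<Phi>_def using D_int AD_int by auto
  \<comment> \<open>Of the three extra cells, two pay for the reach of the second differences and
    one for the offset of x within its cell. With M = 2c the recentred indices run from -c to c -
    1.\<close>
  define c where "c = \<lceil>\<bar>r\<bar> / h\<rceil> + 3"
  define M where "M = nat (2 * c)"
  have "0 \<le> \<bar>r\<bar> / h" using h by simp
  then have "\<lceil>\<bar>r\<bar> / h\<rceil> \<ge> 0" by linarith
  then have "c \<ge> 3" unfolding c_def by linarith
  then have M: "int M = 2 * c" "M > 0" unfolding M_def by auto
  have "\<bar>r\<bar> / h + 3 \<le> of_int c" unfolding c_def by (simp add: le_of_int_ceiling)
  then have rc: "\<bar>r\<bar> + 3 * h \<le> h * of_int c" using h by (simp add: field_simps)
  have "(LINT x|lborel. \<Phi> x) =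
    (LINT x|lborel. indicator {x. \<forall>i. 0 \<le> x $ i \<and> x $ i < h} x *
      (\<Sum>k\<in>lattice_box M. \<Phi> (x + lattice_vec h (\<lambda>i. k i - c))))"
  proof (rule integral_lattice_cells[OF \<Phi>_int h])
    fix x i assume "\<Phi> x \<noteq> 0"
    then have "?D x \<noteq> 0" by (auto simp: \<Phi>_def linear_0[OF linear_tensor_contract])
    then have "norm x \<le> r + 2 * h" using D0 by force
    then have "\<bar>x $ i\<bar> \<le> r + 2 * h" using component_le_norm_cart[of x i] by linarith
    moreover have "h * (of_nat M - of_int c) = h * of_int c"
      using M(1) by (metis add_diff_cancel_right' mult_2 of_int_diff of_int_of_nat_eq)
    ultimately show "- h * of_int c \<le> x $ i \<and> x $ i < h * (of_nat M - of_int c)"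
      using rc h by auto
  qed
  also have "\<dots> \<ge> 0"
  proof (rule Bochner_Integration.integral_nonneg)
    fix x :: "real^'n"
    show "0 \<le> indicator {x. \<forall>i. 0 \<le> x $ i \<and> x $ i < h} x *
      (\<Sum>k\<in>lattice_box M. \<Phi> (x + lattice_vec h (\<lambda>i. k i - c)))"
    proof (cases "\<forall>i. 0 \<le> x $ i \<and> x $ i < h")
      case True
      have "?\<nu>\<^sup>2 * (\<Sum>k\<in>lattice_box M. (norm (lattice_hessian (\<lambda>k. w (x + lattice_vec h (\<lambda>i. k i - c))) k))\<^sup>2)
        \<le> (\<Sum>k\<in>lattice_box M. (norm (tensor_contract A (lattice_hessian (\<lambda>k. w (x + lattice_vec h (\<lambda>i. k i - c))) k)))\<^sup>2)"
      proof (rule lattice_hessian_inequality[OF _ nonneg M(2)])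
        fix k :: "'n \<Rightarrow> int" and l
        assume "w (x + lattice_vec h (\<lambda>i. k i - c)) \<noteq> 0"
        then have "norm (x + lattice_vec h (\<lambda>i. k i - c)) \<le> r" using w_supp by force
        then have "\<bar>x $ l + (h * of_int (k l) - h * of_int c)\<bar> \<le> r"
          using component_le_norm_cart[of "x + lattice_vec h (\<lambda>i. k i - c)" l]
          by (simp add: lattice_vec_def right_diff_distrib)
        moreover have "0 \<le> x $ l" "x $ l < h" using True by auto
        ultimately have "h * of_int (k l) < 2 * (h * of_int c) - 2 * h" "h < h * of_int (k l)"
          using rc h by linarith+
        then have "h * of_int (k l) < h * of_int (2 * c - 2)" "h * of_int 1 < h * of_int (k l)"
          by (simp_all only: of_int_diff of_int_mult of_int_numeral of_int_1 right_diff_distrib mult_ac mult_1_left)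
        then have "of_int (k l) < (of_int (2 * c - 2) :: real)" "(of_int 1 :: real) < of_int (k l)"
          using h by (simp_all only: mult_less_cancel_left_pos)
        \<comment> \<open>The strict bound \<open>1 < k l\<close> becomes the required lower margin
          2 because \<open>k l\<close> is an integer.\<close>
        then show "2 \<le> k l \<and> k l < int M - 2"
          unfolding M(1) of_int_less_iff by linarith
      qed
      then show ?thesis
        unfolding lattice_hessian_restrict \<Phi>_def
        by (simp add: sum_subtractf sum_distrib_left[symmetric])
    qed (auto simp: indicator_def)
  qed
  finally show ?thesis
    using D_int AD_int by (simp add: hessian_inequality_def \<Phi>_def)
qed

section \<open>Mollification in \<open>L\<^sup>2\<close>\<close>

lemma L2_dominated_convergence:
  fixes f :: "real^'n \<Rightarrow> real"
  assumes [measurable]: "\<And>m::nat. F m \<in> borel_measurable borel" "f \<in> borel_measurable borel"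
    and w: "integrable lborel w" "\<And>m x. (F m x - f x)\<^sup>2 \<le> w x"
    and lim: "AE x in lborel. (\<lambda>m. F m x) \<longlonglongrightarrow> f x"
  shows "(\<lambda>m. LINT x|lborel. (F m x - f x)\<^sup>2) \<longlonglongrightarrow> 0"
proof -
  have "(\<lambda>m. LINT x|lborel. (F m x - f x)\<^sup>2) \<longlonglongrightarrow> (LINT x|(lborel :: (real^'n) measure). 0)"
  proof (rule integral_dominated_convergence[OF _ _ w(1)])
    show "AE x in lborel. (\<lambda>m. (F m x - f x)\<^sup>2) \<longlonglongrightarrow> 0"
      using lim
    proof eventually_elim
      case (elim x)
      then have "(\<lambda>m. (F m x - f x)\<^sup>2) \<longlonglongrightarrow> (f x - f x)\<^sup>2" by (intro tendsto_intros)
      then show ?case by simp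
    qed
  qed (use w in auto)
  then show ?thesis by simp
qed

lemma integrable_sq_diff:
  fixes F G :: "real^'n \<Rightarrow> real"
  assumes "F \<in> borel_measurable borel" "G \<in> borel_measurable borel"
    and "integrable lborel (\<lambda>x. (F x)\<^sup>2)" "integrable lborel (\<lambda>x. (G x)\<^sup>2)"
  shows "integrable lborel (\<lambda>x. (F x - G x)\<^sup>2)"
  using integrable_norm_sq_diff[of F G] assms by simp

lemma sq_diff_le: "(a - c)\<^sup>2 \<le> 2 * (a - b)\<^sup>2 + 2 * (b - c)\<^sup>2" for a b c :: real
  using norm_add_sq_le[of 1 "a - b" "b - c"] by simp

text \<open>Clip f in value and in space, then approximate f almost everywhere by continuous
  functions and clip these in the same way. As the clipping maps are continuous and bounded, the
  approximants are continuous with a common bound and support, and dominated convergence applies in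
  both stages.\<close>

lemma L2_dense_continuous:
  fixes f :: "real^'n \<Rightarrow> real"
  assumes f [measurable]: "f \<in> borel_measurable borel" and f2: "integrable lborel (\<lambda>x. (f x)\<^sup>2)" and e: "e > 0"
  obtains g C R where "continuous_on UNIV g" "\<And>x. \<bar>g x\<bar> \<le> C" "\<And>x. norm x > R \<Longrightarrow> g x = 0"
    "(LINT x|lborel. (f x - g x)\<^sup>2) < e"
proof -
  define cut where "cut M x = max 0 (min 1 (M + 1 - norm x))" for M :: real and x :: "real^'n"
  define cl where "cl M y = max (- M) (min M y)" for M y :: real
  have cont_cut: "continuous_on UNIV (cut M)" for M
    unfolding cut_def by (intro continuous_intros)
  have cont_cl: "continuous_on UNIV (cl M)" for M
    unfolding cl_def by (intro continuous_intros)
  have [measurable]: "cut M \<in> borel_measurable borel" "cl M \<in> borel_measurable borel" for M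
    using cont_cut cont_cl by (auto intro: borel_measurable_continuous_onI)
  have cut: "0 \<le> cut M x" "cut M x \<le> 1" for M x by (auto simp: cut_def)
  define T where "T M x = cl M (f x) * cut M x" for M x
  have T_meas [measurable]: "T M \<in> borel_measurable borel" for M unfolding T_def by measurable
  have T_le: "\<bar>T M x - f x\<bar> \<le> \<bar>f x\<bar>" if "M \<ge> 0" for M x
  proof -
    \<comment> \<open>Clipping is multiplication by a factor in [0, 1], and so is the spatial
      cut-off; hence the error is at most |f| and its square is dominated by the integrable square
      of f.\<close>
    have "\<exists>s. 0 \<le> s \<and> s \<le> 1 \<and> cl M (f x) = s * f x"
    proof (cases "\<bar>f x\<bar> \<le> M")
      case True
      then show ?thesis by (intro exI[of _ 1]) (auto simp: cl_def)
    next
      case False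
      then show ?thesis using that
        by (intro exI[of _ "M / \<bar>f x\<bar>"]) (auto simp: cl_def abs_if field_simps split: if_splits)
    qed
    then obtain s where s: "0 \<le> s" "s \<le> 1" "cl M (f x) = s * f x" by blast
    have "T M x - f x = - ((1 - s * cut M x) * f x)" by (simp add: T_def s algebra_simps)
    moreover have "0 \<le> s * cut M x" "s * cut M x \<le> 1" using s cut[of M x] by (auto intro: mult_le_one)
    ultimately show ?thesis by (simp add: abs_mult mult_left_le_one_le)
  qed
  have "(\<lambda>m. LINT x|lborel. (T (real m) x - f x)\<^sup>2) \<longlonglongrightarrow> 0"
  proof (rule L2_dominated_convergence[OF _ _ f2])
    show "(T (real m) x - f x)\<^sup>2 \<le> (f x)\<^sup>2" for m x
      using T_le[of "real m" x] by (simp add: abs_le_square_iff)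
    show "AE x in lborel. (\<lambda>m. T (real m) x) \<longlonglongrightarrow> f x"
    proof (intro AE_I2 tendsto_eventually)
      fix x
      obtain n where n: "real n \<ge> \<bar>f x\<bar> + norm x" using real_arch_simple by blast
      show "\<forall>\<^sub>F m in sequentially. T (real m) x = f x"
        using eventually_ge_at_top[of n]
      proof eventually_elim
        case (elim m)
        then have "\<bar>f x\<bar> \<le> real m" "norm x \<le> real m"
          using n by (smt (verit) norm_ge_zero of_nat_le_iff)+
        then show ?case by (simp add: T_def cl_def cut_def abs_le_iff min_def max_def)
      qed
    qed
  qed auto
  \<comment> \<open>Each of the two errors is doubled when the squares are combined at the end,
    hence e / 4.\<close>
  then have "\<forall>\<^sub>F m in sequentially. (LINT x|lborel. (T (real m) x - f x)\<^sup>2) < e / 4"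
    using e by (intro order_tendstoD(2)) auto
  then obtain m where m: "(LINT x|lborel. (T (real m) x - f x)\<^sup>2) < e / 4"
    by (auto simp: eventually_sequentially)
  define M where "M = real m"
  \<comment> \<open>This notion of measurability provides continuous functions that converge to f
    off a negligible set.\<close>
  have "f measurable_on UNIV"
    by (intro lebesgue_measurable_imp_measurable_on) (simp_all add: measurable_completion)
  then obtain N g where N: "negligible N" and g: "\<And>n. continuous_on UNIV (g n)"
    and lim: "\<And>x. x \<notin> N \<Longrightarrow> (\<lambda>n. g n x) \<longlonglongrightarrow> f x"
    unfolding measurable_on_def by auto
  have AE: "AE x in lborel. (\<lambda>n. g n x) \<longlonglongrightarrow> f x"
    using AE_not_in[of N lebesgue] N lim
    by (simp add: negligible_iff_null_sets AE_completion_iff) (auto elim: eventually_mono)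
  define G where "G n x = cl M (g n x) * cut M x" for n x
  have contG: "continuous_on UNIV (G n)" for n
    unfolding G_def by (intro continuous_intros continuous_on_compose2[OF cont_cl g] cont_cut) auto
  have Mnn: "M \<ge> 0" by (simp add: M_def)
  have cl_bdd: "\<bar>cl M y\<bar> \<le> M" for y using Mnn by (auto simp: cl_def)
  have bdd: "\<bar>cl M y * cut M x\<bar> \<le> M * indicator (cball 0 (M + 1)) x" for y x
  proof (cases "norm x \<le> M + 1")
    case True
    then show ?thesis using cl_bdd[of y] cut[of M x] mult_mono[OF cl_bdd[of y] cut(2)[of M x] Mnn] by (simp add: abs_mult)
  next
    case False
    then show ?thesis by (simp add: cut_def)
  qed
  have "(\<lambda>n. LINT x|lborel. (G n x - T M x)\<^sup>2) \<longlonglongrightarrow> 0"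
  proof (rule L2_dominated_convergence)
    show "G n \<in> borel_measurable borel" for n using contG by (rule borel_measurable_continuous_onI)
    show "integrable lborel (\<lambda>x::real^'n. (2 * M)\<^sup>2 * indicator (cball 0 (M + 1)) x)"
      by (rule integrable_bounded_support[where C="(2 * M)\<^sup>2" and R="M + 1"]) (auto simp: indicator_def)
    show "(G n x - T M x)\<^sup>2 \<le> (2 * M)\<^sup>2 * indicator (cball 0 (M + 1)) x" for n x
    proof -
      have "\<bar>G n x - T M x\<bar> \<le> \<bar>2 * M * indicator (cball 0 (M + 1)) x\<bar>"
        using bdd[of "g n x" x] bdd[of "f x" x] unfolding G_def T_def by linarith
      then have "(G n x - T M x)\<^sup>2 \<le> (2 * M * indicator (cball 0 (M + 1)) x)\<^sup>2"
        by (simp add: abs_le_square_iff)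
      then show ?thesis by (auto simp: indicator_def)
    qed
    show "AE x in lborel. (\<lambda>n. G n x) \<longlonglongrightarrow> T M x"
      using AE
    proof eventually_elim
      case (elim x)
      have "(\<lambda>n. cl M (g n x)) \<longlonglongrightarrow> cl M (f x)"
        using elim cont_cl[of M] isCont_tendsto_compose[of "f x" "cl M"] by (simp add: continuous_on_eq_continuous_at)
      then show ?case unfolding G_def T_def by (intro tendsto_intros)
    qed
  qed auto
  then have "\<forall>\<^sub>F n in sequentially. (LINT x|lborel. (G n x - T M x)\<^sup>2) < e / 4"
    using e by (intro order_tendstoD(2)) auto
  then obtain n where n: "(LINT x|lborel. (G n x - T M x)\<^sup>2) < e / 4"
    by (auto simp: eventually_sequentially)
  have [measurable]: "G n \<in> borel_measurable borel" using contG by (rule borel_measurable_continuous_onI)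
  have Gb: "\<bar>G n x\<bar> \<le> M" for x using bdd[of "g n x" x] Mnn by (cases "norm x \<le> M + 1") (auto simp: G_def)
  have G0: "G n x = 0" if "norm x > M + 1" for x using that by (simp add: G_def cut_def)
  have G2: "integrable lborel (\<lambda>x. (G n x)\<^sup>2)"
    by (rule integrable_bounded_support[where C="M\<^sup>2" and R="M + 1"]) (use Gb G0 Mnn in \<open>auto simp: abs_le_square_iff[symmetric]\<close>)
  have T2: "integrable lborel (\<lambda>x. (T M x)\<^sup>2)"
  proof -
    have "\<bar>T M x\<bar> \<le> M" "norm x > M + 1 \<Longrightarrow> T M x = 0" for x
      using bdd[of "f x" x] Mnn by (cases "norm x \<le> M + 1"; auto simp: T_def cut_def)+
    then show ?thesis
      using Mnn by (intro integrable_bounded_support[where C="M\<^sup>2" and R="M + 1"]) (auto simp: abs_le_square_iff[symmetric])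
  qed
  have "(LINT x|lborel. (f x - G n x)\<^sup>2) \<le> (LINT x|lborel. 2 * (T M x - f x)\<^sup>2 + 2 * (G n x - T M x)\<^sup>2)"
    using sq_diff_le[of "f _" "G n _" "T M _"]
    by (intro integral_mono integrable_sq_diff Bochner_Integration.integrable_add integrable_mult_right f2 G2 T2)
       (auto simp: power2_commute)
  also have "\<dots> = 2 * (LINT x|lborel. (T M x - f x)\<^sup>2) + 2 * (LINT x|lborel. (G n x - T M x)\<^sup>2)"
    using f2 G2 T2 by (simp add: integrable_sq_diff)
  also have "\<dots> < e" using m n by (simp add: M_def)
  finally show thesis using that contG Gb G0 by blast
qed

text \<open>The counterpart of \<open>locally_integrable\<close> for Borel functions and
  \<open>lborel\<close>; testing on balls suffices because every compact set lies in one.\<close>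

definition loc_integrable :: "(real^'n \<Rightarrow> real) \<Rightarrow> bool" where
  "loc_integrable f \<longleftrightarrow> f \<in> borel_measurable borel \<and> (\<forall>r. integrable lborel (\<lambda>x. indicator (cball 0 r) x * f x))"

lemma loc_integrable_borel: "loc_integrable f \<Longrightarrow> f \<in> borel_measurable borel"
  by (simp add: loc_integrable_def)

lemma loc_integrable_L2:
  assumes [measurable]: "f \<in> borel_measurable borel" and "integrable lborel (\<lambda>x. (f x)\<^sup>2)"
  shows "loc_integrable f"
  unfolding loc_integrable_def
proof (intro conjI allI)
  fix r
  have [measurable]: "cball (0::real^'a) r \<in> sets borel" by simp
  show "integrable lborel (\<lambda>x. indicator (cball 0 r) x * f x)"
  proof (rule Bochner_Integration.integrable_bound)
    show "integrable lborel (\<lambda>x. indicator (cball 0 r) x + (f x)\<^sup>2)"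
      by (intro Bochner_Integration.integrable_add assms integrable_bounded_support[where C=1 and R=r])
        (auto intro!: borel_measurable_indicator)
    have "\<bar>y\<bar> \<le> 1 + y\<^sup>2" for y :: real
      using zero_le_power2[of "\<bar>y\<bar> - 1"] by (simp add: power2_diff)
    then show "AE x in lborel. norm (indicator (cball 0 r) x * f x) \<le> norm (indicator (cball 0 r) x + (f x)\<^sup>2)"
      by (intro AE_I2) (auto simp: indicator_def)
  qed measurable
qed (use assms in auto)

lemma loc_integrable_mult_bounded:
  assumes f: "loc_integrable f" and [measurable]: "k \<in> borel_measurable borel"
    and k: "\<And>x. \<bar>k x\<bar> \<le> C" "\<And>x. norm x > R \<Longrightarrow> k x = 0"
  shows "integrable lborel (\<lambda>x. f x * k x)"
proof (rule Bochner_Integration.integrable_bound)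
  have [measurable]: "f \<in> borel_measurable borel" using f by (simp add: loc_integrable_def)
  show "integrable lborel (\<lambda>x. C * (indicator (cball 0 R) x * f x))"
    using f by (intro integrable_mult_right) (simp add: loc_integrable_def)
  show "AE x in lborel. norm (f x * k x) \<le> norm (C * (indicator (cball 0 R) x * f x))"
  proof (intro AE_I2)
    fix x
    have "\<bar>k x\<bar> \<le> \<bar>C\<bar>" using k(1)[of x] by linarith
    then show "norm (f x * k x) \<le> norm (C * (indicator (cball 0 R) x * f x))"
      using k(2)[of x] by (cases "norm x \<le> R") (auto simp: abs_mult mult.commute[of "\<bar>f x\<bar>"] intro: mult_right_mono)
  qed
  show "(\<lambda>x. f x * k x) \<in> borel_measurable lborel" by measurable
qed

section \<open>Convolution with a probability density\<close>

definition convolve :: "(real^'n \<Rightarrow> real) \<Rightarrow> (real^'n \<Rightarrow> real) \<Rightarrow> real^'n \<Rightarrow> real" where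
  "convolve f k x = (LINT y|lborel. f y * k (x - y))"

lemma convolve_integrable:
  assumes f: "loc_integrable f" and [measurable]: "k \<in> borel_measurable borel"
    and k: "\<And>x. \<bar>k x\<bar> \<le> C" "\<And>x. norm x > R \<Longrightarrow> k x = 0"
  shows "integrable lborel (\<lambda>y. f y * k (x - y))"
proof (rule loc_integrable_mult_bounded[OF f])
  show "\<bar>k (x - y)\<bar> \<le> C" for y by (rule k)
  show "k (x - y) = 0" if "norm y > R + norm x" for y
    using that norm_triangle_ineq2[of y x] by (intro k) (simp add: norm_minus_commute)
qed measurable

lemma convolve_borel [measurable]:
  assumes [measurable]: "f \<in> borel_measurable borel" "k \<in> borel_measurable borel"
  shows "convolve f k \<in> borel_measurable borel"
  unfolding convolve_def by measurable

lemma lborel_distr_reflect: "distr lborel borel (\<lambda>y. x - y) = (lborel :: 'a::euclidean_space measure)"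
  using lborel_affine[of "-1" x] by (simp add: density_1)

lemma integral_lborel_reflect:
  fixes k :: "'a::euclidean_space \<Rightarrow> real"
  assumes "k \<in> borel_measurable borel"
  shows "(LINT y|lborel. k (x - y)) = (LINT y|lborel. k y)"
  using assms integral_distr[of "\<lambda>y. x - y" lborel borel k] by (simp add: lborel_distr_reflect)

text \<open>Jensen's inequality for the density \<open>k (x - y)\<close>, obtained by expanding the
  non-negative variance of f about its mean \<open>convolve f k x\<close>.\<close>

lemma convolve_sq_le:
  assumes f: "loc_integrable f" "loc_integrable (\<lambda>x. (f x)\<^sup>2)" and [measurable]: "k \<in> borel_measurable borel"
    and k: "\<And>x. \<bar>k x\<bar> \<le> C" "\<And>x. norm x > R \<Longrightarrow> k x = 0" "\<And>x. k x \<ge> 0" and k1: "(LINT x|lborel. k x) = 1"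
  shows "(convolve f k x)\<^sup>2 \<le> convolve (\<lambda>x. (f x)\<^sup>2) k x"
proof -
  let ?c = "convolve f k x"
  have one: "loc_integrable (\<lambda>x::real^'a. 1)"
    unfolding loc_integrable_def
  proof (intro conjI allI)
    show "integrable lborel (\<lambda>x::real^'a. indicator (cball 0 r) x * 1 :: real)" for r
      by (rule integrable_bounded_support[where C=1 and R=r]) (auto intro!: borel_measurable_indicator)
  qed auto
  have i1: "integrable lborel (\<lambda>y. k (x - y))"
    using convolve_integrable[of "\<lambda>_. 1" k C R x] one k by simp
  have i2: "integrable lborel (\<lambda>y. f y * k (x - y))" "integrable lborel (\<lambda>y. (f y)\<^sup>2 * k (x - y))"
    using convolve_integrable[of f k C R x] convolve_integrable[of "\<lambda>x. (f x)\<^sup>2" k C R x] f k by simp_all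
  have "0 \<le> (LINT y|lborel. (f y - ?c)\<^sup>2 * k (x - y))"
    by (rule Bochner_Integration.integral_nonneg) (simp add: k)
  also have "\<dots> = (LINT y|lborel. (f y)\<^sup>2 * k (x - y) - 2 * ?c * (f y * k (x - y)) + ?c\<^sup>2 * k (x - y))"
    by (simp add: power2_diff algebra_simps)
  also have "\<dots> = convolve (\<lambda>x. (f x)\<^sup>2) k x - 2 * ?c * ?c + ?c\<^sup>2 * (LINT y|lborel. k (x - y))"
    using i1 i2 by (simp add: convolve_def)
  also have "(LINT y|lborel. k (x - y)) = 1" using k1 by (simp add: integral_lborel_reflect)
  finally show ?thesis by (simp add: power2_eq_square)
qed

text \<open>Jensen's inequality at each point, then Tonelli's theorem. Working with the non-negative
  integral also delivers the integrability, which is not known beforehand.\<close>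

lemma convolve_L2:
  assumes [measurable]: "f \<in> borel_measurable borel" and f2: "integrable lborel (\<lambda>x. (f x)\<^sup>2)"
    and [measurable]: "k \<in> borel_measurable borel"
    and k: "\<And>x. \<bar>k x\<bar> \<le> C" "\<And>x. norm x > R \<Longrightarrow> k x = 0" "\<And>x. k x \<ge> 0" and k1: "(LINT x|lborel. k x) = 1"
  shows "integrable lborel (\<lambda>x. (convolve f k x)\<^sup>2)"
    and "(LINT x|lborel. (convolve f k x)\<^sup>2) \<le> (LINT x|lborel. (f x)\<^sup>2)"
proof -
  have loc: "loc_integrable f" by (rule loc_integrable_L2) (use f2 in auto)
  have loc2: "loc_integrable (\<lambda>x. (f x)\<^sup>2)"
    unfolding loc_integrable_def
    by (auto intro!: Bochner_Integration.integrable_bound[OF f2] simp: indicator_def)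
  have "integrable lborel k"
    by (rule integrable_bounded_support[of k C R]) (use k in auto)
  then have kk: "(\<integral>\<^sup>+x. ennreal (k x) \<partial>lborel) = 1"
    using nn_integral_eq_integral[of lborel k] k(3) k1 by simp
  have "(\<integral>\<^sup>+x. ennreal ((convolve f k x)\<^sup>2) \<partial>lborel) \<le> (\<integral>\<^sup>+x. (\<integral>\<^sup>+y. ennreal ((f y)\<^sup>2 * k (x - y)) \<partial>lborel) \<partial>lborel)"
  proof (rule nn_integral_mono)
    fix x
    have "(\<integral>\<^sup>+y. ennreal ((f y)\<^sup>2 * k (x - y)) \<partial>lborel) = ennreal (convolve (\<lambda>x. (f x)\<^sup>2) k x)"
      unfolding convolve_def
      using convolve_integrable[of "\<lambda>x. (f x)\<^sup>2" k C R x] loc2 k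
      by (intro nn_integral_eq_integral) auto
    then show "ennreal ((convolve f k x)\<^sup>2) \<le> (\<integral>\<^sup>+y. ennreal ((f y)\<^sup>2 * k (x - y)) \<partial>lborel)"
      using convolve_sq_le[of f k C R x] loc loc2 k k1 by (simp add: ennreal_leI)
  qed
  also have "\<dots> = (\<integral>\<^sup>+y. (\<integral>\<^sup>+x. ennreal ((f y)\<^sup>2 * k (x - y)) \<partial>lborel) \<partial>lborel)"
    by (rule lborel_pair.Fubini'[symmetric]) measurable
  also have "\<dots> = (\<integral>\<^sup>+y. ennreal ((f y)\<^sup>2) \<partial>lborel)"
  proof (rule nn_integral_cong)
    fix y
    have "(\<integral>\<^sup>+x. ennreal (k (x - y)) \<partial>lborel) = 1"
      using nn_integral_distr[of "(+) (- y)" lborel borel "\<lambda>x. ennreal (k x)"] kk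
      by (simp add: lborel_distr_plus)
    then show "(\<integral>\<^sup>+x. ennreal ((f y)\<^sup>2 * k (x - y)) \<partial>lborel) = ennreal ((f y)\<^sup>2)"
      by (simp add: ennreal_mult' nn_integral_cmult k)
  qed
  also have "\<dots> = ennreal (LINT x|lborel. (f x)\<^sup>2)"
    by (rule nn_integral_eq_integral[OF f2]) simp
  finally have *: "(\<integral>\<^sup>+x. ennreal ((convolve f k x)\<^sup>2) \<partial>lborel) \<le> ennreal (LINT x|lborel. (f x)\<^sup>2)" .
  show i: "integrable lborel (\<lambda>x. (convolve f k x)\<^sup>2)"
  proof (rule integrableI_bounded)
    show "(\<integral>\<^sup>+x. ennreal (norm ((convolve f k x)\<^sup>2)) \<partial>lborel) < \<infinity>"
      using * by (simp add: le_less_trans)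
  qed measurable
  show "(LINT x|lborel. (convolve f k x)\<^sup>2) \<le> (LINT x|lborel. (f x)\<^sup>2)"
    using * nn_integral_eq_integral[OF i] by (simp add: Bochner_Integration.integral_nonneg)
qed

section \<open>Mollifiers as an approximate identity\<close>

definition mollifier :: "nat \<Rightarrow> real^'n \<Rightarrow> real" where
  "mollifier m x = bump (real (Suc m) *\<^sub>R x) / (LINT x|lborel. bump (real (Suc m) *\<^sub>R (x :: real^'n)))"

lemma bump_scaled_test_function: "test_function (\<lambda>x. bump (real (Suc m) *\<^sub>R x))"
  using test_function_affine[OF bump_test_function, of "real (Suc m)" 0] by simp

lemma test_function_integrable: "test_function \<phi> \<Longrightarrow> integrable lborel \<phi>"
  by (metis integrable_bounded_support test_function_borel test_function_bounded test_function_support)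

text \<open>A non-negative function with vanishing integral is zero almost everywhere, but the
  scaled bump is positive on a ball of positive measure.\<close>

lemma integral_bump_pos: "(LINT x|lborel. bump (real (Suc m) *\<^sub>R (x :: real^'n))) > 0"
proof -
  let ?b = "\<lambda>x :: real^'n. bump (real (Suc m) *\<^sub>R x)"
  have int: "integrable lborel ?b"
    by (rule test_function_integrable[OF bump_scaled_test_function])
  have "(LINT x|lborel. ?b x) \<noteq> 0"
  proof
    assume "(LINT x|lborel. ?b x) = 0"
    then have "AE x in lborel. ?b x = 0"
      using integral_nonneg_eq_0_iff_AE[OF int] bump_nonneg by auto
    then have "AE x in lborel. x \<notin> ball (0::real^'n) (1 / real (Suc m))"
    proof eventually_elim
      case (elim x)
      show ?case
      proof
        assume "x \<in> ball 0 (1 / real (Suc m))"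
        then have "norm (real (Suc m) *\<^sub>R x) < 1"
          by (simp add: field_simps del: of_nat_Suc)
        then have "(real (Suc m) *\<^sub>R x) \<bullet> (real (Suc m) *\<^sub>R x) < 1"
          unfolding dot_square_norm by (metis abs_norm_cancel abs_square_less_1)
        then have "?b x > 0" by (simp add: bump_def flat_exp_def)
        then show False using elim by simp
      qed
    qed
    then have "ball (0::real^'n) (1 / real (Suc m)) \<in> null_sets lborel"
      by (subst (asm) AE_iff_null_sets[symmetric]) auto
    then have "measure lborel (ball (0::real^'n) (1 / real (Suc m))) = 0"
      by (simp add: measure_def null_setsD1)
    then show False using content_ball_pos[of "1 / real (Suc m)" "0::real^'n"] by simp
  qed
  moreover have "(LINT x|lborel. ?b x) \<ge> 0"
    by (rule Bochner_Integration.integral_nonneg) (rule bump_nonneg)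
  ultimately show ?thesis by simp
qed

lemma mollifier_test_function: "test_function (mollifier m)"
  using test_function_cmult[OF bump_scaled_test_function, of "inverse (LINT x|lborel. bump (real (Suc m) *\<^sub>R (x :: real^'a)))" m]
  by (simp add: mollifier_def[abs_def] divide_inverse mult.commute)

lemma mollifier_nonneg: "mollifier m x \<ge> 0"
  unfolding mollifier_def using integral_bump_pos[of m, where 'n='a] bump_nonneg
  by (intro divide_nonneg_pos) auto

lemma integral_mollifier: "(LINT x|lborel. mollifier m (x::real^'n)) = 1"
  using integral_bump_pos[of m, where 'n='n] by (simp add: mollifier_def)

lemma mollifier_support: "norm x \<ge> 1 / real (Suc m) \<Longrightarrow> mollifier m x = 0"
  by (simp add: mollifier_def bump_support field_simps del: of_nat_Suc)

lemma convolve_mollifier_continuous: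
  fixes g :: "real^'n \<Rightarrow> real"
  assumes cont: "continuous_on UNIV g" and bdd: "\<And>x. \<bar>g x\<bar> \<le> C" and supp: "\<And>x. norm x > R \<Longrightarrow> g x = 0"
  shows "(\<lambda>m. LINT x|lborel. (convolve g (mollifier m) x - g x)\<^sup>2) \<longlonglongrightarrow> 0"
proof -
  have [measurable]: "g \<in> borel_measurable borel" using cont by (rule borel_measurable_continuous_onI)
  have mm [measurable]: "(mollifier m :: real^'n \<Rightarrow> real) \<in> borel_measurable borel" for m
    by (rule test_function_borel[OF mollifier_test_function])
  have mi: "integrable lborel (\<lambda>y. mollifier m (x - y))" for m and x :: "real^'n"
    using test_function_integrable[OF test_function_affine[OF mollifier_test_function[of m], of "-1" x]] by simp
  have m1: "(LINT y|lborel. mollifier m (x - y)) = 1" for m and x :: "real^'n"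
    by (simp add: integral_lborel_reflect integral_mollifier)
  have gi: "integrable lborel (\<lambda>y. g y * mollifier m (x - y))" for m x
    by (rule Bochner_Integration.integrable_bound[OF integrable_mult_right[OF mi, of C m x]])
      (use bdd order_trans[OF abs_ge_zero bdd] in \<open>auto simp: abs_mult mollifier_nonneg intro!: mult_right_mono\<close>)
  have diff: "convolve g (mollifier m) x - g x = (LINT y|lborel. (g y - g x) * mollifier m (x - y))" for m x
  proof -
    have "(LINT y|lborel. (g y - g x) * mollifier m (x - y)) =
        (LINT y|lborel. g y * mollifier m (x - y) - g x * mollifier m (x - y))"
      by (simp add: algebra_simps)
    also have "\<dots> = convolve g (mollifier m) x - g x"
      using gi mi by (simp add: convolve_def m1)
    finally show ?thesis by simp
  qed
  \<comment> \<open>Used three times: with the global oscillation 2C for the dominating function,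
    with e = 0 away from the support of g, and with the modulus of continuity for the pointwise
    limit.\<close>
  have close: "\<bar>convolve g (mollifier m) x - g x\<bar> \<le> e"
    if e: "\<And>y. norm (y - x) < 1 / real (Suc m) \<Longrightarrow> \<bar>g y - g x\<bar> \<le> e" for m x e
  proof -
    have "\<bar>convolve g (mollifier m) x - g x\<bar> \<le> (LINT y|lborel. e * mollifier m (x - y))"
      unfolding diff real_norm_def[symmetric]
    proof (rule Bochner_Integration.integral_norm_bound_integral)
      show "integrable lborel (\<lambda>y. (g y - g x) * mollifier m (x - y))"
        using Bochner_Integration.integrable_diff[OF gi[of m x] integrable_mult_right[OF mi, of "g x" m x]]
        by (simp add: algebra_simps)
      show "norm ((g y - g x) * mollifier m (x - y)) \<le> e * mollifier m (x - y)" for y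
      proof (cases "norm (y - x) < 1 / real (Suc m)")
        case True
        then show ?thesis using e[of y] by (simp add: abs_mult mollifier_nonneg mult_right_mono)
      next
        case False
        then have "mollifier m (x - y) = 0"
          by (intro mollifier_support) (simp add: norm_minus_commute)
        then show ?thesis by simp
      qed
    qed (use mi in auto)
    then show ?thesis by (simp add: m1)
  qed
  show ?thesis
  proof (rule L2_dominated_convergence)
    show "integrable lborel (\<lambda>x::real^'n. (2 * C)\<^sup>2 * indicator (cball 0 (R + 1)) x)"
      by (rule integrable_bounded_support[where C="(2 * C)\<^sup>2" and R="R + 1"])
         (auto simp: indicator_def intro!: borel_measurable_indicator)
    show "(convolve g (mollifier m) x - g x)\<^sup>2 \<le> (2 * C)\<^sup>2 * indicator (cball 0 (R + 1)) x" for m x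
    proof (cases "norm x \<le> R + 1")
      case True
      have "\<bar>g y - g x\<bar> \<le> 2 * C" for y using bdd[of y] bdd[of x] by linarith
      then have "\<bar>convolve g (mollifier m) x - g x\<bar> \<le> 2 * C" by (intro close)
      then have "(convolve g (mollifier m) x - g x)\<^sup>2 \<le> (2 * C)\<^sup>2"
        by (metis abs_ge_zero abs_le_square_iff abs_of_nonneg order_trans)
      then show ?thesis using True by simp
    next
      case False
      have "\<bar>convolve g (mollifier m) x - g x\<bar> \<le> 0"
      proof (rule close)
        fix y assume y: "norm (y - x) < 1 / real (Suc m)"
        have "1 / real (Suc m) \<le> 1" by simp
        then have "norm (y - x) < 1" using y by linarith
        then have "norm y > R" using False norm_triangle_ineq2[of x y] by (simp add: norm_minus_commute)
        then show "\<bar>g y - g x\<bar> \<le> 0" using False supp[of x] supp[of y] by simp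
      qed
      then show ?thesis by simp
    qed
    show "AE x in lborel. (\<lambda>m. convolve g (mollifier m) x) \<longlonglongrightarrow> g x"
    proof (intro AE_I2 LIMSEQ_I)
      fix x :: "real^'n" and e :: real assume e: "e > 0"
      have "isCont g x" using cont by (simp add: continuous_on_eq_continuous_at)
      then obtain d where d: "d > 0" "\<And>y. dist y x < d \<Longrightarrow> dist (g y) (g x) < e / 2"
        using e unfolding continuous_at_eps_delta by (meson half_gt_zero)
      obtain n where n: "inverse (real (Suc n)) < d" using reals_Archimedean[OF d(1)] by blast
      have "norm (convolve g (mollifier m) x - g x) < e" if "m \<ge> n" for m
      proof -
        have "1 / real (Suc m) \<le> inverse (real (Suc n))" using that by (simp add: field_simps)
        then have "\<bar>convolve g (mollifier m) x - g x\<bar> \<le> e / 2"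
          using d(2) n by (intro close) (force simp: dist_norm intro: less_imp_le)
        then show ?thesis using e by simp
      qed
      then show "\<exists>n. \<forall>m\<ge>n. norm (convolve g (mollifier m) x - g x) < e" by blast
    qed
  qed measurable
qed

text \<open>Convolution with a mollifier does not increase the norm, whatever m is, so convergence
  on the dense class of continuous functions with bounded support carries over to all of L2.\<close>

proposition convolve_mollifier_L2:
  fixes f :: "real^'n \<Rightarrow> real"
  assumes f [measurable]: "f \<in> borel_measurable borel" and f2: "integrable lborel (\<lambda>x. (f x)\<^sup>2)"
  shows "(\<lambda>m. LINT x|lborel. (convolve f (mollifier m) x - f x)\<^sup>2) \<longlonglongrightarrow> 0"
proof (rule LIMSEQ_I)
  fix e :: real assume e: "e > 0"
  \<comment> \<open>The three-term splitting below has weights 2, 4 and 4, each multiplying a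
    quantity below e / 12; the total 10 e / 12 stays below e.\<close>
  obtain g C R where g: "continuous_on UNIV g" "\<And>x. \<bar>g x\<bar> \<le> C" "\<And>x. norm x > R \<Longrightarrow> g x = 0"
    "(LINT x|lborel. (f x - g x)\<^sup>2) < e / 12"
    using L2_dense_continuous[OF f f2, of "e / 12"] e by auto
  have [measurable]: "g \<in> borel_measurable borel" using g(1) by (rule borel_measurable_continuous_onI)
  have mm [measurable]: "(mollifier m :: real^'n \<Rightarrow> real) \<in> borel_measurable borel" for m
    by (rule test_function_borel[OF mollifier_test_function])
  have g2: "integrable lborel (\<lambda>x. (g x)\<^sup>2)"
    by (rule integrable_bounded_support[where C="C\<^sup>2" and R=R])
       (use g(2,3) order_trans[OF abs_ge_zero g(2)] in \<open>auto simp: abs_le_square_iff[symmetric]\<close>)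
  have fg2: "integrable lborel (\<lambda>x. (f x - g x)\<^sup>2)" by (rule integrable_sq_diff) (use f2 g2 in auto)
  have conv: "integrable lborel (\<lambda>x. (convolve h (mollifier m) x)\<^sup>2)"
      "(LINT x|lborel. (convolve h (mollifier m) x)\<^sup>2) \<le> (LINT x|lborel. (h x)\<^sup>2)"
      "integrable lborel (\<lambda>y. h y * mollifier m (x - y))"
    if [measurable]: "h \<in> borel_measurable borel" and h: "integrable lborel (\<lambda>x. (h x)\<^sup>2)"
    for h :: "real^'n \<Rightarrow> real" and m x
  proof -
    obtain B where B: "\<And>x::real^'n. \<bar>mollifier m x\<bar> \<le> B"
      using test_function_bounded[OF mollifier_test_function] by blast
    have s: "mollifier m x = 0" if "norm x > 1 / real (Suc m)" for x :: "real^'n"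
      using that by (intro mollifier_support) simp
    show "integrable lborel (\<lambda>x. (convolve h (mollifier m) x)\<^sup>2)"
      "(LINT x|lborel. (convolve h (mollifier m) x)\<^sup>2) \<le> (LINT x|lborel. (h x)\<^sup>2)"
      by (rule convolve_L2[of h "mollifier m" B "1 / real (Suc m)",
            OF that(1) h mm B s mollifier_nonneg integral_mollifier], assumption)+
    show "integrable lborel (\<lambda>y. h y * mollifier m (x - y))"
      using convolve_integrable[of h "mollifier m" B "1 / real (Suc m)" x] B s loc_integrable_L2[of h] h by auto
  qed
  have "\<forall>\<^sub>F m in sequentially. (LINT x|lborel. (convolve g (mollifier m) x - g x)\<^sup>2) < e / 12"
    using convolve_mollifier_continuous[OF g(1-3)] e by (intro order_tendstoD(2)) auto
  then obtain n where n: "\<And>m. m \<ge> n \<Longrightarrow> (LINT x|lborel. (convolve g (mollifier m) x - g x)\<^sup>2) < e / 12"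
    by (auto simp: eventually_sequentially)
  have "norm ((LINT x|lborel. (convolve f (mollifier m) x - f x)\<^sup>2) - 0) < e" if m: "m \<ge> n" for m
  proof -
    let ?F = "convolve f (mollifier m)" and ?G = "convolve g (mollifier m)"
    have FG: "?F x - ?G x = convolve (\<lambda>x. f x - g x) (mollifier m) x" for x
      using conv(3)[OF _ f2, of m x] conv(3)[OF _ g2, of m x]
      by (simp add: convolve_def left_diff_distrib)
    have iF: "integrable lborel (\<lambda>x. (?F x)\<^sup>2)" and iG: "integrable lborel (\<lambda>x. (?G x)\<^sup>2)"
      using conv(1)[OF _ f2] conv(1)[OF _ g2] by auto
    have i: "integrable lborel (\<lambda>x. (?F x - ?G x)\<^sup>2)" "integrable lborel (\<lambda>x. (?G x - g x)\<^sup>2)"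
      "integrable lborel (\<lambda>x. (?F x - f x)\<^sup>2)"
      by (rule integrable_sq_diff; use iF iG g2 f2 in measurable)+
    have "(LINT x|lborel. (?F x - f x)\<^sup>2) \<le>
      (LINT x|lborel. 2 * (?F x - ?G x)\<^sup>2 + (4 * (?G x - g x)\<^sup>2 + 4 * (f x - g x)\<^sup>2))"
    proof (rule integral_mono)
      fix x
      show "(?F x - f x)\<^sup>2 \<le> 2 * (?F x - ?G x)\<^sup>2 + (4 * (?G x - g x)\<^sup>2 + 4 * (f x - g x)\<^sup>2)"
        using sq_diff_le[of "?F x" "f x" "?G x"] sq_diff_le[of "?G x" "f x" "g x"] by (simp add: power2_commute)
    qed (use i fg2 in auto)
    also have "\<dots> = 2 * (LINT x|lborel. (?F x - ?G x)\<^sup>2) + (4 * (LINT x|lborel. (?G x - g x)\<^sup>2) + 4 * (LINT x|lborel. (f x - g x)\<^sup>2))"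
      using i fg2 by simp
    finally have Ff: "(LINT x|lborel. (?F x - f x)\<^sup>2) \<le> \<dots>" .
    have "(LINT x|lborel. (?F x - ?G x)\<^sup>2) \<le> (LINT x|lborel. (f x - g x)\<^sup>2)"
      unfolding FG by (rule conv(2)) (use fg2 in auto)
    then have "(LINT x|lborel. (?F x - f x)\<^sup>2) < e"
      using Ff g(4) n[OF m] e by linarith
    moreover have "(LINT x|lborel. (?F x - f x)\<^sup>2) \<ge> 0" by (rule Bochner_Integration.integral_nonneg) simp
    ultimately show ?thesis by simp
  qed
  then show "\<exists>n. \<forall>m\<ge>n. norm ((LINT x|lborel. (convolve f (mollifier m) x - f x)\<^sup>2) - 0) < e" by blast
qed

section \<open>Compactly supported weakly differentiable functions\<close>

lemma integrable_tensor_sq: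
  fixes G :: "real^'n \<Rightarrow> real^'n^'n^'N"
  assumes "\<And>\<alpha> i j. integrable lborel (\<lambda>x. (G x $ \<alpha> $ i $ j)\<^sup>2)"
  shows "integrable lborel (\<lambda>x. (norm (G x))\<^sup>2)"
  unfolding norm_tensor_sq using assms by (intro Bochner_Integration.integrable_sum)

lemma integrable_tensor_component_sq:
  fixes G :: "real^'n \<Rightarrow> real^'n^'n^'N"
  assumes [measurable]: "G \<in> borel_measurable borel" and "integrable lborel (\<lambda>x. (norm (G x))\<^sup>2)"
  shows "integrable lborel (\<lambda>x. (G x $ \<alpha> $ i $ j)\<^sup>2)"
proof (rule Bochner_Integration.integrable_bound[OF assms(2)])
  have "\<bar>G x $ \<alpha> $ i $ j\<bar> \<le> norm (G x)" for x
    by (rule order_trans[OF component_le_norm_cart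
          order_trans[OF Finite_Cartesian_Product.norm_nth_le Finite_Cartesian_Product.norm_nth_le]])
  then show "AE x in lborel. norm ((G x $ \<alpha> $ i $ j)\<^sup>2) \<le> norm ((norm (G x))\<^sup>2)"
    by (intro AE_I2) (simp add: abs_le_square_iff[symmetric])
qed measurable

lemma hessian_inequality_limit_components:
  assumes F: "\<And>m. hessian_inequality A (F m)"
    and G [measurable]: "G \<in> borel_measurable borel"
    and G2: "\<And>\<alpha> i j. integrable lborel (\<lambda>x. (G x $ \<alpha> $ i $ j)\<^sup>2)"
    and lim: "\<And>\<alpha> i j. (\<lambda>m. LINT x|lborel. (F m x $ \<alpha> $ i $ j - G x $ \<alpha> $ i $ j)\<^sup>2) \<longlonglongrightarrow> 0"
  shows "hessian_inequality A G"
proof (rule hessian_inequality_limit[OF F G integrable_tensor_sq[OF G2]])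
  have [measurable]: "F m \<in> borel_measurable borel" and F2: "integrable lborel (\<lambda>x. (norm (F m x))\<^sup>2)" for m
    using F by (auto simp: hessian_inequality_def)
  have i: "integrable lborel (\<lambda>x. (F m x $ \<alpha> $ i $ j - G x $ \<alpha> $ i $ j)\<^sup>2)" for m \<alpha> i j
    by (intro integrable_sq_diff integrable_tensor_component_sq F2 G2) measurable
  have "(LINT x|lborel. (norm (F m x - G x))\<^sup>2) =
      (\<Sum>\<alpha>\<in>UNIV. \<Sum>i\<in>UNIV. \<Sum>j\<in>UNIV. (LINT x|lborel. (F m x $ \<alpha> $ i $ j - G x $ \<alpha> $ i $ j)\<^sup>2))" for m
    unfolding norm_tensor_sq by (simp add: i Bochner_Integration.integral_sum)
  then show "(\<lambda>m. LINT x|lborel. (norm (F m x - G x))\<^sup>2) \<longlonglongrightarrow> 0"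
    using lim by (auto intro!: tendsto_null_sum)
qed

section \<open>Second difference quotients of smooth kernels\<close>

lemma has_real_derivative_line:
  fixes f :: "real^'n \<Rightarrow> real"
  assumes "f differentiable_on UNIV"
  shows "((\<lambda>t. f (y + t *\<^sub>R axis i 1)) has_real_derivative partial_derivative i f (y + t *\<^sub>R axis i 1)) (at t)"
proof -
  have "((\<lambda>t. f (y + t *\<^sub>R axis i 1)) has_derivative
      (\<lambda>s. frechet_derivative f (at (y + t *\<^sub>R axis i 1)) (s *\<^sub>R axis i 1))) (at t)"
    by (rule has_derivative_compose[OF _ differentiable_on_UNIV_has_derivative[OF assms]])
       (auto intro!: derivative_eq_intros)
  moreover have "linear (frechet_derivative f (at (y + t *\<^sub>R axis i 1)))"
    using assms by (auto simp: differentiable_on_def intro: linear_frechet_derivative)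
  ultimately show ?thesis
    unfolding has_field_derivative_def
    by (elim has_derivative_eq_rhs) (auto simp: partial_derivative_def linear_scale)
qed

definition kernel_difference :: "real \<Rightarrow> 'n \<Rightarrow> 'n \<Rightarrow> (real^'n \<Rightarrow> real) \<Rightarrow> real^'n \<Rightarrow> real" where
  "kernel_difference h i j k x =
     k (x + h *\<^sub>R (axis i 1 + axis j 1)) - k (x + h *\<^sub>R (axis i 1 - axis j 1))
     - k (x + h *\<^sub>R (- axis i 1 + axis j 1)) + k (x + h *\<^sub>R (- axis i 1 - axis j 1))"

text \<open>The mean value theorem twice: along direction i for the difference of two translates in
  direction j, then along j for the partial derivative in i. Each application contributes a factor
  2h and a displacement of size at most h.\<close>

lemma kernel_difference_mvt:
  fixes k :: "real^'n \<Rightarrow> real"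
  assumes k: "test_function k" and h: "h > 0"
  obtains \<xi> where "norm \<xi> \<le> 2 * h"
    "kernel_difference h i j k x = 4 * h\<^sup>2 * partial_derivative j (partial_derivative i k) (x + \<xi>)"
proof -
  have d: "k differentiable_on UNIV" "partial_derivative i k differentiable_on UNIV"
    using k by (auto intro: test_function_differentiable test_function_partial)
  define \<psi> where "\<psi> t = k ((x + h *\<^sub>R axis j 1) + t *\<^sub>R axis i 1) - k ((x - h *\<^sub>R axis j 1) + t *\<^sub>R axis i 1)" for t
  have "\<exists>\<tau>. - h < \<tau> \<and> \<tau> < h \<and> \<psi> h - \<psi> (- h) = (h - (- h)) *
     (partial_derivative i k ((x + h *\<^sub>R axis j 1) + \<tau> *\<^sub>R axis i 1) - partial_derivative i k ((x - h *\<^sub>R axis j 1) + \<tau> *\<^sub>R axis i 1))"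
    unfolding \<psi>_def using h by (intro MVT2 DERIV_diff has_real_derivative_line d) auto
  then obtain \<tau> where \<tau>: "\<bar>\<tau>\<bar> \<le> h" and 1: "\<psi> h - \<psi> (- h) = (h - (- h)) *
     (partial_derivative i k ((x + h *\<^sub>R axis j 1) + \<tau> *\<^sub>R axis i 1) - partial_derivative i k ((x - h *\<^sub>R axis j 1) + \<tau> *\<^sub>R axis i 1))"
    using abs_le_iff less_imp_le by (metis minus_le_iff)
  define \<omega> where "\<omega> t = partial_derivative i k ((x + \<tau> *\<^sub>R axis i 1) + t *\<^sub>R axis j 1)" for t
  have "\<exists>\<sigma>. - h < \<sigma> \<and> \<sigma> < h \<and> \<omega> h - \<omega> (- h) = (h - (- h)) *
     partial_derivative j (partial_derivative i k) ((x + \<tau> *\<^sub>R axis i 1) + \<sigma> *\<^sub>R axis j 1)"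
    unfolding \<omega>_def using h by (intro MVT2 has_real_derivative_line d) auto
  then obtain \<sigma> where \<sigma>: "\<bar>\<sigma>\<bar> \<le> h" and 2: "\<omega> h - \<omega> (- h) = (h - (- h)) *
     partial_derivative j (partial_derivative i k) ((x + \<tau> *\<^sub>R axis i 1) + \<sigma> *\<^sub>R axis j 1)"
    using abs_le_iff less_imp_le by (metis minus_le_iff)
  show thesis
  proof
    show "norm (\<tau> *\<^sub>R (axis i 1 :: real^'n) + \<sigma> *\<^sub>R axis j 1) \<le> 2 * h"
      using norm_triangle_ineq[of "\<tau> *\<^sub>R (axis i 1 :: real^'n)" "\<sigma> *\<^sub>R axis j 1"] \<tau> \<sigma> by simp
    have "kernel_difference h i j k x = \<psi> h - \<psi> (- h)"
      by (simp add: kernel_difference_def \<psi>_def scaleR_add_right scaleR_diff_right algebra_simps)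
    also have "\<dots> = 2 * h * (\<omega> h - \<omega> (- h))"
      unfolding 1 by (simp add: \<omega>_def algebra_simps)
    finally show "kernel_difference h i j k x =
        4 * h\<^sup>2 * partial_derivative j (partial_derivative i k) (x + (\<tau> *\<^sub>R axis i 1 + \<sigma> *\<^sub>R axis j 1))"
      unfolding 2 by (simp add: power2_eq_square add.assoc)
  qed
qed

lemma kernel_difference_eq_0:
  fixes k :: "real^'n \<Rightarrow> real"
  assumes k: "\<And>x. norm x > r \<Longrightarrow> k x = 0" and x: "norm x > r + 2 * h" and h: "h > 0"
  shows "kernel_difference h i j k x = 0"
proof -
  \<comment> \<open>The scalar kernel is viewed as a map with one component, indexed by
    \<open>unit\<close>, in order to reuse the vector-valued statement.\<close>
  have "hessian_difference h (\<lambda>x. \<chi> \<alpha>::unit. k x) x = 0"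
    by (rule hessian_difference_eq_0[of r]) (use assms in \<open>auto simp: vec_eq_iff\<close>)
  then show ?thesis by (simp add: hessian_difference_def kernel_difference_def vec_eq_iff)
qed

text \<open>By linearity a second difference of v convolved with k is v convolved with that second
  difference of k, so only the smooth kernel is differentiated. Its quotients converge pointwise to
  the second partials, uniformly bounded and with supports in a fixed ball, and dominated
  convergence gives the Hessian in L2.\<close>

proposition hessian_inequality_kernel:
  fixes A :: "real^'n^'n^'N^'N" and v :: "real^'n \<Rightarrow> real^'N"
  assumes v [measurable]: "v \<in> borel_measurable borel" and vi: "\<And>\<alpha>. integrable lborel (\<lambda>x. v x $ \<alpha>)"
    and v0: "\<And>x. norm x > R \<Longrightarrow> v x = 0"
    and k: "test_function k" and nonneg: "ellipticity_constant A \<ge> 0"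
  shows "hessian_inequality A
    (\<lambda>x. \<chi> \<alpha> i j. convolve (\<lambda>y. v y $ \<alpha>) (partial_derivative j (partial_derivative i k)) x)"
proof -
  let ?h = "\<lambda>m. 1 / real (Suc m)"
  let ?dk = "\<lambda>i j. partial_derivative j (partial_derivative i k)"
  define w where "w x = (\<chi> \<alpha>. convolve (\<lambda>y. v y $ \<alpha>) k x)" for x
  \<comment> \<open>Normalised by the factor 4 h^2 found in \<open>kernel_difference_mvt\<close>, so
    that \<open>q m i j\<close> tends to a second partial derivative of k.\<close>
  define q where "q m i j x = kernel_difference (?h m) i j k x / (4 * (?h m)\<^sup>2)" for m i j x
  define F where "F m x = (1 / (4 * (?h m)\<^sup>2)) *\<^sub>R hessian_difference (?h m) w x" for m x
  have [measurable]: "k \<in> borel_measurable borel" using k by (rule test_function_borel)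
  have tdk: "test_function (?dk i j)" for i j using k by (intro test_function_partial)
  have [measurable]: "?dk i j \<in> borel_measurable borel" for i j by (rule test_function_borel[OF tdk])
  have [measurable]: "q m i j \<in> borel_measurable borel" for m i j
    unfolding q_def kernel_difference_def by measurable
  have vint: "integrable lborel (\<lambda>y. v y $ \<alpha> * g (x - y))"
    if [measurable]: "g \<in> borel_measurable borel" and g: "\<And>x. \<bar>g x\<bar> \<le> C" for g C x \<alpha>
  proof (rule Bochner_Integration.integrable_bound[OF integrable_mult_right[OF vi, of C \<alpha>]])
    show "AE y in lborel. norm (v y $ \<alpha> * g (x - y)) \<le> norm (C * v y $ \<alpha>)"
    proof (rule AE_I2)
      fix y show "norm (v y $ \<alpha> * g (x - y)) \<le> norm (C * v y $ \<alpha>)"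
        using mult_right_mono[OF g[of "x - y"], of "\<bar>v y $ \<alpha>\<bar>"] order_trans[OF abs_ge_zero g[of 0]]
        by (simp add: abs_mult mult.commute)
    qed
  qed measurable
  have vbd: "\<bar>convolve (\<lambda>y. v y $ \<alpha>) g x\<bar> \<le> C * (LINT y|lborel. \<bar>v y $ \<alpha>\<bar>)"
    if [measurable]: "g \<in> borel_measurable borel" and g: "\<And>x. \<bar>g x\<bar> \<le> C" for g C x \<alpha>
  proof -
    have "norm (convolve (\<lambda>y. v y $ \<alpha>) g x) \<le> (LINT y|lborel. C * \<bar>v y $ \<alpha>\<bar>)"
      unfolding convolve_def
    proof (rule Bochner_Integration.integral_norm_bound_integral)
      show "norm (v y $ \<alpha> * g (x - y)) \<le> C * \<bar>v y $ \<alpha>\<bar>" for y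
        using mult_right_mono[OF g[of "x - y"], of "\<bar>v y $ \<alpha>\<bar>"] by (simp add: abs_mult mult.commute)
    qed (use vint[of g C] that vi in auto)
    then show ?thesis by simp
  qed
  obtain Ck where Ck: "Ck > 0" "\<And>x. \<bar>k x\<bar> \<le> Ck" using test_function_bounded[OF k] by blast
  obtain rk where rk: "rk > 0" "\<And>x. norm x > rk \<Longrightarrow> k x = 0" using test_function_support[OF k] by blast
  have w_meas [measurable]: "w \<in> borel_measurable borel"
    by (rule borel_measurable_vecI) (simp add: w_def)
  have w_bdd: "norm (w x) \<le> (\<Sum>\<alpha>\<in>UNIV. Ck * (LINT y|lborel. \<bar>v y $ \<alpha>\<bar>))" for x
    using sum_mono[of UNIV "\<lambda>\<alpha>. \<bar>w x $ \<alpha>\<bar>" "\<lambda>\<alpha>. Ck * (LINT y|lborel. \<bar>v y $ \<alpha>\<bar>)"] vbd[of k Ck] Ck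
      norm_le_l1_cart[of "w x"] by (fastforce simp: w_def)
  have conv0: "convolve (\<lambda>y. v y $ \<alpha>) g x = 0" if "\<And>x. norm x > r \<Longrightarrow> g x = 0" "norm x > R + r" for g r x \<alpha>
  proof -
    have "v y $ \<alpha> * g (x - y) = 0" for y
    proof (cases "norm y > R")
      case False
      then have "norm (x - y) > r" using that(2) norm_triangle_ineq2[of x y] by linarith
      then show ?thesis using that(1) by simp
    qed (simp add: v0)
    then have "(\<lambda>y. v y $ \<alpha> * g (x - y)) = (\<lambda>_. 0)" by (rule ext)
    then show ?thesis unfolding convolve_def by simp
  qed
  have w_supp: "w x = 0" if "norm x > R + rk" for x
    using conv0[OF rk(2) that] by (simp add: w_def vec_eq_iff)
  have F_ineq: "hessian_inequality A (F m)" for m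
    unfolding F_def by (intro hessian_inequality_scale hessian_inequality_difference[OF w_meas w_bdd w_supp _ nonneg]) simp_all
  have F_comp: "F m x $ \<alpha> $ i $ j = convolve (\<lambda>y. v y $ \<alpha>) (q m i j) x" for m x \<alpha> i j
  proof -
    have i: "integrable lborel (\<lambda>y. v y $ \<alpha> * k ((x + a) - y))" for a
      using vint[of k Ck] Ck by simp
    have "hessian_difference (?h m) w x $ \<alpha> $ i $ j =
      (LINT y|lborel. v y $ \<alpha> * kernel_difference (?h m) i j k (x - y))"
      unfolding kernel_difference_def hessian_difference_def w_def convolve_def
      using i[of "?h m *\<^sub>R (axis i 1 + axis j 1)"] i[of "?h m *\<^sub>R (axis i 1 - axis j 1)"]
        i[of "?h m *\<^sub>R (- axis i 1 + axis j 1)"] i[of "?h m *\<^sub>R (- axis i 1 - axis j 1)"]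
      by (simp add: algebra_simps del: of_nat_Suc)
    then show ?thesis
      by (simp add: F_def q_def convolve_def)
  qed
  show ?thesis
  proof (rule hessian_inequality_limit_components[OF F_ineq])
    let ?W = "\<lambda>x. \<chi> \<alpha> i j. convolve (\<lambda>y. v y $ \<alpha>) (?dk i j) x"
    show "?W \<in> borel_measurable borel"
      by (intro borel_measurable_vecI) simp
    fix \<alpha> i j
    obtain C where C: "C > 0" "\<And>x. \<bar>?dk i j x\<bar> \<le> C" using test_function_bounded[OF tdk] by blast
    obtain r where r: "r > 0" "\<And>x. norm x > r \<Longrightarrow> ?dk i j x = 0" using test_function_support[OF tdk] by blast
    let ?V = "C * (LINT y|lborel. \<bar>v y $ \<alpha>\<bar>)"
    have V0: "?V \<ge> 0" using C(1) by (simp add: Bochner_Integration.integral_nonneg)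
    have q_mvt: "\<exists>\<xi>. norm \<xi> \<le> 2 * ?h m \<and> q m i j x = ?dk i j (x + \<xi>)" for m x
    proof -
      have "?h m > 0" by simp
      from kernel_difference_mvt[OF k this, of i j x] obtain \<xi> where "norm \<xi> \<le> 2 * ?h m"
        "kernel_difference (?h m) i j k x = 4 * (?h m)\<^sup>2 * ?dk i j (x + \<xi>)" by blast
      then show ?thesis by (intro exI[of _ \<xi>]) (simp add: q_def)
    qed
    have q_bdd: "\<bar>q m i j x\<bar> \<le> C" for m x using q_mvt[of m x] C(2) by metis
    have q_lim: "(\<lambda>m. q m i j x) \<longlonglongrightarrow> ?dk i j x" for x
    proof -
      obtain \<xi> where \<xi>: "\<And>m. norm (\<xi> m) \<le> 2 * ?h m" "\<And>m. q m i j x = ?dk i j (x + \<xi> m)"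
        using q_mvt[of _ x] by metis
      have "\<xi> \<longlonglongrightarrow> 0"
      proof (rule Lim_null_comparison)
        show "\<forall>\<^sub>F m in sequentially. norm (\<xi> m) \<le> 2 * ?h m" using \<xi>(1) by simp
        show "(\<lambda>m. 2 * ?h m) \<longlonglongrightarrow> 0"
          using tendsto_mult_right_zero[OF LIMSEQ_inverse_real_of_nat, of 2] by (simp add: inverse_eq_divide)
      qed
      then have "(\<lambda>m. x + \<xi> m) \<longlonglongrightarrow> x + 0" by (intro tendsto_intros)
      moreover have "isCont (?dk i j) (x + 0)"
        using test_function_continuous[OF tdk] by (simp add: continuous_on_eq_continuous_at)
      ultimately have "(\<lambda>m. ?dk i j (x + \<xi> m)) \<longlonglongrightarrow> ?dk i j (x + 0)"
        by (metis isCont_tendsto_compose)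
      then show ?thesis unfolding \<xi>(2) by simp
    qed
    have W_bdd: "\<bar>convolve (\<lambda>y. v y $ \<alpha>) (?dk i j) x\<bar> \<le> ?V" for x by (rule vbd) (use C in auto)
    have W_supp: "convolve (\<lambda>y. v y $ \<alpha>) (?dk i j) x = 0" if "norm x > R + r" for x
      by (rule conv0[of r]) (use r that in auto)
    show "integrable lborel (\<lambda>x. (?W x $ \<alpha> $ i $ j)\<^sup>2)"
      by (rule integrable_bounded_support[where C="?V\<^sup>2" and R="R + r"])
         (use W_bdd W_supp V0 in \<open>auto simp: abs_le_square_iff[symmetric]\<close>)
    have "(\<lambda>m. LINT x|lborel. (convolve (\<lambda>y. v y $ \<alpha>) (q m i j) x - convolve (\<lambda>y. v y $ \<alpha>) (?dk i j) x)\<^sup>2) \<longlonglongrightarrow> 0"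
    proof (rule L2_dominated_convergence)
      \<comment> \<open>One ball for all m: the quotients enlarge the support radius
        \<open>rk\<close> of k by 2h, which is at most 2, the limit kernel lives within radius r,
        and v adds R.\<close>
      define Q where "Q = R + max r (rk + 2)"
      show "integrable lborel (\<lambda>x::real^'n. (2 * ?V)\<^sup>2 * indicator (cball 0 Q) x)"
        by (rule integrable_bounded_support[where C="(2 * ?V)\<^sup>2" and R=Q])
           (auto simp: indicator_def intro!: borel_measurable_indicator)
      show "(convolve (\<lambda>y. v y $ \<alpha>) (q m i j) x - convolve (\<lambda>y. v y $ \<alpha>) (?dk i j) x)\<^sup>2
          \<le> (2 * ?V)\<^sup>2 * indicator (cball 0 Q) x" for m x
      proof (cases "norm x \<le> Q")
        case True
        have "\<bar>convolve (\<lambda>y. v y $ \<alpha>) (q m i j) x\<bar> \<le> ?V" by (rule vbd) (use q_bdd in auto)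
        then have "\<bar>convolve (\<lambda>y. v y $ \<alpha>) (q m i j) x - convolve (\<lambda>y. v y $ \<alpha>) (?dk i j) x\<bar> \<le> \<bar>2 * ?V\<bar>"
          using W_bdd[of x] by linarith
        then show ?thesis using True by (simp add: abs_le_square_iff)
      next
        case False
        have "q m i j z = 0" if "norm z > rk + 2" for z
        proof -
          have "?h m \<le> 1" by simp
          then have "norm z > rk + 2 * ?h m" using that by linarith
          then show ?thesis unfolding q_def using kernel_difference_eq_0[of rk k "?h m" z] rk(2) by simp
        qed
        then have "convolve (\<lambda>y. v y $ \<alpha>) (q m i j) x = 0"
          by (rule conv0) (use False in \<open>auto simp: Q_def\<close>)
        moreover have "convolve (\<lambda>y. v y $ \<alpha>) (?dk i j) x = 0"
          by (rule W_supp) (use False in \<open>auto simp: Q_def\<close>)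
        ultimately show ?thesis by simp
      qed
      show "AE x in lborel. (\<lambda>m. convolve (\<lambda>y. v y $ \<alpha>) (q m i j) x) \<longlonglongrightarrow> convolve (\<lambda>y. v y $ \<alpha>) (?dk i j) x"
      proof (rule AE_I2)
        fix x
        show "(\<lambda>m. convolve (\<lambda>y. v y $ \<alpha>) (q m i j) x) \<longlonglongrightarrow> convolve (\<lambda>y. v y $ \<alpha>) (?dk i j) x"
          unfolding convolve_def
        proof (rule integral_dominated_convergence)
          show "integrable lborel (\<lambda>y. C * \<bar>v y $ \<alpha>\<bar>)" using vi by auto
          show "AE y in lborel. norm (v y $ \<alpha> * q m i j (x - y)) \<le> C * \<bar>v y $ \<alpha>\<bar>" for m
          proof (rule AE_I2)
            fix y show "norm (v y $ \<alpha> * q m i j (x - y)) \<le> C * \<bar>v y $ \<alpha>\<bar>"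
              using mult_right_mono[OF q_bdd[of m "x - y"], of "\<bar>v y $ \<alpha>\<bar>"] by (simp add: abs_mult mult.commute)
          qed
          show "AE y in lborel. (\<lambda>m. v y $ \<alpha> * q m i j (x - y)) \<longlonglongrightarrow> v y $ \<alpha> * ?dk i j (x - y)"
            by (intro AE_I2 tendsto_intros q_lim)
        qed measurable
      qed
    qed measurable
    then show "(\<lambda>m. LINT x|lborel. (F m x $ \<alpha> $ i $ j - ?W x $ \<alpha> $ i $ j)\<^sup>2) \<longlonglongrightarrow> 0"
      by (simp add: F_comp)
  qed
qed

text \<open>A Borel version of \<open>has_weak_partial\<close>, stated for \<open>lborel\<close> so that Fubini's theorem applies.\<close>

definition borel_weak_partial :: "(real^'n \<Rightarrow> real) \<Rightarrow> 'n \<Rightarrow> (real^'n \<Rightarrow> real) \<Rightarrow> bool" where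
  "borel_weak_partial f i g \<longleftrightarrow> loc_integrable f \<and> loc_integrable g \<and>
    (\<forall>\<phi>. test_function \<phi> \<longrightarrow>
      (LINT x|lborel. f x * partial_derivative i \<phi> x) = - (LINT x|lborel. g x * \<phi> x))"

text \<open>Test with the reflected kernel y -> k(x - y): the sign from the chain rule cancels the
  sign in the definition of the weak derivative.\<close>

lemma convolve_weak_partial:
  assumes fg: "borel_weak_partial f i g" and k: "test_function k"
  shows "convolve f (partial_derivative i k) x = convolve g k x"
proof -
  have t: "test_function (\<lambda>y. k (x + (- 1) *\<^sub>R y))"
    using k by (rule test_function_affine) simp
  have "partial_derivative i (\<lambda>y. k (x + (- 1) *\<^sub>R y)) = (\<lambda>y. - partial_derivative i k (x - y))"
    using partial_derivative_affine[OF test_function_differentiable[OF k], of i x "-1"] by auto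
  then have "(LINT y|lborel. f y * - partial_derivative i k (x - y)) = - (LINT y|lborel. g y * k (x - y))"
    using fg t unfolding borel_weak_partial_def by (metis (no_types, lifting) Bochner_Integration.integral_cong diff_conv_add_uminus scaleR_minus1_left)
  then show ?thesis by (simp add: convolve_def)
qed

text \<open>With a mollifier as kernel, the outer partial derivative j moves to v first and gives
  \<open>G \<alpha> j\<close>, then the inner one gives \<open>H \<alpha> i j\<close>. The Hessian
  in the kernel statement is therefore the mollified H, which converges to H in L2.\<close>

proposition hessian_inequality_compact_support:
  fixes A :: "real^'n^'n^'N^'N" and v :: "real^'n \<Rightarrow> real^'N"
  assumes v: "\<And>\<alpha> j. borel_weak_partial (\<lambda>x. v x $ \<alpha>) j (G \<alpha> j)"
    and G: "\<And>\<alpha> i j. borel_weak_partial (G \<alpha> j) i (H \<alpha> i j)"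
    and H2: "\<And>\<alpha> i j. integrable lborel (\<lambda>x. (H \<alpha> i j x)\<^sup>2)"
    and v0: "\<And>x. norm x > R \<Longrightarrow> v x = 0" and nonneg: "ellipticity_constant A \<ge> 0"
  shows "hessian_inequality A (\<lambda>x. \<chi> \<alpha> i j. H \<alpha> i j x)"
proof (rule hessian_inequality_limit_components)
  have vloc: "loc_integrable (\<lambda>x. v x $ \<alpha>)" for \<alpha> using v by (auto simp: borel_weak_partial_def)
  have [measurable]: "v \<in> borel_measurable borel"
    by (rule borel_measurable_vecI) (rule loc_integrable_borel[OF vloc])
  have vi: "integrable lborel (\<lambda>x. v x $ \<alpha>)" for \<alpha>
  proof -
    have "integrable lborel (\<lambda>x. indicator (cball 0 R) x * v x $ \<alpha>)"
      using vloc by (auto simp: loc_integrable_def)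
    moreover have "indicator (cball 0 R) x * v x $ \<alpha> = v x $ \<alpha>" for x
      using v0[of x] by (auto simp: indicator_def)
    ultimately show ?thesis by simp
  qed
  have Hm [measurable]: "H \<alpha> i j \<in> borel_measurable borel" for \<alpha> i j
    using G[of \<alpha> j i] by (auto simp: borel_weak_partial_def loc_integrable_def)
  show "hessian_inequality A (\<lambda>x. \<chi> \<alpha> i j. convolve (H \<alpha> i j) (mollifier m) x)" for m
    using hessian_inequality_kernel[OF _ vi v0 mollifier_test_function[of m] nonneg]
    by (simp add: convolve_weak_partial[OF v test_function_partial[OF mollifier_test_function]]
        convolve_weak_partial[OF G mollifier_test_function])
  show "(\<lambda>x. \<chi> \<alpha> i j. H \<alpha> i j x) \<in> borel_measurable borel"
    by (intro borel_measurable_vecI) simp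
  show "(\<lambda>m. LINT x|lborel. ((\<chi> \<alpha> i j. convolve (H \<alpha> i j) (mollifier m) x) $ \<alpha> $ i $ j -
      (\<chi> \<alpha> i j. H \<alpha> i j x) $ \<alpha> $ i $ j)\<^sup>2) \<longlonglongrightarrow> 0" for \<alpha> i j
    using convolve_mollifier_L2[OF Hm H2] by simp
qed (use H2 in simp)

section \<open>Cut-off\<close>

text \<open>Normalised to be 1 at the origin, not on a whole ball: the bump can be reused, and
  continuity at 0 gives pointwise convergence to 1 as the dilation grows.\<close>

definition cutoff :: "nat \<Rightarrow> real^'n \<Rightarrow> real" where
  "cutoff m x = bump ((1 / real (Suc m)) *\<^sub>R x) / bump (0 :: real^'n)"

definition cutoff_profile :: "real^'n \<Rightarrow> real" where
  "cutoff_profile x = bump x / bump (0 :: real^'n)"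

lemma cutoff_profile_test_function: "test_function cutoff_profile"
  using test_function_cmult[OF bump_test_function, of "inverse (bump 0)"]
  by (simp add: cutoff_profile_def[abs_def] divide_inverse mult.commute)

lemma cutoff_eq: "cutoff m x = cutoff_profile ((1 / real (Suc m)) *\<^sub>R x)"
  by (simp add: cutoff_def cutoff_profile_def)

lemma cutoff_test_function: "test_function (cutoff m)"
  using test_function_affine[OF cutoff_profile_test_function, of "1 / real (Suc m)" 0]
  by (simp add: cutoff_eq[abs_def])

lemma cutoff_support: "norm x > real (Suc m) \<Longrightarrow> cutoff m x = 0"
  unfolding cutoff_def by (subst bump_support) (simp_all add: field_simps del: of_nat_Suc)

lemma partial_derivative_scale:
  assumes "f differentiable_on UNIV"
  shows "partial_derivative i (\<lambda>x. f (b *\<^sub>R x)) x = b * partial_derivative i f (b *\<^sub>R x)"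
  using partial_derivative_affine[OF assms, of i 0 b x] by simp

lemma partial_derivative_cmult:
  fixes f :: "real^'n \<Rightarrow> real"
  assumes "f differentiable_on UNIV"
  shows "partial_derivative i (\<lambda>x. c * f x) x = c * partial_derivative i f x"
proof -
  have "partial_derivative i (\<lambda>x::real^'n. c) x = 0"
    by (subst partial_derivative_eqI[where f'="\<lambda>x. 0"]) auto
  then show ?thesis
    using partial_derivative_mult[of "\<lambda>_. c" f i x] assms by simp
qed

lemma partial_derivative_cutoff:
  "partial_derivative i (cutoff m) x =
    1 / real (Suc m) * partial_derivative i cutoff_profile ((1 / real (Suc m)) *\<^sub>R x)"
  unfolding cutoff_eq[abs_def]
  by (rule partial_derivative_scale[OF test_function_differentiable[OF cutoff_profile_test_function]])

lemma partial_derivative2_cutoff: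
  fixes x :: "real^'n"
  shows "partial_derivative i (partial_derivative j (cutoff m)) x =
    (1 / real (Suc m))\<^sup>2 * partial_derivative i (partial_derivative j cutoff_profile) ((1 / real (Suc m)) *\<^sub>R x)"
proof -
  let ?b = "1 / real (Suc m)"
  have d: "partial_derivative j cutoff_profile differentiable_on (UNIV :: (real^'n) set)"
    by (intro test_function_differentiable test_function_partial cutoff_profile_test_function)
  have d': "(\<lambda>x. partial_derivative j cutoff_profile (?b *\<^sub>R x)) differentiable_on (UNIV :: (real^'n) set)"
    using differentiable_affine[OF d, of 0 ?b] by simp
  have "partial_derivative j (cutoff m) = (\<lambda>x. ?b * partial_derivative j cutoff_profile (?b *\<^sub>R (x :: real^'n)))"
    by (rule ext) (rule partial_derivative_cutoff)
  then show ?thesis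
    using partial_derivative_cmult[OF d', of i ?b x] partial_derivative_scale[OF d, of i ?b x]
    by (simp add: power2_eq_square)
qed

lemma cutoff_tendsto: "(\<lambda>m. cutoff m x) \<longlonglongrightarrow> 1" for x :: "real^'n"
proof -
  have "(\<lambda>m. inverse (real (Suc m)) *\<^sub>R x) \<longlonglongrightarrow> 0 *\<^sub>R x"
    by (intro tendsto_intros LIMSEQ_inverse_real_of_nat)
  then have L: "(\<lambda>m. (1 / real (Suc m)) *\<^sub>R x) \<longlonglongrightarrow> 0" by (simp add: inverse_eq_divide)
  have "isCont cutoff_profile (0 :: real^'n)"
    using test_function_continuous[OF cutoff_profile_test_function[where 'a='n]]
    by (simp add: continuous_on_eq_continuous_at)
  from isCont_tendsto_compose[OF this L]
  have "(\<lambda>m. cutoff_profile ((1 / real (Suc m)) *\<^sub>R x)) \<longlonglongrightarrow> cutoff_profile (0 :: real^'n)" .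
  moreover have "bump (0 :: real^'n) > 0" by (rule bump_0)
  ultimately show ?thesis by (simp add: cutoff_eq cutoff_profile_def)
qed

text \<open>Hoelder's inequality, with the exponents forced by scaling, only bounds the integral below;
  Young's inequality with a small parameter together with dominated convergence makes it vanish,
  without requiring the gradient of the cut-off function to be supported in an annulus.\<close>

lemma scaled_weight_L2_vanishes:
  fixes f \<kappa> :: "real^'n \<Rightarrow> real"
  assumes [measurable]: "f \<in> borel_measurable borel" "\<kappa> \<in> borel_measurable borel"
    and s: "0 < s" "2 * s < CARD('n)"
    and f: "integrable lborel (\<lambda>x. \<bar>f x\<bar> powr (2 * real CARD('n) / (real CARD('n) - 2 * real s)))"
    and \<kappa>: "\<And>x. \<bar>\<kappa> x\<bar> \<le> C" "\<And>x. norm x > r \<Longrightarrow> \<kappa> x = 0" and r: "r > 0"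
  shows "integrable lborel (\<lambda>x. ((1 / real (Suc m)) ^ s * \<kappa> ((1 / real (Suc m)) *\<^sub>R x) * f x)\<^sup>2)"
    and "(\<lambda>m. LINT x|lborel. ((1 / real (Suc m)) ^ s * \<kappa> ((1 / real (Suc m)) *\<^sub>R x) * f x)\<^sup>2) \<longlonglongrightarrow> 0"
proof -
  define n where "n = CARD('n)"
  \<comment> \<open>Conjugate exponents. The power q turns the square of f into the assumed power of
    |f|; the power p turns the scale factor of order 2s into one of order n, which offsets the
    volume of the dilated support.\<close>
  define p q where "p = real n / (2 * real s)" and "q = real n / (real n - 2 * real s)"
  have n: "real n - 2 * real s > 0" using s(2) unfolding n_def by linarith
  have p: "p > 1" and q: "q > 1" and pq: "1 / p + 1 / q = 1"
    using n s(1) by (auto simp: p_def q_def field_simps)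
  let ?b = "\<lambda>m. 1 / real (Suc m)"
  define a where "a m x = ((?b m) ^ s * \<kappa> (?b m *\<^sub>R x))\<^sup>2" for m x
  define F where "F x = (f x)\<^sup>2" for x
  have [measurable]: "a m \<in> borel_measurable borel" "F \<in> borel_measurable borel" for m
    unfolding a_def F_def by measurable
  have aF: "((?b m) ^ s * \<kappa> (?b m *\<^sub>R x) * f x)\<^sup>2 = a m x * F x" for m x
    by (simp add: a_def F_def power_mult_distrib)
  have a0: "a m x \<ge> 0" and F0: "F x \<ge> 0" for m x by (auto simp: a_def F_def)
  have Fq: "integrable lborel (\<lambda>x. F x powr q)"
  proof -
    have "F x powr q = \<bar>f x\<bar> powr (2 * real CARD('n) / (real CARD('n) - 2 * real s))" for x
    proof -
      have "F x = \<bar>f x\<bar> powr 2" by (simp add: F_def)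
      then have "F x powr q = \<bar>f x\<bar> powr (2 * q)" by (simp only: powr_powr)
      then show ?thesis by (simp add: q_def n_def)
    qed
    then show ?thesis using f by simp
  qed
  \<comment> \<open>A majorant of \<open>(t * a m x) powr p\<close> whose integral,
    \<open>t powr p * K\<close>, does not depend on m.\<close>
  define b where "b t m x = t powr p * (C\<^sup>2) powr p * (?b m) ^ n * indicator (cball 0 (r * real (Suc m))) x" for t m and x :: "real^'n"
  define K where "K = (C\<^sup>2) powr p * (unit_ball_vol (real n) * r ^ n)"
  have a_le: "a m x \<le> (?b m) ^ (2 * s) * C\<^sup>2" for m x
  proof -
    have "(\<kappa> (?b m *\<^sub>R x))\<^sup>2 \<le> C\<^sup>2"
      using power_mono[OF \<kappa>(1), of "?b m *\<^sub>R x" 2] by simp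
    then show ?thesis by (simp add: a_def power_mult_distrib power_mult[symmetric] mult.commute mult_left_mono del: of_nat_Suc)
  qed
  have a_supp: "a m x = 0" if "norm x > r * real (Suc m)" for m x
    using that \<kappa>(2)[of "?b m *\<^sub>R x"] by (simp add: a_def field_simps del: of_nat_Suc)
  have ab: "(t * a m x) powr p \<le> b t m x" if t: "t > 0" for t m x
  proof (cases "norm x \<le> r * real (Suc m)")
    case True
    have "(t * a m x) powr p \<le> (t * ((?b m) ^ (2 * s) * C\<^sup>2)) powr p"
      using a_le[of m x] a0 t p by (intro powr_mono2 mult_left_mono) auto
    also have "\<dots> = t powr p * (((?b m) ^ (2 * s)) powr p * (C\<^sup>2) powr p)"
      using t by (simp add: powr_mult)
    also have "((?b m) ^ (2 * s)) powr p = (?b m) ^ n"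
    proof -
      have "(?b m) ^ (2 * s) = (?b m) powr (real (2 * s))" by (subst powr_realpow) auto
      then have "((?b m) ^ (2 * s)) powr p = (?b m) powr (real n)"
        using s(1) by (simp add: powr_powr p_def)
      also have "\<dots> = (?b m) ^ n" by (subst powr_realpow) auto
      finally show ?thesis .
    qed
    finally show ?thesis using True by (simp add: b_def mult_ac)
  next
    case False
    then show ?thesis using a_supp[of m x] by (simp add: b_def)
  qed
  have b_int: "integrable lborel (b t m)" for t m
    unfolding b_def
    by (rule integrable_bounded_support[where C="t powr p * (C\<^sup>2) powr p * (?b m) ^ n" and R="r * real (Suc m)"])
       (auto simp: indicator_def intro!: borel_measurable_indicator)
  have b_val: "(LINT x|lborel. b t m x) = t powr p * K" for t m
  proof -
    have "(LINT x|lborel. b t m x) = t powr p * (C\<^sup>2) powr p * (?b m) ^ n * measure lborel (cball (0::real^'n) (r * real (Suc m)))"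
      unfolding b_def by simp
    also have "measure lborel (cball (0::real^'n) (r * real (Suc m))) = unit_ball_vol (real n) * (r * real (Suc m)) ^ n"
      using content_cball[of "r * real (Suc m)" "0::real^'n"] r by (simp add: n_def)
    also have "t powr p * (C\<^sup>2) powr p * (?b m) ^ n * (unit_ball_vol (real n) * (r * real (Suc m)) ^ n) =
       t powr p * K * ((?b m) * real (Suc m)) ^ n"
      by (simp only: K_def power_mult_distrib mult_ac)
    also have "?b m * real (Suc m) = 1" by simp
    finally show ?thesis by simp
  qed
  have young: "a m x * F x \<le> b t m x + (F x / t) powr q" if t: "t > 0" for t m x
  proof -
    have "a m x * F x = (t * a m x) * (F x / t)" using t by simp
    also have "\<dots> \<le> (t * a m x) powr p / p + (F x / t) powr q / q"
      using p q pq t a0 F0 by (intro Youngs_inequality) auto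
    also have "\<dots> \<le> (t * a m x) powr p + (F x / t) powr q"
      using p q by (intro add_mono) (auto simp: divide_le_eq mult_le_cancel_left1)
    finally show ?thesis using ab[OF t, of m x] by linarith
  qed
  have Fqt: "integrable lborel (\<lambda>x. (F x / t) powr q)" if t: "t > 0" for t
    using Fq t F0 by (simp add: powr_divide)
  have aF_int: "integrable lborel (\<lambda>x. a m x * F x)" for m
  proof (rule Bochner_Integration.integrable_bound)
    show "integrable lborel (\<lambda>x. b 1 m x + (F x / 1) powr q)"
      using b_int Fqt[of 1] by (intro Bochner_Integration.integrable_add) auto
    show "AE x in lborel. norm (a m x * F x) \<le> norm (b 1 m x + (F x / 1) powr q)"
    proof (rule AE_I2)
      fix x show "norm (a m x * F x) \<le> norm (b 1 m x + (F x / 1) powr q)"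
        using young[of 1 m x] a0[of m x] F0[of x] by simp
    qed
  qed measurable
  show "integrable lborel (\<lambda>x. ((?b m) ^ s * \<kappa> (?b m *\<^sub>R x) * f x)\<^sup>2)"
    unfolding aF by (rule aF_int)
  have K0: "K \<ge> 0" using r by (simp add: K_def)
  have "(\<lambda>m. LINT x|lborel. a m x * F x) \<longlonglongrightarrow> 0"
  proof (rule LIMSEQ_I)
    fix e :: real assume e: "e > 0"
    \<comment> \<open>Chosen so that the majorant contributes less than e / 2; the 1 added to K
      guards against K = 0.\<close>
    define t where "t = (e / (2 * (K + 1))) powr (1 / p)"
    have t: "t > 0" using e K0 by (simp add: t_def)
    have tp: "t powr p = e / (2 * (K + 1))" using p e K0 by (simp add: t_def powr_powr)
    have tK: "t powr p * K < e / 2" unfolding tp using e K0 by (simp add: field_simps)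
    \<comment> \<open>The excess over the majorant. It stays below the fixed integrable function
      \<open>(F x / t) powr q\<close> and tends to 0 pointwise because \<open>a m x\<close> does, so
      dominated convergence applies.\<close>
    define G where "G m x = max 0 (a m x * F x - b t m x)" for m x
    have [measurable]: "b t m \<in> borel_measurable borel" for m using b_int by auto
    have [measurable]: "G m \<in> borel_measurable borel" for m unfolding G_def by measurable
    have G_bd: "0 \<le> G m x" "G m x \<le> (F x / t) powr q" for m x
      using young[OF t, of m x] by (auto simp: G_def)
    have b0: "b t m x \<ge> 0" for m x by (simp add: b_def)
    have G_int: "integrable lborel (G m)" for m
      by (rule Bochner_Integration.integrable_bound[OF Fqt[OF t]]) (use G_bd in \<open>auto intro!: AE_I2\<close>)
    have "(\<lambda>m. LINT x|lborel. G m x) \<longlonglongrightarrow> (LINT x|(lborel :: (real^'n) measure). 0)"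
    proof (rule integral_dominated_convergence[OF _ _ Fqt[OF t]])
      show "AE x in lborel. (\<lambda>m. G m x) \<longlonglongrightarrow> 0"
      proof (rule AE_I2, rule tendsto_sandwich)
        fix x
        show "\<forall>\<^sub>F m in sequentially. 0 \<le> G m x" using G_bd by simp
        show "\<forall>\<^sub>F m in sequentially. G m x \<le> (?b m) ^ (2 * s) * C\<^sup>2 * F x"
        proof (intro always_eventually allI)
          fix m
          have "G m x \<le> a m x * F x" using b0[of m x] a0[of m x] F0[of x] by (simp add: G_def)
          also have "\<dots> \<le> (?b m) ^ (2 * s) * C\<^sup>2 * F x" by (intro mult_right_mono a_le F0)
          finally show "G m x \<le> (?b m) ^ (2 * s) * C\<^sup>2 * F x" .
        qed
        have "(\<lambda>m. inverse (real (Suc m)) ^ (2 * s) * C\<^sup>2 * F x) \<longlonglongrightarrow> 0 ^ (2 * s) * C\<^sup>2 * F x"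
          by (intro tendsto_intros LIMSEQ_inverse_real_of_nat)
        then show "(\<lambda>m. (?b m) ^ (2 * s) * C\<^sup>2 * F x) \<longlonglongrightarrow> 0"
          using s(1) by (simp add: inverse_eq_divide zero_power)
      qed simp
    qed (use G_bd in \<open>auto intro!: AE_I2\<close>)
    then have "\<forall>\<^sub>F m in sequentially. (LINT x|lborel. G m x) < e / 2"
      using e by (intro order_tendstoD(2)) auto
    then obtain m0 where m0: "\<And>m. m \<ge> m0 \<Longrightarrow> (LINT x|lborel. G m x) < e / 2"
      by (auto simp: eventually_sequentially)
    have "norm ((LINT x|lborel. a m x * F x) - 0) < e" if "m \<ge> m0" for m
    proof -
      have "(LINT x|lborel. a m x * F x) \<le> (LINT x|lborel. b t m x + G m x)"
        by (rule integral_mono) (use aF_int b_int G_int in \<open>auto simp: G_def\<close>)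
      also have "\<dots> = t powr p * K + (LINT x|lborel. G m x)"
        using b_int G_int by (simp add: b_val)
      also have "\<dots> < e" using tK m0[OF that] by linarith
      finally have "(LINT x|lborel. a m x * F x) < e" .
      moreover have "(LINT x|lborel. a m x * F x) \<ge> 0"
        using a0 F0 by (intro Bochner_Integration.integral_nonneg) simp
      ultimately show ?thesis by simp
    qed
    then show "\<exists>m0. \<forall>m\<ge>m0. norm ((LINT x|lborel. a m x * F x) - 0) < e" by blast
  qed
  then show "(\<lambda>m. LINT x|lborel. ((?b m) ^ s * \<kappa> (?b m *\<^sub>R x) * f x)\<^sup>2) \<longlonglongrightarrow> 0"
    unfolding aF .
qed

section \<open>Product rule for weak derivatives\<close>

lemma loc_integrable_add:
  assumes "loc_integrable f" "loc_integrable g"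
  shows "loc_integrable (\<lambda>x. f x + g x)"
  using assms unfolding loc_integrable_def by (auto simp: distrib_left)

lemma loc_integrable_test_function:
  assumes "loc_integrable f" "test_function \<phi>"
  shows "integrable lborel (\<lambda>x. f x * \<phi> x)"
  using assms
  by (metis loc_integrable_mult_bounded test_function_borel test_function_bounded test_function_support)

lemma loc_integrable_mult_test_function:
  assumes f: "loc_integrable f" and \<phi>: "test_function \<phi>"
  shows "loc_integrable (\<lambda>x. \<phi> x * f x)"
  unfolding loc_integrable_def
proof (intro conjI allI)
  have [measurable]: "f \<in> borel_measurable borel" "\<phi> \<in> borel_measurable borel"
    using f \<phi> by (auto simp: loc_integrable_def)
  show "(\<lambda>x. \<phi> x * f x) \<in> borel_measurable borel" by measurable
  have [measurable]: "cball (0::real^'a) r \<in> sets borel" for r by simp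
  show "integrable lborel (\<lambda>x. indicator (cball 0 r) x * (\<phi> x * f x))" for r
    by (rule Bochner_Integration.integrable_bound[OF loc_integrable_test_function[OF f \<phi>]])
       (auto simp: indicator_def mult.commute)
qed

lemma borel_weak_partial_add:
  assumes f: "borel_weak_partial f i g" and f': "borel_weak_partial f' i g'"
  shows "borel_weak_partial (\<lambda>x. f x + f' x) i (\<lambda>x. g x + g' x)"
  using assms unfolding borel_weak_partial_def
  by (auto simp: loc_integrable_add distrib_right loc_integrable_test_function test_function_partial)

text \<open>The product of \<open>\<eta>\<close> with a test function is again a test function;
  inserting it in the definition for f and expanding by the classical product rule isolates the term
  in which \<open>\<eta>\<close> is differentiated.\<close>

lemma borel_weak_partial_mult:
  assumes fg: "borel_weak_partial f i g" and \<eta>: "test_function \<eta>"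
  shows "borel_weak_partial (\<lambda>x. \<eta> x * f x) i (\<lambda>x. \<eta> x * g x + partial_derivative i \<eta> x * f x)"
  unfolding borel_weak_partial_def
proof (intro conjI allI impI)
  have f: "loc_integrable f" and g: "loc_integrable g" using fg by (auto simp: borel_weak_partial_def)
  show "loc_integrable (\<lambda>x. \<eta> x * f x)" by (rule loc_integrable_mult_test_function[OF f \<eta>])
  show "loc_integrable (\<lambda>x. \<eta> x * g x + partial_derivative i \<eta> x * f x)"
    by (intro loc_integrable_add loc_integrable_mult_test_function f g \<eta> test_function_partial)
  fix \<phi> :: "real^'a \<Rightarrow> real" assume \<phi>: "test_function \<phi>"
  have t: "test_function (\<lambda>x. \<eta> x * \<phi> x)" "test_function (\<lambda>x. partial_derivative i \<eta> x * \<phi> x)"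
    using \<eta> \<phi> by (auto intro!: test_function_mult test_function_C_k test_function_partial)
  have pd: "partial_derivative i (\<lambda>x. \<eta> x * \<phi> x) x =
      partial_derivative i \<eta> x * \<phi> x + \<eta> x * partial_derivative i \<phi> x" for x
    by (intro partial_derivative_mult test_function_differentiable \<eta> \<phi>)
  have "(LINT x|lborel. \<eta> x * f x * partial_derivative i \<phi> x) =
      (LINT x|lborel. f x * partial_derivative i (\<lambda>x. \<eta> x * \<phi> x) x - f x * (partial_derivative i \<eta> x * \<phi> x))"
    by (simp add: pd algebra_simps)
  also have "\<dots> = (LINT x|lborel. f x * partial_derivative i (\<lambda>x. \<eta> x * \<phi> x) x) - (LINT x|lborel. f x * (partial_derivative i \<eta> x * \<phi> x))"
    by (intro Bochner_Integration.integral_diff loc_integrable_test_function f t test_function_partial)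
  also have "(LINT x|lborel. f x * partial_derivative i (\<lambda>x. \<eta> x * \<phi> x) x) = - (LINT x|lborel. g x * (\<eta> x * \<phi> x))"
    using fg t unfolding borel_weak_partial_def by blast
  also have "- (LINT x|lborel. g x * (\<eta> x * \<phi> x)) - (LINT x|lborel. f x * (partial_derivative i \<eta> x * \<phi> x)) =
      - (LINT x|lborel. g x * (\<eta> x * \<phi> x) + f x * (partial_derivative i \<eta> x * \<phi> x))"
    using loc_integrable_test_function[OF g t(1)] loc_integrable_test_function[OF f t(2)] by simp
  finally show "(LINT x|lborel. \<eta> x * f x * partial_derivative i \<phi> x) =
      - (LINT x|lborel. (\<eta> x * g x + partial_derivative i \<eta> x * f x) * \<phi> x)"
    by (simp add: algebra_simps)
qed

lemma L2_null_add:
  fixes f g :: "nat \<Rightarrow> real^'n \<Rightarrow> real"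
  assumes [measurable]: "\<And>m. f m \<in> borel_measurable borel" "\<And>m. g m \<in> borel_measurable borel"
    and f: "\<And>m. integrable lborel (\<lambda>x. (f m x)\<^sup>2)" "(\<lambda>m. LINT x|lborel. (f m x)\<^sup>2) \<longlonglongrightarrow> 0"
    and g: "\<And>m. integrable lborel (\<lambda>x. (g m x)\<^sup>2)" "(\<lambda>m. LINT x|lborel. (g m x)\<^sup>2) \<longlonglongrightarrow> 0"
  shows "\<And>m. integrable lborel (\<lambda>x. (f m x + g m x)\<^sup>2)"
    and "(\<lambda>m. LINT x|lborel. (f m x + g m x)\<^sup>2) \<longlonglongrightarrow> 0"
proof -
  have le: "(f m x + g m x)\<^sup>2 \<le> 2 * (f m x)\<^sup>2 + 2 * (g m x)\<^sup>2" for m x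
    using norm_add_sq_le[of 1 "f m x" "g m x"] by simp
  have i2: "integrable lborel (\<lambda>x. 2 * (f m x)\<^sup>2 + 2 * (g m x)\<^sup>2)" for m using f g by auto
  show i: "integrable lborel (\<lambda>x. (f m x + g m x)\<^sup>2)" for m
    by (rule Bochner_Integration.integrable_bound[OF i2[of m]]) (use le in \<open>auto intro!: AE_I2\<close>)
  show "(\<lambda>m. LINT x|lborel. (f m x + g m x)\<^sup>2) \<longlonglongrightarrow> 0"
  proof (rule tendsto_sandwich)
    show "\<forall>\<^sub>F m in sequentially. 0 \<le> (LINT x|lborel. (f m x + g m x)\<^sup>2)"
      by (simp add: Bochner_Integration.integral_nonneg)
    have "(LINT x|lborel. (f m x + g m x)\<^sup>2) \<le> 2 * (LINT x|lborel. (f m x)\<^sup>2) + 2 * (LINT x|lborel. (g m x)\<^sup>2)" for m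
      using integral_mono[OF i i2 le, of m] f g by simp
    then show "\<forall>\<^sub>F m in sequentially. (LINT x|lborel. (f m x + g m x)\<^sup>2) \<le>
        2 * (LINT x|lborel. (f m x)\<^sup>2) + 2 * (LINT x|lborel. (g m x)\<^sup>2)" by simp
    show "(\<lambda>m. 2 * (LINT x|lborel. (f m x)\<^sup>2) + 2 * (LINT x|lborel. (g m x)\<^sup>2)) \<longlonglongrightarrow> 0"
      using tendsto_add[OF tendsto_mult_right_zero[OF f(2), of 2] tendsto_mult_right_zero[OF g(2), of 2]] by simp
  qed simp
qed

text \<open>The error terms of the truncated Hessian carry one derivative of the cut-off times Du,
  or two times u. With R the cut-off radius these derivatives scale like 1/R and 1/R^2, which
  matches the exponent 2n/(n - 2s) for s = 1 and s = 2; the case s = 2 is what asks for n >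
  4.\<close>

proposition hessian_inequality_weak:
  fixes A :: "real^'n^'n^'N^'N" and u :: "real^'n \<Rightarrow> real^'N"
  assumes u: "\<And>\<alpha> j. borel_weak_partial (\<lambda>x. u x $ \<alpha>) j (G \<alpha> j)"
    and G: "\<And>\<alpha> i j. borel_weak_partial (G \<alpha> j) i (H \<alpha> i j)"
    and u_int: "\<And>\<alpha>. integrable lborel (\<lambda>x. \<bar>u x $ \<alpha>\<bar> powr (2 * real CARD('n) / (real CARD('n) - 4)))"
    and G_int: "\<And>\<alpha> j. integrable lborel (\<lambda>x. \<bar>G \<alpha> j x\<bar> powr (2 * real CARD('n) / (real CARD('n) - 2)))"
    and H2: "\<And>\<alpha> i j. integrable lborel (\<lambda>x. (H \<alpha> i j x)\<^sup>2)"
    and n: "CARD('n) \<ge> 5" and nonneg: "ellipticity_constant A \<ge> 0"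
  shows "hessian_inequality A (\<lambda>x. \<chi> \<alpha> i j. H \<alpha> i j x)"
proof -
  have [measurable]: "(\<lambda>x. u x $ \<alpha>) \<in> borel_measurable borel" "G \<alpha> j \<in> borel_measurable borel"
    "H \<alpha> i j \<in> borel_measurable borel" for \<alpha> i j
    using u[of \<alpha> j] G[of \<alpha> j i] by (auto simp: borel_weak_partial_def loc_integrable_def)
  let ?\<eta> = "cutoff :: nat \<Rightarrow> real^'n \<Rightarrow> real"
  define Gm where "Gm m \<alpha> j x = ?\<eta> m x * G \<alpha> j x + partial_derivative j (?\<eta> m) x * u x $ \<alpha>" for m \<alpha> j x
  \<comment> \<open>All terms in which the cut-off is differentiated at least once; what remains is
    the cut-off times H.\<close>
  define E where "E m \<alpha> i j x = partial_derivative i (?\<eta> m) x * G \<alpha> j x +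
      (partial_derivative j (?\<eta> m) x * G \<alpha> i x + partial_derivative i (partial_derivative j (?\<eta> m)) x * u x $ \<alpha>)" for m \<alpha> i j x
  \<comment> \<open>Bracketed as the product rule produces it when the two summands of
    \<open>Gm\<close> are differentiated separately.\<close>
  define Hm where "Hm m \<alpha> i j x = (?\<eta> m x * H \<alpha> i j x + partial_derivative i (?\<eta> m) x * G \<alpha> j x) +
      (partial_derivative j (?\<eta> m) x * G \<alpha> i x + partial_derivative i (partial_derivative j (?\<eta> m)) x * u x $ \<alpha>)" for m \<alpha> i j x
  have \<eta>: "test_function (?\<eta> m)" for m by (rule cutoff_test_function)
  have [measurable]: "?\<eta> m \<in> borel_measurable borel" "partial_derivative i (?\<eta> m) \<in> borel_measurable borel"
    "partial_derivative i (partial_derivative j (?\<eta> m)) \<in> borel_measurable borel" for m i j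
    by (intro test_function_borel test_function_partial \<eta>)+
  have wG: "borel_weak_partial (\<lambda>x. (?\<eta> m x *\<^sub>R u x) $ \<alpha>) j (Gm m \<alpha> j)" for m \<alpha> j
    using borel_weak_partial_mult[OF u \<eta>] by (simp add: Gm_def[abs_def])
  have wH: "borel_weak_partial (Gm m \<alpha> j) i (Hm m \<alpha> i j)" for m \<alpha> i j
    unfolding Gm_def[abs_def] Hm_def[abs_def]
    by (intro borel_weak_partial_add borel_weak_partial_mult G u \<eta> test_function_partial)
  have t1: "test_function (partial_derivative i (cutoff_profile :: real^'n \<Rightarrow> real))"
    and t2: "test_function (partial_derivative i (partial_derivative j (cutoff_profile :: real^'n \<Rightarrow> real)))" for i j
    by (intro test_function_partial cutoff_profile_test_function)+
  have grad: "integrable lborel (\<lambda>x. (partial_derivative i (?\<eta> m) x * G \<alpha> j x)\<^sup>2)"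
    "(\<lambda>m. LINT x|lborel. (partial_derivative i (?\<eta> m) x * G \<alpha> j x)\<^sup>2) \<longlonglongrightarrow> 0" for m i j \<alpha>
  proof -
    obtain C where C: "\<And>x. \<bar>partial_derivative i (cutoff_profile :: real^'n \<Rightarrow> real) x\<bar> \<le> C"
      using test_function_bounded[OF t1] by blast
    obtain r where r: "r > 0" "\<And>x. norm x > r \<Longrightarrow> partial_derivative i (cutoff_profile :: real^'n \<Rightarrow> real) x = 0"
      using test_function_support[OF t1] by blast
    note * = scaled_weight_L2_vanishes[of "G \<alpha> j" "partial_derivative i cutoff_profile" 1 C r,
        OF _ test_function_borel[OF t1] _ _ _ C r(2,1)]
    show "integrable lborel (\<lambda>x. (partial_derivative i (?\<eta> m) x * G \<alpha> j x)\<^sup>2)"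
      "(\<lambda>m. LINT x|lborel. (partial_derivative i (?\<eta> m) x * G \<alpha> j x)\<^sup>2) \<longlonglongrightarrow> 0"
      using *(1)[of m] *(2) n G_int[of \<alpha> j] by (simp_all add: partial_derivative_cutoff del: of_nat_Suc One_nat_def)
  qed
  have hess: "integrable lborel (\<lambda>x. (partial_derivative i (partial_derivative j (?\<eta> m)) x * u x $ \<alpha>)\<^sup>2)"
    "(\<lambda>m. LINT x|lborel. (partial_derivative i (partial_derivative j (?\<eta> m)) x * u x $ \<alpha>)\<^sup>2) \<longlonglongrightarrow> 0" for m i j \<alpha>
  proof -
    obtain C where C: "\<And>x. \<bar>partial_derivative i (partial_derivative j (cutoff_profile :: real^'n \<Rightarrow> real)) x\<bar> \<le> C"
      using test_function_bounded[OF t2] by blast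
    obtain r where r: "r > 0" "\<And>x. norm x > r \<Longrightarrow> partial_derivative i (partial_derivative j (cutoff_profile :: real^'n \<Rightarrow> real)) x = 0"
      using test_function_support[OF t2] by blast
    note * = scaled_weight_L2_vanishes[of "\<lambda>x. u x $ \<alpha>" "partial_derivative i (partial_derivative j cutoff_profile)" 2 C r,
        OF _ test_function_borel[OF t2] _ _ _ C r(2,1)]
    show "integrable lborel (\<lambda>x. (partial_derivative i (partial_derivative j (?\<eta> m)) x * u x $ \<alpha>)\<^sup>2)"
      "(\<lambda>m. LINT x|lborel. (partial_derivative i (partial_derivative j (?\<eta> m)) x * u x $ \<alpha>)\<^sup>2) \<longlonglongrightarrow> 0"
      using *(1)[of m] *(2) n u_int[of \<alpha>] by (simp_all add: partial_derivative2_cutoff del: of_nat_Suc)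
  qed
  have E_meas [measurable]: "E m \<alpha> i j \<in> borel_measurable borel" for m \<alpha> i j
    unfolding E_def by measurable
  have E: "integrable lborel (\<lambda>x. (E m \<alpha> i j x)\<^sup>2)" "(\<lambda>m. LINT x|lborel. (E m \<alpha> i j x)\<^sup>2) \<longlonglongrightarrow> 0" for m \<alpha> i j
  proof -
    define e1 e2 e3 where "e1 m x = partial_derivative i (?\<eta> m) x * G \<alpha> j x"
      and "e2 m x = partial_derivative j (?\<eta> m) x * G \<alpha> i x"
      and "e3 m x = partial_derivative i (partial_derivative j (?\<eta> m)) x * u x $ \<alpha>" for m x
    have [measurable]: "e1 m \<in> borel_measurable borel" "e2 m \<in> borel_measurable borel" "e3 m \<in> borel_measurable borel" for m
      unfolding e1_def e2_def e3_def by measurable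
    have e: "integrable lborel (\<lambda>x. (e1 m x)\<^sup>2)" "(\<lambda>m. LINT x|lborel. (e1 m x)\<^sup>2) \<longlonglongrightarrow> 0"
      "integrable lborel (\<lambda>x. (e2 m x)\<^sup>2)" "(\<lambda>m. LINT x|lborel. (e2 m x)\<^sup>2) \<longlonglongrightarrow> 0"
      "integrable lborel (\<lambda>x. (e3 m x)\<^sup>2)" "(\<lambda>m. LINT x|lborel. (e3 m x)\<^sup>2) \<longlonglongrightarrow> 0" for m
      unfolding e1_def e2_def e3_def by (rule grad hess)+
    have e23: "integrable lborel (\<lambda>x. (e2 m x + e3 m x)\<^sup>2)" "(\<lambda>m. LINT x|lborel. (e2 m x + e3 m x)\<^sup>2) \<longlonglongrightarrow> 0" for m
      using L2_null_add[of e2 e3] e by simp_all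
    have "integrable lborel (\<lambda>x. (e1 m x + (e2 m x + e3 m x))\<^sup>2)"
      "(\<lambda>m. LINT x|lborel. (e1 m x + (e2 m x + e3 m x))\<^sup>2) \<longlonglongrightarrow> 0"
      using L2_null_add[of e1 "\<lambda>m x. e2 m x + e3 m x"] e e23 by simp_all
    then show "integrable lborel (\<lambda>x. (E m \<alpha> i j x)\<^sup>2)" "(\<lambda>m. LINT x|lborel. (E m \<alpha> i j x)\<^sup>2) \<longlonglongrightarrow> 0"
      by (simp_all add: E_def e1_def e2_def e3_def)
  qed
  obtain C where C: "\<And>x. \<bar>cutoff_profile (x :: real^'n)\<bar> \<le> C"
    using test_function_bounded[OF cutoff_profile_test_function] by blast
  have D_le: "((?\<eta> m x - 1) * H \<alpha> i j x)\<^sup>2 \<le> (C + 1)\<^sup>2 * (H \<alpha> i j x)\<^sup>2" for m \<alpha> i j x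
  proof -
    have "\<bar>?\<eta> m x - 1\<bar> \<le> \<bar>C + 1\<bar>" using C[of "(1 / real (Suc m)) *\<^sub>R x"] by (simp add: cutoff_eq)
    then have "(?\<eta> m x - 1)\<^sup>2 \<le> (C + 1)\<^sup>2" by (simp add: abs_le_square_iff)
    then show ?thesis by (simp add: power_mult_distrib mult_right_mono)
  qed
  have D: "integrable lborel (\<lambda>x. ((?\<eta> m x - 1) * H \<alpha> i j x)\<^sup>2)"
    "(\<lambda>m. LINT x|lborel. ((?\<eta> m x - 1) * H \<alpha> i j x)\<^sup>2) \<longlonglongrightarrow> 0" for m \<alpha> i j
  proof -
    have w: "integrable lborel (\<lambda>x. (C + 1)\<^sup>2 * (H \<alpha> i j x)\<^sup>2)" using H2 by simp
    show "integrable lborel (\<lambda>x. ((?\<eta> m x - 1) * H \<alpha> i j x)\<^sup>2)"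
      by (rule Bochner_Integration.integrable_bound[OF w]) (use D_le in \<open>auto intro!: AE_I2\<close>)
    have "(\<lambda>m. LINT x|lborel. ((?\<eta> m x - 1) * H \<alpha> i j x - 0)\<^sup>2) \<longlonglongrightarrow> 0"
    proof (rule L2_dominated_convergence[OF _ _ w])
      show "AE x in lborel. (\<lambda>m. (?\<eta> m x - 1) * H \<alpha> i j x) \<longlonglongrightarrow> 0"
      proof (rule AE_I2)
        fix x
        have "(\<lambda>m. (?\<eta> m x - 1) * H \<alpha> i j x) \<longlonglongrightarrow> (1 - 1) * H \<alpha> i j x"
          by (intro tendsto_intros cutoff_tendsto)
        then show "(\<lambda>m. (?\<eta> m x - 1) * H \<alpha> i j x) \<longlonglongrightarrow> 0" by simp
      qed
    qed (use D_le in simp_all)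
    then show "(\<lambda>m. LINT x|lborel. ((?\<eta> m x - 1) * H \<alpha> i j x)\<^sup>2) \<longlonglongrightarrow> 0" by simp
  qed
  have diff: "Hm m \<alpha> i j x - H \<alpha> i j x = (?\<eta> m x - 1) * H \<alpha> i j x + E m \<alpha> i j x" for m \<alpha> i j x
    by (simp add: Hm_def E_def algebra_simps)
  have Hm_meas [measurable]: "Hm m \<alpha> i j \<in> borel_measurable borel" for m \<alpha> i j
    unfolding Hm_def by measurable
  have diff_int: "integrable lborel (\<lambda>x. (Hm m \<alpha> i j x - H \<alpha> i j x)\<^sup>2)"
    and lim: "(\<lambda>m. LINT x|lborel. (Hm m \<alpha> i j x - H \<alpha> i j x)\<^sup>2) \<longlonglongrightarrow> 0" for m \<alpha> i j
  proof -
    have "(\<lambda>x. (?\<eta> m x - 1) * H \<alpha> i j x) \<in> borel_measurable borel" for m by measurable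
    then show "integrable lborel (\<lambda>x. (Hm m \<alpha> i j x - H \<alpha> i j x)\<^sup>2)"
      "(\<lambda>m. LINT x|lborel. (Hm m \<alpha> i j x - H \<alpha> i j x)\<^sup>2) \<longlonglongrightarrow> 0"
      unfolding diff
      using L2_null_add[of "\<lambda>m x. (?\<eta> m x - 1) * H \<alpha> i j x" "\<lambda>m. E m \<alpha> i j"] D E E_meas
      by simp_all
  qed
  have Hm2: "integrable lborel (\<lambda>x. (Hm m \<alpha> i j x)\<^sup>2)" for m \<alpha> i j
  proof -
    \<comment> \<open>\<open>Hm\<close> is written as the difference of \<open>Hm - H\<close> and
      \<open>- H\<close>, both square integrable.\<close>
    have "integrable lborel (\<lambda>x. (- H \<alpha> i j x)\<^sup>2)" using H2 by simp
    from integrable_sq_diff[OF _ _ diff_int[of m \<alpha> i j] this] show ?thesis by simp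
  qed
  show ?thesis
  proof (rule hessian_inequality_limit_components)
    show "hessian_inequality A (\<lambda>x. \<chi> \<alpha> i j. Hm m \<alpha> i j x)" for m
      by (rule hessian_inequality_compact_support[OF wG wH Hm2 _ nonneg, of "real (Suc m)"])
         (simp add: cutoff_support del: of_nat_Suc)
    show "(\<lambda>x. \<chi> \<alpha> i j. H \<alpha> i j x) \<in> borel_measurable borel"
      by (intro borel_measurable_vecI) simp
  qed (use H2 lim in simp_all)
qed

section \<open>From Lebesgue to Borel representatives\<close>

text \<open>The weak derivatives are known only to be Lebesgue measurable, whereas the arguments
  above are carried out for Borel functions; a version that agrees almost everywhere changes no
  integral.\<close>

definition borel_rep :: "(real^'n \<Rightarrow> real) \<Rightarrow> real^'n \<Rightarrow> real" where
  "borel_rep f = (SOME f'. f' \<in> borel_measurable borel \<and> (AE x in lebesgue. f x = f' x))"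

lemma borel_rep:
  assumes "f \<in> borel_measurable lebesgue"
  shows "borel_rep f \<in> borel_measurable borel" and "AE x in lebesgue. f x = borel_rep f x"
proof -
  have "\<exists>f'. f' \<in> borel_measurable borel \<and> (AE x in lebesgue. f x = f' x)"
    using completion_ex_borel_measurable_real[OF assms] by (auto simp: AE_completion_iff)
  from someI_ex[OF this]
  show "borel_rep f \<in> borel_measurable borel" and "AE x in lebesgue. f x = borel_rep f x"
    by (simp_all add: borel_rep_def)
qed

lemma integrable_borel_representative:
  fixes f f' :: "real^'n \<Rightarrow> real"
  assumes "integrable lebesgue f" and [measurable]: "f' \<in> borel_measurable borel" and "AE x in lebesgue. f x = f' x"
  shows "integrable lborel f'"
proof -
  have "f' \<in> borel_measurable lebesgue" by (simp add: measurable_completion)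
  then have "integrable lebesgue f'"
    using Bochner_Integration.integrable_cong_AE[OF borel_measurable_integrable[OF assms(1)] _ assms(3)] assms(1) by simp
  then show ?thesis by (simp add: integrable_completion)
qed

lemma integral_borel_representative:
  fixes f f' :: "real^'n \<Rightarrow> real"
  assumes "f \<in> borel_measurable lebesgue" and [measurable]: "f' \<in> borel_measurable borel" and "AE x in lebesgue. f x = f' x"
  shows "(LINT x|lebesgue. f x) = (LINT x|lborel. f' x)"
proof -
  have "f' \<in> borel_measurable lebesgue" by (simp add: measurable_completion)
  then have "(LINT x|lebesgue. f x) = (LINT x|lebesgue. f' x)"
    using assms by (intro integral_cong_AE) auto
  then show ?thesis by (simp add: integral_completion)
qed

lemma loc_integrable_representative:
  assumes "locally_integrable f" and [measurable]: "f' \<in> borel_measurable borel" and ae: "AE x in lebesgue. f x = f' x"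
  shows "loc_integrable f'"
  unfolding loc_integrable_def
proof (intro conjI allI)
  have [measurable]: "cball (0::real^'a) r \<in> sets borel" for r by simp
  show "integrable lborel (\<lambda>x. indicator (cball 0 r) x * f' x)" for r
  proof (rule integrable_borel_representative)
    show "integrable lebesgue (\<lambda>x. indicator (cball 0 r) x *\<^sub>R f x)"
      using assms(1) by (simp add: locally_integrable_def set_integrable_def)
    show "AE x in lebesgue. indicator (cball 0 r) x *\<^sub>R f x = indicator (cball 0 r) x * f' x"
      using ae by eventually_elim simp
  qed measurable
qed simp

lemma borel_weak_partial_representative:
  fixes f g :: "real^'n \<Rightarrow> real"
  assumes fg: "has_weak_partial f i g"
    and f [measurable]: "f \<in> borel_measurable lebesgue" "f' \<in> borel_measurable borel" "AE x in lebesgue. f x = f' x"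
    and g [measurable]: "g \<in> borel_measurable lebesgue" "g' \<in> borel_measurable borel" "AE x in lebesgue. g x = g' x"
  shows "borel_weak_partial f' i g'"
  unfolding borel_weak_partial_def
proof (intro conjI allI impI)
  show "loc_integrable f'" "loc_integrable g'"
    using fg f g loc_integrable_representative unfolding has_weak_partial_def by blast+
  fix \<phi> :: "real^'n \<Rightarrow> real" assume \<phi>: "test_function \<phi>"
  have [measurable]: "\<phi> \<in> borel_measurable borel" "partial_derivative i \<phi> \<in> borel_measurable borel"
    using \<phi> by (auto intro: test_function_borel test_function_partial)
  have [measurable]: "\<phi> \<in> borel_measurable lebesgue" "partial_derivative i \<phi> \<in> borel_measurable lebesgue"
    by (simp_all add: measurable_completion)
  have "(LINT x|lborel. f' x * partial_derivative i \<phi> x) = (LINT x|lebesgue. f x * partial_derivative i \<phi> x)"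
    by (rule integral_borel_representative[symmetric]) (use f in \<open>auto elim: eventually_mono\<close>)
  also have "\<dots> = - (LINT x|lebesgue. g x * \<phi> x)"
    using fg \<phi> by (simp add: has_weak_partial_def)
  also have "(LINT x|lebesgue. g x * \<phi> x) = (LINT x|lborel. g' x * \<phi> x)"
    by (rule integral_borel_representative) (use g in \<open>auto elim: eventually_mono\<close>)
  finally show "(LINT x|lborel. f' x * partial_derivative i \<phi> x) = - (LINT x|lborel. g' x * \<phi> x)" .
qed

lemma has_weak_partial_weak_partial: "weakly_differentiable f \<Longrightarrow> has_weak_partial f i (weak_partial i f)"
  using someI_ex[of "has_weak_partial f i"] by (simp add: weakly_differentiable_def weak_partial_def)

lemma integrable_powr_dominated:
  fixes f :: "real^'n \<Rightarrow> real" and g :: "real^'n \<Rightarrow> 'b::euclidean_space"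
  assumes "in_Lp p g" "p \<ge> 0" "f \<in> borel_measurable lebesgue" "\<And>x. \<bar>f x\<bar> \<le> norm (g x)"
  shows "integrable lebesgue (\<lambda>x. \<bar>f x\<bar> powr p)"
proof (rule Bochner_Integration.integrable_bound)
  show "integrable lebesgue (\<lambda>x. norm (g x) powr p)" using assms(1) by (simp add: in_Lp_def)
  show "(\<lambda>x. \<bar>f x\<bar> powr p) \<in> borel_measurable lebesgue" using assms(3) by measurable
  show "AE x in lebesgue. norm (\<bar>f x\<bar> powr p) \<le> norm (norm (g x) powr p)"
    using assms(2,4) by (intro AE_I2) (simp add: powr_mono2)
qed

theorem proposition10:
  fixes A :: "real^'n^'n^'N^'N"
  assumes "CARD('n) \<ge> 5" and "CARD('N) \<ge> 2"
    and "A \<in> tensors_S" and "rank_one_positive A"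
  shows "\<forall>u \<in> (W22_star :: (real^'n \<Rightarrow> real^'N) set).
    Lp_norm 2 (weak_D2 u) \<le>
      1 / ellipticity_constant A * Lp_norm 2 (\<lambda>x. tensor_contract A (weak_D2 u x))"
proof
  fix u :: "real^'n \<Rightarrow> real^'N" assume "u \<in> W22_star"
  then have uLp: "in_Lp (2 * real CARD('n) / (real CARD('n) - 4)) u"
    and uw: "\<And>\<alpha>. weakly_differentiable (\<lambda>y. u y $ \<alpha>)"
    and DuLp: "in_Lp (2 * real CARD('n) / (real CARD('n) - 2)) (weak_D u)"
    and Duw: "\<And>\<alpha> j. weakly_differentiable (weak_partial j (\<lambda>y. u y $ \<alpha>))"
    and D2uLp: "in_Lp 2 (weak_D2 u)"
    by (auto simp: W22_star_def)
  let ?\<nu> = "ellipticity_constant A"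
  have \<nu>: "?\<nu> > 0" using assms(4) by (simp add: rank_one_positive_def)
  have n: "real CARD('n) \<ge> 5" using assms(1) by simp
  have um [measurable]: "(\<lambda>x. u x $ \<alpha>) \<in> borel_measurable lebesgue" for \<alpha>
    using uLp by (auto simp: in_Lp_def)
  \<comment> \<open>The weak partial derivatives are chosen arbitrarily; their measurability is read
    off from \<open>in_Lp\<close> for the whole of \<open>weak_D u\<close>.\<close>
  have Dum: "weak_partial j (\<lambda>y. u y $ \<alpha>) \<in> borel_measurable lebesgue" for \<alpha> j
  proof -
    have "(\<lambda>x. weak_D u x $ \<alpha> $ j) \<in> borel_measurable lebesgue" using DuLp by (auto simp: in_Lp_def)
    then show ?thesis by (simp add: weak_D_def)
  qed
  have D2um: "weak_partial i (weak_partial j (\<lambda>y. u y $ \<alpha>)) \<in> borel_measurable lebesgue" for \<alpha> i j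
  proof -
    have "(\<lambda>x. weak_D2 u x $ \<alpha> $ i $ j) \<in> borel_measurable lebesgue" using D2uLp by (auto simp: in_Lp_def)
    then show ?thesis by (simp add: weak_D2_def)
  qed
  define U where "U \<alpha> = borel_rep (\<lambda>x. u x $ \<alpha>)" for \<alpha>
  define G where "G \<alpha> j = borel_rep (weak_partial j (\<lambda>y. u y $ \<alpha>))" for \<alpha> j
  define H where "H \<alpha> i j = borel_rep (weak_partial i (weak_partial j (\<lambda>y. u y $ \<alpha>)))" for \<alpha> i j
  note U = borel_rep[OF um, folded U_def] and G = borel_rep[OF Dum, folded G_def]
    and H = borel_rep[OF D2um, folded H_def]
  define V where "V x = (\<chi> \<alpha>. U \<alpha> x)" for x
  define K where "K x = (\<chi> \<alpha> i j. H \<alpha> i j x)" for x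
  have wU: "borel_weak_partial (\<lambda>x. V x $ \<alpha>) j (G \<alpha> j)" for \<alpha> j
    using borel_weak_partial_representative[OF has_weak_partial_weak_partial[OF uw] um U Dum G] by (simp add: V_def)
  \<comment> \<open>\<open>weak_D2\<close> differentiates the very representative chosen as first
    derivative, so its Borel version \<open>G\<close> fits both as derivative of \<open>V\<close>
    and as the function that has derivative \<open>H\<close>.\<close>
  have wG: "borel_weak_partial (G \<alpha> j) i (H \<alpha> i j)" for \<alpha> i j
    by (rule borel_weak_partial_representative[OF has_weak_partial_weak_partial[OF Duw] Dum G D2um H])
  have transfer: "integrable lborel (\<lambda>x. \<bar>f' x\<bar> powr p)"
    if "integrable lebesgue (\<lambda>x. \<bar>f x\<bar> powr p)" "f' \<in> borel_measurable borel" "AE x in lebesgue. f x = f' x"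
    for f f' :: "real^'n \<Rightarrow> real" and p
    by (rule integrable_borel_representative[OF that(1)]) (use that in \<open>auto elim: eventually_mono\<close>)
  have U_int: "integrable lborel (\<lambda>x. \<bar>V x $ \<alpha>\<bar> powr (2 * real CARD('n) / (real CARD('n) - 4)))" for \<alpha>
  proof -
    have "integrable lebesgue (\<lambda>x. \<bar>u x $ \<alpha>\<bar> powr (2 * real CARD('n) / (real CARD('n) - 4)))"
      using n by (intro integrable_powr_dominated[OF uLp _ um] component_le_norm_cart) simp
    from transfer[OF this U] show ?thesis by (simp add: V_def)
  qed
  have G_int: "integrable lborel (\<lambda>x. \<bar>G \<alpha> j x\<bar> powr (2 * real CARD('n) / (real CARD('n) - 2)))" for \<alpha> j
  proof (rule transfer[OF integrable_powr_dominated[OF DuLp _ Dum] G])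
    show "0 \<le> 2 * real CARD('n) / (real CARD('n) - 2)" using n by simp
    show "\<bar>weak_partial j (\<lambda>y. u y $ \<alpha>) x\<bar> \<le> norm (weak_D u x)" for x
      using order_trans[OF component_le_norm_cart[of "weak_D u x $ \<alpha>" j] Finite_Cartesian_Product.norm_nth_le]
      by (simp add: weak_D_def)
  qed
  have H2: "integrable lborel (\<lambda>x. (H \<alpha> i j x)\<^sup>2)" for \<alpha> i j
  proof -
    have "\<bar>weak_partial i (weak_partial j (\<lambda>y. u y $ \<alpha>)) x\<bar> \<le> norm (weak_D2 u x)" for x
      using order_trans[OF component_le_norm_cart[of "weak_D2 u x $ \<alpha> $ i" j]
        order_trans[OF Finite_Cartesian_Product.norm_nth_le Finite_Cartesian_Product.norm_nth_le]]
      by (simp add: weak_D2_def)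
    from transfer[OF integrable_powr_dominated[OF D2uLp _ D2um this] H] show ?thesis by simp
  qed
  have "hessian_inequality A K"
    unfolding K_def by (rule hessian_inequality_weak[OF wU wG U_int G_int H2 assms(1)]) (use \<nu> in simp)
  then have K [measurable]: "K \<in> borel_measurable borel"
    and ineq: "?\<nu>\<^sup>2 * (LINT x|lborel. (norm (K x))\<^sup>2) \<le> (LINT x|lborel. (norm (tensor_contract A (K x)))\<^sup>2)"
    by (auto simp: hessian_inequality_def)
  \<comment> \<open>There are finitely many index triples, so one null set serves all components of
    the Hessian.\<close>
  have "AE x in lebesgue. \<forall>\<alpha> i j. weak_partial i (weak_partial j (\<lambda>y. u y $ \<alpha>)) x = H \<alpha> i j x"
    using H(2) by (simp add: AE_all_countable)
  then have ae: "AE x in lebesgue. weak_D2 u x = K x"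
    by eventually_elim (simp add: weak_D2_def K_def)
  have D2 [measurable]: "weak_D2 u \<in> borel_measurable lebesgue" using D2uLp by (simp add: in_Lp_def)
  have 1: "Lp_norm 2 (weak_D2 u) = sqrt (LINT x|lborel. (norm (K x))\<^sup>2)"
  proof -
    have "(LINT x|lebesgue. norm (weak_D2 u x) powr 2) = (LINT x|lborel. (norm (K x))\<^sup>2)"
      by (rule integral_borel_representative) (use ae in \<open>auto elim: eventually_mono\<close>)
    then show ?thesis by (simp add: Lp_norm_def powr_half_sqrt Bochner_Integration.integral_nonneg)
  qed
  have 2: "Lp_norm 2 (\<lambda>x. tensor_contract A (weak_D2 u x)) = sqrt (LINT x|lborel. (norm (tensor_contract A (K x)))\<^sup>2)"
  proof -
    have "(LINT x|lebesgue. norm (tensor_contract A (weak_D2 u x)) powr 2) =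
        (LINT x|lborel. (norm (tensor_contract A (K x)))\<^sup>2)"
      by (rule integral_borel_representative) (use ae in \<open>auto elim: eventually_mono\<close>)
    then show ?thesis by (simp add: Lp_norm_def powr_half_sqrt Bochner_Integration.integral_nonneg)
  qed
  \<comment> \<open>Taking roots undoes the squaring; since \<nu> is positive it leaves the root
    unchanged and can then be divided out.\<close>
  have "?\<nu> * sqrt (LINT x|lborel. (norm (K x))\<^sup>2) \<le> sqrt (LINT x|lborel. (norm (tensor_contract A (K x)))\<^sup>2)"
    using real_sqrt_le_mono[OF ineq] \<nu> by (simp add: real_sqrt_mult)
  then show "Lp_norm 2 (weak_D2 u) \<le> 1 / ?\<nu> * Lp_norm 2 (\<lambda>x. tensor_contract A (weak_D2 u x))"
    unfolding 1 2 using \<nu> by (simp add: field_simps)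
qed

end
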